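(* Assume that $\nu:\mathbb{R}\to\mathbb{R}$ is Lipschitz continuous and that there are constants $\kappa,\beta>0$ with $\kappa\le \nu(x)\le \kappa^{-1}$ and $|\nu(x_1)-\nu(x_2)|\le \beta|x_1-x_2|$ for all $x,x_1,x_2\in\mathbb{R}$. Let $\mathbf{u}_h^0,\mathbf{u}_h^1\in\mathbf{V}_h$ and $c_h^0,c_h^1\in\widetilde{H}_h$ be given, and let $(\mathbf{u}_h^{n+1},c_h^{n+1})\in \mathbf{V}_h\times\widetilde H_h$, together with the pressures $p_h^n\in M_h$, $1\le n\le N-1$, be the solution of the decoupled Crank--Nicolson leap-frog (CNLF) scheme (described in the context). Then there is a constant $C>0$, independent of the time step $\tau$ and the mesh size $h$ (and with no upper bound on $\tau$ in terms of $h$ required), such that for all $1\le m\le N-1$ $$\|\mathbf{u}^{m+1}_h\|^2_{L^2} + \| c^{m+1}_h\|^2_{L^2} + \kappa \tau \sum_{n=1}^{N-1} \|\nabla( \mathbf{u}^{n+1}_h+\mathbf{u}^{n-1}_h)\|^2_{L^2}+\theta \tau \sum_{n=1}^{N-1} \|\nabla( c^{n+1}_h+c^{n-1}_h)\|^2_{L^2}$$ $$\leq C \big(\|\mathbf{u}^0_h\|^2_{L^2}+\|\mathbf{u}^1_h\|^2_{L^2}+\|c^0_h\|^2_{L^2}+\|c^1_h\|^2_{L^2}\big) + C \tau \sum_{n=1}^{N} \big( \| \mathbf{f}^n\|^2_{L^2} + |\Omega|\big).$$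
   Context: Setting. $\Omega\subset\mathbb{R}^2$ is a bounded domain with smooth boundary, $|\Omega|$ its measure, $x_2$ the second spatial coordinate, $\mathbf{i}_2$ the second unit coordinate vector. $\theta,g,\gamma,U,\alpha>0$ are given constants, $\nu$ is the concentration-dependent viscosity, $\mathbf{f}$ is a given body force on $\Omega\times[0,T]$. $(\cdot,\cdot)$ is the $L^2(\Omega)$ inner product (scalar, vector or matrix valued). Let $N$ be a positive integer, $\tau=T/N$, $t_n=n\tau$, $\mathbf{f}^n=\mathbf{f}(t_n)\in L^2(\Omega)^2$. Spaces. $\mathbf{V}=H_0^1(\Omega)^2$, $M=L^2_0(\Omega)=\{q\in L^2(\Omega):\int_\Omega q\,dx=0\}$, $\widetilde H=H^1(\Omega)\cap L_0^2(\Omega)$. Let $\mathcal{T}_h$ be a family of quasi-uniform triangulations of $\Omega$ with maximal element diameter $h$. With $P_1(\mathcal K)$ the polynomials of degree at most $1$ on $\mathcal K$ and $b(\mathcal K)$ the (span of the) bubble function on $\mathcal K$, $\mathbf{V}_h=\{\mathbf{v}_h\in C(\overline\Omega)^2\cap\mathbf{V}: \mathbf{v}_h|_{\mathcal K}\in(P_1(\mathcal K)\oplus b(\mathcal K))^2\ \forall \mathcal K\in\mathcal T_h\}$, $M_h=\{q_h\in C(\overline\Omega)\cap H^1(\Omega): q_h|_{\mathcal K}\in P_1(\mathcal K)\ \forall \mathcal K\in\mathcal T_h,\ \int_\Omega q_h\,dx=0\}$, $\widetilde H_h=\{r_h\in C(\overline\Omega)\cap\widetilde H: r_h|_{\mathcal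 K}\in P_1(\mathcal K)\ \forall \mathcal K\in\mathcal T_h\}$. Forms. $A(c,\mathbf{u},\mathbf{v})=(\nu(c+\alpha)\nabla\mathbf{u},\nabla\mathbf{v})$, $B(\mathbf{u},\mathbf{v},\mathbf{w})=\int_\Omega(\mathbf{u}\cdot\nabla\mathbf{v})\cdot\mathbf{w}\,dx+\frac12\int_\Omega(\nabla\cdot\mathbf{u})\,\mathbf{v}\cdot\mathbf{w}\,dx$, $b(\mathbf{u},c,r)=\int_\Omega(\mathbf{u}\cdot\nabla c)\,r\,dx+\frac12\int_\Omega(\nabla\cdot\mathbf{u})\,c\,r\,dx$. CNLF scheme. For $n=1,\dots,N-1$, given the two previous levels, the approximations satisfy, for all $\mathbf{v}_h\in\mathbf{V}_h$, $q_h\in M_h$, $\phi_h\in\widetilde H_h$, $$\Big(\tfrac{\mathbf{u}^{n+1}_h-\mathbf{u}^{n-1}_h}{2\tau},\mathbf{v}_h\Big)+A\Big(c_h^n,\tfrac{\mathbf{u}^{n+1}_h+\mathbf{u}^{n-1}_h}{2},\mathbf{v}_h\Big)+B\Big(\mathbf{u}_h^n,\tfrac{\mathbf{u}^{n+1}_h+\mathbf{u}^{n-1}_h}{2},\mathbf{v}_h\Big)-(p_h^n,\nabla\cdot\mathbf{v}_h)=-(g(1+\gamma c_h^n)\mathbf{i}_2,\mathbf{v}_h)+(\mathbf{f}^n,\mathbf{v}_h),$$ $$\Big(\nabla\cdot\tfrac{\mathbf{u}^{n+1}_h+\mathbf{u}^{n-1}_h}{2},q_h\Big)=0,$$ $$\Big(\tfrac{c^{n+1}_h-c^{n-1}_h}{2\tau},\phi_h\Big)+\theta\Big(\nabla\tfrac{c^{n+1}_h+c^{n-1}_h}{2},\nabla\phi_h\Big)+b\Big(\mathbf{u}_h^n,\tfrac{c^{n+1}_h+c^{n-1}_h}{2},\phi_h\Big)-U\Big(c_h^n,\tfrac{\partial\phi_h}{\partial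 x_2}\Big)=U\alpha\Big(1,\tfrac{\partial\phi_h}{\partial x_2}\Big).$$ Here the pressure unknown of step $n$ is the function $p_h^n$ appearing in the momentum equation. *)

theory Defs
  imports "HOL-Analysis.Analysis"
begin

section \<open>Smooth functions and smooth domains in the plane\<close>

(* Meant for open S. *)
fun Ck_on :: "nat \<Rightarrow> (real^2) set \<Rightarrow> (real^2 \<Rightarrow> real) \<Rightarrow> bool" where
  "Ck_on 0 S f \<longleftrightarrow> continuous_on S f"
| "Ck_on (Suc k) S f \<longleftrightarrow>
     f differentiable_on S \<and>
     (\<forall>i. Ck_on k S (\<lambda>x. frechet_derivative f (at x) (axis i 1)))"

definition smooth_on :: "(real^2) set \<Rightarrow> (real^2 \<Rightarrow> real) \<Rightarrow> bool" where
  "smooth_on S f \<longleftrightarrow> (\<forall>k. Ck_on k S f)"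

definition partial :: "2 \<Rightarrow> (real^2 \<Rightarrow> real) \<Rightarrow> real^2 \<Rightarrow> real" where
  "partial i f x = frechet_derivative f (at x) (axis i 1)"

definition bounded_domain :: "(real^2) set \<Rightarrow> bool" where
  "bounded_domain \<Omega> \<longleftrightarrow> open \<Omega> \<and> connected \<Omega> \<and> \<Omega> \<noteq> {} \<and> bounded \<Omega>"

(* Locally, \<Omega> is a strict sublevel set of a smooth function with nowhere vanishing gradient. *)
definition smooth_boundary :: "(real^2) set \<Rightarrow> bool" where
  "smooth_boundary \<Omega> \<longleftrightarrow>
     (\<forall>z\<in>frontier \<Omega>. \<exists>r>0. \<exists>\<rho>. smooth_on (ball z r) \<rho> \<and> \<rho> z = 0 \<and>
        (\<forall>x\<in>ball z r. \<exists>i. partial i \<rho> x \<noteq> 0) \<and>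
        \<Omega> \<inter> ball z r = {x \<in> ball z r. \<rho> x < 0})"

section \<open>Lebesgue and Sobolev spaces\<close>

(* Elements are representatives; only their values on \<Omega>, up to null sets, matter. *)

definition L2 :: "(real^2) set \<Rightarrow> (real^2 \<Rightarrow> 'b::euclidean_space) set" where
  "L2 \<Omega> = {u \<in> borel_measurable (lebesgue_on \<Omega>).
             integrable (lebesgue_on \<Omega>) (\<lambda>x. (norm (u x))\<^sup>2)}"

(* For matrix-valued functions \<bullet> is the Frobenius inner product. *)
definition L2_inner ::
    "(real^2) set \<Rightarrow> (real^2 \<Rightarrow> 'b::euclidean_space) \<Rightarrow> (real^2 \<Rightarrow> 'b) \<Rightarrow> real" where
  "L2_inner \<Omega> u v = (LINT x|lebesgue_on \<Omega>. u x \<bullet> v x)"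

definition L2_norm :: "(real^2) set \<Rightarrow> (real^2 \<Rightarrow> 'b::euclidean_space) \<Rightarrow> real" where
  "L2_norm \<Omega> u = sqrt (L2_inner \<Omega> u u)"

definition test_functions :: "(real^2) set \<Rightarrow> (real^2 \<Rightarrow> real) set" where
  "test_functions \<Omega> =
     {\<phi>. smooth_on UNIV \<phi> \<and> compact (closure {x. \<phi> x \<noteq> 0}) \<and> closure {x. \<phi> x \<noteq> 0} \<subseteq> \<Omega>}"

definition is_weak_grad ::
    "(real^2) set \<Rightarrow> (real^2 \<Rightarrow> real) \<Rightarrow> (real^2 \<Rightarrow> real^2) \<Rightarrow> bool" where
  "is_weak_grad \<Omega> u G \<longleftrightarrow> G \<in> L2 \<Omega> \<and>
     (\<forall>\<phi>\<in>test_functions \<Omega>. \<forall>i.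
        (LINT x|lebesgue_on \<Omega>. u x * partial i \<phi> x) = - (LINT x|lebesgue_on \<Omega>. G x $ i * \<phi> x))"

definition H1 :: "(real^2) set \<Rightarrow> (real^2 \<Rightarrow> real) set" where
  "H1 \<Omega> = {u \<in> L2 \<Omega>. \<exists>G. is_weak_grad \<Omega> u G}"

(* The weak gradient is unique almost everywhere, so the choice of representative is immaterial. *)
definition weak_grad :: "(real^2) set \<Rightarrow> (real^2 \<Rightarrow> real) \<Rightarrow> real^2 \<Rightarrow> real^2" where
  "weak_grad \<Omega> u = (SOME G. is_weak_grad \<Omega> u G)"

definition H1_norm :: "(real^2) set \<Rightarrow> (real^2 \<Rightarrow> real) \<Rightarrow> real" where
  "H1_norm \<Omega> u = sqrt ((L2_norm \<Omega> u)\<^sup>2 + (L2_norm \<Omega> (weak_grad \<Omega> u))\<^sup>2)"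

definition H10 :: "(real^2) set \<Rightarrow> (real^2 \<Rightarrow> real) set" where
  "H10 \<Omega> = {u \<in> H1 \<Omega>. \<exists>\<phi>. (\<forall>k::nat. \<phi> k \<in> test_functions \<Omega>) \<and>
                (\<lambda>k. H1_norm \<Omega> (\<lambda>x. u x - \<phi> k x)) \<longlonglongrightarrow> 0}"

definition L20 :: "(real^2) set \<Rightarrow> (real^2 \<Rightarrow> real) set" where
  "L20 \<Omega> = {q \<in> L2 \<Omega>. (LINT x|lebesgue_on \<Omega>. q x) = 0}"

definition H_tilde :: "(real^2) set \<Rightarrow> (real^2 \<Rightarrow> real) set" where
  "H_tilde \<Omega> = H1 \<Omega> \<inter> L20 \<Omega>"

definition V_space :: "(real^2) set \<Rightarrow> (real^2 \<Rightarrow> real^2) set" where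
  "V_space \<Omega> = {v. \<forall>i. (\<lambda>x. v x $ i) \<in> H10 \<Omega>}"

(* Row i is the gradient of the i-th component. *)
definition weak_jac :: "(real^2) set \<Rightarrow> (real^2 \<Rightarrow> real^2) \<Rightarrow> real^2 \<Rightarrow> real^2^2" where
  "weak_jac \<Omega> u x = (\<chi> i. weak_grad \<Omega> (\<lambda>y. u y $ i) x)"

definition weak_div :: "(real^2) set \<Rightarrow> (real^2 \<Rightarrow> real^2) \<Rightarrow> real^2 \<Rightarrow> real" where
  "weak_div \<Omega> u x = trace (weak_jac \<Omega> u x)"

section \<open>Triangulations and finite element spaces\<close>

definition ref_triangle :: "(real^2) set" where
  "ref_triangle = convex hull {0, axis 1 1, axis 2 1}"

(* A domain with smooth boundary is not a union of straight triangles: elements touching the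
   boundary along an edge may have that edge curved.  An element is therefore given by its
   parametrization F over the reference triangle, a C^1 diffeomorphism up to the boundary;
   the element itself is F ` ref_triangle. *)
definition element_map :: "(real^2 \<Rightarrow> real^2) \<Rightarrow> bool" where
  "element_map F \<longleftrightarrow> inj_on F ref_triangle \<and>
     (\<exists>S. open S \<and> ref_triangle \<subseteq> S \<and> (\<forall>i. Ck_on 1 S (\<lambda>y. F y $ i)) \<and>
          (\<forall>y\<in>S. inj (frechet_derivative F (at y))))"

definition ref_edge :: "(real^2) set \<Rightarrow> bool" where
  "ref_edge e \<longleftrightarrow> e face_of ref_triangle \<and> aff_dim e = 1"

(* Only edges lying on the boundary may be curved; an element without such an edge is an
   affinely parametrized straight triangle. *)
definition fitted_element :: "(real^2) set \<Rightarrow> (real^2 \<Rightarrow> real^2) \<Rightarrow> bool" where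
  "fitted_element \<Omega> F \<longleftrightarrow> element_map F \<and>
     (\<forall>e. ref_edge e \<longrightarrow> F ` e \<subseteq> frontier \<Omega> \<or> (\<exists>a b. F ` e = closed_segment a b)) \<and>
     ((\<forall>e. ref_edge e \<longrightarrow> \<not> F ` e \<subseteq> frontier \<Omega>) \<longrightarrow>
        (\<exists>(A::real^2^2) d. \<forall>y\<in>ref_triangle. F y = A *v y + d))"

(* Distinct elements meet in the empty set, a common vertex or a common edge. *)
definition triangulation :: "(real^2) set \<Rightarrow> (real^2 \<Rightarrow> real^2) set \<Rightarrow> bool" where
  "triangulation \<Omega> \<T> \<longleftrightarrow> finite \<T> \<and>
     (\<forall>F\<in>\<T>. fitted_element \<Omega> F) \<and>
     (\<Union>F\<in>\<T>. F ` ref_triangle) = closure \<Omega> \<and>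
     (\<forall>F\<in>\<T>. \<forall>G\<in>\<T>. F \<noteq> G \<longrightarrow>
        (\<exists>s t. s face_of ref_triangle \<and> s \<noteq> ref_triangle \<and>
               t face_of ref_triangle \<and> t \<noteq> ref_triangle \<and>
               F ` ref_triangle \<inter> G ` ref_triangle = F ` s \<and> F ` s = G ` t))"

definition mesh_size :: "(real^2 \<Rightarrow> real^2) set \<Rightarrow> real" where
  "mesh_size \<T> = Max ((\<lambda>F. diameter (F ` ref_triangle)) ` \<T>)"

(* A family \<T> h, indexed by its mesh sizes h \<in> I, with inradii uniformly comparable to h. *)
definition quasi_uniform_family ::
    "(real^2) set \<Rightarrow> real set \<Rightarrow> (real \<Rightarrow> (real^2 \<Rightarrow> real^2) set) \<Rightarrow> bool" where
  "quasi_uniform_family \<Omega> I \<T> \<longleftrightarrow>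
     (\<forall>h\<in>I. h > 0 \<and> triangulation \<Omega> (\<T> h) \<and> mesh_size (\<T> h) = h) \<and>
     (\<exists>\<sigma>>0. \<forall>h\<in>I. \<forall>F\<in>\<T> h. \<exists>z. ball z (\<sigma> * h) \<subseteq> F ` ref_triangle)"

definition P1 :: "(real^2 \<Rightarrow> real) set" where
  "P1 = {w. \<exists>a d. \<forall>x. w x = a \<bullet> x + d}"

(* On a straight triangle this is 27 times the product of the barycentric coordinates. *)
definition bubble :: "(real^2 \<Rightarrow> real^2) \<Rightarrow> real^2 \<Rightarrow> real" where
  "bubble F x = (let y = inv_into ref_triangle F x in 27 * y $ 1 * y $ 2 * (1 - y $ 1 - y $ 2))"

definition V_h ::
    "(real^2) set \<Rightarrow> (real^2 \<Rightarrow> real^2) set \<Rightarrow> (real^2 \<Rightarrow> real^2) set" where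
  "V_h \<Omega> \<T> = {v \<in> V_space \<Omega>. continuous_on (closure \<Omega>) v \<and>
     (\<forall>F\<in>\<T>. \<forall>i. \<exists>w\<in>P1. \<exists>d. \<forall>x\<in>F ` ref_triangle. v x $ i = w x + d * bubble F x)}"

definition M_h ::
    "(real^2) set \<Rightarrow> (real^2 \<Rightarrow> real^2) set \<Rightarrow> (real^2 \<Rightarrow> real) set" where
  "M_h \<Omega> \<T> = {q \<in> H1 \<Omega>. continuous_on (closure \<Omega>) q \<and>
     (\<forall>F\<in>\<T>. \<exists>w\<in>P1. \<forall>x\<in>F ` ref_triangle. q x = w x) \<and>
     (LINT x|lebesgue_on \<Omega>. q x) = 0}"

definition H_tilde_h ::
    "(real^2) set \<Rightarrow> (real^2 \<Rightarrow> real^2) set \<Rightarrow> (real^2 \<Rightarrow> real) set" where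
  "H_tilde_h \<Omega> \<T> = {r \<in> H_tilde \<Omega>. continuous_on (closure \<Omega>) r \<and>
     (\<forall>F\<in>\<T>. \<exists>w\<in>P1. \<forall>x\<in>F ` ref_triangle. r x = w x)}"

section \<open>Forms and the CNLF scheme\<close>

definition form_A ::
    "(real^2) set \<Rightarrow> (real \<Rightarrow> real) \<Rightarrow> real \<Rightarrow> (real^2 \<Rightarrow> real) \<Rightarrow>
     (real^2 \<Rightarrow> real^2) \<Rightarrow> (real^2 \<Rightarrow> real^2) \<Rightarrow> real" where
  "form_A \<Omega> \<nu> \<alpha> c u v =
     L2_inner \<Omega> (\<lambda>x. \<nu> (c x + \<alpha>) *\<^sub>R weak_jac \<Omega> u x) (weak_jac \<Omega> v)"

definition form_B ::
    "(real^2) set \<Rightarrow> (real^2 \<Rightarrow> real^2) \<Rightarrow> (real^2 \<Rightarrow> real^2) \<Rightarrow> (real^2 \<Rightarrow> real^2) \<Rightarrow> real" where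
  "form_B \<Omega> u v w =
     (LINT x|lebesgue_on \<Omega>. (weak_jac \<Omega> v x *v u x) \<bullet> w x) +
     1/2 * (LINT x|lebesgue_on \<Omega>. weak_div \<Omega> u x * (v x \<bullet> w x))"

definition form_b ::
    "(real^2) set \<Rightarrow> (real^2 \<Rightarrow> real^2) \<Rightarrow> (real^2 \<Rightarrow> real) \<Rightarrow> (real^2 \<Rightarrow> real) \<Rightarrow> real" where
  "form_b \<Omega> u c r =
     (LINT x|lebesgue_on \<Omega>. (u x \<bullet> weak_grad \<Omega> c x) * r x) +
     1/2 * (LINT x|lebesgue_on \<Omega>. weak_div \<Omega> u x * c x * r x)"

definition mean :: "(real^2 \<Rightarrow> 'b::real_vector) \<Rightarrow> (real^2 \<Rightarrow> 'b) \<Rightarrow> real^2 \<Rightarrow> 'b" where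
  "mean v w x = (1/2) *\<^sub>R (v x + w x)"

definition central_diff ::
    "real \<Rightarrow> (real^2 \<Rightarrow> 'b::real_vector) \<Rightarrow> (real^2 \<Rightarrow> 'b) \<Rightarrow> real^2 \<Rightarrow> 'b" where
  "central_diff \<tau> v w x = (1 / (2 * \<tau>)) *\<^sub>R (v x - w x)"

(* f n is the body force at time level n. *)
definition cnlf_solution ::
    "(real^2) set \<Rightarrow> (real^2 \<Rightarrow> real^2) set \<Rightarrow> (real \<Rightarrow> real) \<Rightarrow> real \<Rightarrow> real \<Rightarrow> real \<Rightarrow> real \<Rightarrow> real \<Rightarrow>
     real \<Rightarrow> nat \<Rightarrow> (nat \<Rightarrow> real^2 \<Rightarrow> real^2) \<Rightarrow>
     (nat \<Rightarrow> real^2 \<Rightarrow> real^2) \<Rightarrow> (nat \<Rightarrow> real^2 \<Rightarrow> real) \<Rightarrow> (nat \<Rightarrow> real^2 \<Rightarrow> real) \<Rightarrow> bool" where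
  "cnlf_solution \<Omega> \<T> \<nu> \<theta> g \<gamma> U \<alpha> \<tau> N f u c p \<longleftrightarrow>
     (\<forall>n\<in>{1..N-1}. u (n+1) \<in> V_h \<Omega> \<T> \<and> c (n+1) \<in> H_tilde_h \<Omega> \<T> \<and> p n \<in> M_h \<Omega> \<T>) \<and>
     (\<forall>n\<in>{1..N-1}.
        (\<forall>v\<in>V_h \<Omega> \<T>.
           L2_inner \<Omega> (central_diff \<tau> (u (n+1)) (u (n-1))) v
           + form_A \<Omega> \<nu> \<alpha> (c n) (mean (u (n+1)) (u (n-1))) v
           + form_B \<Omega> (u n) (mean (u (n+1)) (u (n-1))) v
           - L2_inner \<Omega> (p n) (weak_div \<Omega> v)
           = - L2_inner \<Omega> (\<lambda>x. (g * (1 + \<gamma> * c n x)) *\<^sub>R axis 2 1) v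
             + L2_inner \<Omega> (f n) v) \<and>
        (\<forall>q\<in>M_h \<Omega> \<T>.
           L2_inner \<Omega> (weak_div \<Omega> (mean (u (n+1)) (u (n-1)))) q = 0) \<and>
        (\<forall>\<phi>\<in>H_tilde_h \<Omega> \<T>.
           L2_inner \<Omega> (central_diff \<tau> (c (n+1)) (c (n-1))) \<phi>
           + \<theta> * L2_inner \<Omega> (weak_grad \<Omega> (mean (c (n+1)) (c (n-1)))) (weak_grad \<Omega> \<phi>)
           + form_b \<Omega> (u n) (mean (c (n+1)) (c (n-1))) \<phi>
           - U * L2_inner \<Omega> (c n) (\<lambda>x. weak_grad \<Omega> \<phi> x $ 2)
           = U * \<alpha> * L2_inner \<Omega> (\<lambda>x. 1) (\<lambda>x. weak_grad \<Omega> \<phi> x $ 2)))"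

end

theory Submission
  imports Defs
begin

text \<open>
  Testing the momentum and the concentration equation with the means of the levels
  \<open>n + 1\<close> and \<open>n - 1\<close> makes the convective terms vanish by skew symmetry
  and the pressure term by the discrete incompressibility constraint.  The concentration
  estimate involves only \<open>c n\<close> on the right, so the quantity
  \<open>\<parallel>c n\<parallel>\<^sup>2 + \<parallel>c (n + 1)\<parallel>\<^sup>2\<close> obeys an explicit Gronwall recursion without any restriction
  on the time step.  Once the concentration is bounded, the velocity estimate
  \<open>x\<^sup>2 - y\<^sup>2 + \<dots> \<le> 2 \<tau> F (x + y)\<close>, where \<open>x\<close> and \<open>y\<close> are the norms at the levels
  \<open>n + 1\<close> and \<open>n - 1\<close>, can be divided by \<open>x + y\<close>, which again avoids an implicit Gronwall
  argument.

  The skew symmetry needs \<open>c\<^sup>2\<close> to have the weak gradient \<open>2 c \<nabla>c\<close> for continuous \<open>c\<close>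
  in \<open>H1\<close>.  Instead of mollifying, the function
  \<open>s \<mapsto> \<integral> \<psi>(x) c(x) c(x - s e) dx\<close> is differentiated at \<open>0\<close> in two ways, according to which factor
  \<open>c\<close> is replaced by smooth approximations.
\<close>

section \<open>Smooth functions and test functions\<close>

text \<open>Two obstacles shape the analytic part. \<open>weak_grad\<close> is an arbitrary choice
  of representative, so even its linearity holds only almost everywhere and rests on uniqueness,
  which comes from the fundamental lemma of the calculus of variations. And the discrete velocity is
  not pointwise divergence free: the halves of \<open>weak_div\<close> in \<open>form_B\<close> and
  \<open>form_b\<close> compensate for this, but cancelling them against the transport terms
  requires the product rule for squares. Continuity on \<open>closure \<Omega>\<close> makes
  discrete functions bounded, so that \<open>c * c\<close> and \<open>c\<close> times its gradient
  lie in L2 without any Sobolev embedding. The time step is unrestricted because the source of the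
  concentration equation and the buoyancy sit at the explicit middle level \<open>n\<close>; the
  former is in divergence form and is paid for by half of the diffusion. The final constant is a
  value of \<open>leapfrog_const\<close>, which sees only \<open>T\<close> and the coefficients of
  the two energy estimates, hence neither the mesh nor \<open>N\<close>.\<close>

lemma Ck_on_SucI:
  assumes "\<And>x. (f has_derivative D x) (at x)" "\<And>i. Ck_on k UNIV (\<lambda>x. D x (axis i 1))"
  shows "Ck_on (Suc k) UNIV f"
proof -
  have "frechet_derivative f (at x) = D x" for x
    using frechet_derivative_at[OF assms(1)] by simp
  then show ?thesis
    using assms by (auto simp: differentiable_on_def differentiable_def)
qed

lemma Ck_on_SucD:
  assumes "Ck_on (Suc k) UNIV f"
  shows "(f has_derivative frechet_derivative f (at x)) (at x)"
  using assms frechet_derivative_works by (auto simp: differentiable_on_def)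

lemma Ck_on_Suc_imp_Ck_on: "Ck_on (Suc k) UNIV f \<Longrightarrow> Ck_on k UNIV f"
  by (induction k arbitrary: f) (auto intro: differentiable_imp_continuous_on)

lemma Ck_on_const: "Ck_on k UNIV (\<lambda>x. c)"
proof (induction k arbitrary: c)
  case (Suc k)
  then show ?case by (intro Ck_on_SucI[where D="\<lambda>x h. 0"]) auto
qed auto

lemma Ck_on_add: "Ck_on k UNIV f \<Longrightarrow> Ck_on k UNIV g \<Longrightarrow> Ck_on k UNIV (\<lambda>x. f x + g x)"
proof (induction k arbitrary: f g)
  case (Suc k)
  then show ?case
    by (intro Ck_on_SucI[OF has_derivative_add[OF Ck_on_SucD Ck_on_SucD]]) auto
qed (auto intro: continuous_intros)

text \<open>The derivative of a product contains the undifferentiated factors, so the induction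
  needs these at the lower order as well; this is what \<open>Ck_on_Suc_imp_Ck_on\<close> is
  for.\<close>

lemma Ck_on_mult: "Ck_on k UNIV f \<Longrightarrow> Ck_on k UNIV g \<Longrightarrow> Ck_on k UNIV (\<lambda>x. f x * g x)"
proof (induction k arbitrary: f g)
  case (Suc k)
  show ?case
    by (intro Ck_on_SucI[OF has_derivative_mult[OF Ck_on_SucD[OF Suc.prems(1)] Ck_on_SucD[OF Suc.prems(2)]]]
        Ck_on_add Suc.IH Ck_on_Suc_imp_Ck_on[OF Suc.prems(1)] Ck_on_Suc_imp_Ck_on[OF Suc.prems(2)])
      (use Suc.prems in auto)
qed (auto intro: continuous_intros)

lemma has_derivative_shift:
  fixes f :: "'a::real_normed_vector \<Rightarrow> 'b::real_normed_vector"
  assumes "(f has_derivative D) (at (x + a))"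
  shows "((\<lambda>x. f (x + a)) has_derivative D) (at x)"
proof -
  have "((\<lambda>x. x + a) has_derivative (\<lambda>h. h)) (at x)"
    by (auto intro!: derivative_eq_intros)
  from has_derivative_compose[OF this assms] show ?thesis .
qed

lemma Ck_on_shift: "Ck_on k UNIV f \<Longrightarrow> Ck_on k UNIV (\<lambda>x. f (x + a))"
proof (induction k arbitrary: f)
  case 0
  then show ?case by (auto intro!: continuous_on_compose2[of UNIV f] continuous_intros)
next
  case (Suc k)
  then show ?case
    by (intro Ck_on_SucI[OF has_derivative_shift[OF Ck_on_SucD[OF Suc.prems]]]) auto
qed

lemma Ck_on_component: "Ck_on k UNIV (\<lambda>x. x $ j)"
proof (cases k)
  case (Suc k)
  have "((\<lambda>x::real^2. x $ j) has_derivative (\<lambda>h. h $ j)) (at x)" for x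
    by (rule bounded_linear_imp_has_derivative[OF bounded_linear_vec_nth])
  then show ?thesis unfolding Suc by (rule Ck_on_SucI) (rule Ck_on_const)
qed (auto intro: continuous_intros)

lemma smooth_on_has_derivative:
  "smooth_on UNIV f \<Longrightarrow> (f has_derivative frechet_derivative f (at x)) (at x)"
  unfolding smooth_on_def using Ck_on_SucD by blast

lemma smooth_on_partial: "smooth_on UNIV f \<Longrightarrow> smooth_on UNIV (partial i f)"
  unfolding smooth_on_def partial_def[abs_def] by (metis Ck_on.simps(2))

lemma smooth_on_continuous: "smooth_on UNIV f \<Longrightarrow> continuous_on A f"
  unfolding smooth_on_def by (metis Ck_on.simps(1) continuous_on_subset subset_UNIV)

lemma smooth_on_const: "smooth_on UNIV (\<lambda>x. c)"
  by (simp add: smooth_on_def Ck_on_const)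

lemma smooth_on_add: "smooth_on UNIV f \<Longrightarrow> smooth_on UNIV g \<Longrightarrow> smooth_on UNIV (\<lambda>x. f x + g x)"
  by (simp add: smooth_on_def Ck_on_add)

lemma smooth_on_mult: "smooth_on UNIV f \<Longrightarrow> smooth_on UNIV g \<Longrightarrow> smooth_on UNIV (\<lambda>x. f x * g x)"
  by (simp add: smooth_on_def Ck_on_mult)

lemma smooth_on_shift: "smooth_on UNIV f \<Longrightarrow> smooth_on UNIV (\<lambda>x. f (x + a))"
  by (simp add: smooth_on_def Ck_on_shift)

lemma partial_eqI: "(f has_derivative D) (at x) \<Longrightarrow> partial i f x = D (axis i 1)"
  unfolding partial_def using frechet_derivative_at by metis

lemma partial_mult:
  "smooth_on UNIV f \<Longrightarrow> smooth_on UNIV g \<Longrightarrow>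
    partial i (\<lambda>x. f x * g x) x = f x * partial i g x + partial i f x * g x"
  using partial_eqI[OF has_derivative_mult[OF smooth_on_has_derivative smooth_on_has_derivative]]
  by (simp add: partial_def)

lemma partial_shift:
  "smooth_on UNIV f \<Longrightarrow> partial i (\<lambda>x. f (x + a)) x = partial i f (x + a)"
  using partial_eqI[OF has_derivative_shift[OF smooth_on_has_derivative]]
  by (simp add: partial_def)

text \<open>Since \<open>axis i r = r * axis i 1\<close>, the cases \<open>r = 1\<close> and \<open>r = -1\<close> cover both directions of translation.\<close>

lemma smooth_on_DERIV_line:
  assumes "smooth_on UNIV f"
  shows "((\<lambda>s. f (x + s *\<^sub>R axis i r)) has_real_derivative r * partial i f (x + s *\<^sub>R axis i r)) (at s within S)"
proof -
  let ?D = "frechet_derivative f (at (x + s *\<^sub>R axis i r))"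
  have D: "(f has_derivative ?D) (at (x + s *\<^sub>R axis i r))"
    by (rule smooth_on_has_derivative[OF assms])
  have "((\<lambda>s. x + s *\<^sub>R axis i r) has_derivative (\<lambda>h. h *\<^sub>R axis i r)) (at s within S)"
    by (auto intro!: derivative_eq_intros)
  from has_derivative_compose[OF this D]
  have "((\<lambda>s. f (x + s *\<^sub>R axis i r)) has_derivative (\<lambda>h. ?D (h *\<^sub>R axis i r))) (at s within S)" .
  moreover have "?D (h *\<^sub>R axis i r) = r * partial i f (x + s *\<^sub>R axis i r) * h" for h
  proof -
    have "h *\<^sub>R axis i r = (h * r) *\<^sub>R (axis i 1 :: real^2)"
      by (simp add: vec_eq_iff axis_def)
    then show ?thesis
      using linear_cmul[OF has_derivative_linear[OF D], of "h*r" "axis i 1"]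
      by (simp add: partial_def)
  qed
  ultimately show ?thesis
    by (simp add: has_field_derivative_def)
qed

text \<open>Stone-Weierstrass for the algebra of smooth functions, whose coordinate functions
  separate points. Derivatives of the approximants are not controlled; in the product rule below
  they are therefore moved onto other factors before the limit is taken.\<close>

lemma smooth_approximation:
  assumes "compact K" "continuous_on K (f :: real^2 \<Rightarrow> real)"
  obtains g where "\<And>n::nat. smooth_on UNIV (g n)"
    "\<And>n x. x \<in> K \<Longrightarrow> \<bar>f x - g n x\<bar> < 1 / Suc n"
proof -
  interpret function_ring_on "Collect (smooth_on UNIV)" K
  proof
    fix x y :: "real^2" assume "x \<noteq> y"
    then obtain j where "x $ j \<noteq> y $ j" by (auto simp: vec_eq_iff)
    then show "\<exists>f\<in>Collect (smooth_on UNIV). f x \<noteq> f y"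
      by (intro bexI[of _ "\<lambda>x. x $ j"]) (auto simp: smooth_on_def Ck_on_component)
  qed (auto simp: assms smooth_on_continuous smooth_on_const smooth_on_add smooth_on_mult)
  have "\<forall>n. \<exists>g. smooth_on UNIV g \<and> (\<forall>x\<in>K. \<bar>f x - g x\<bar> < 1 / real (Suc n))"
    using Stone_Weierstrass_basic[OF assms(2)] by fastforce
  then show ?thesis
    using that by metis
qed

section \<open>Smooth functions positive exactly on a box\<close>

definition cutoff :: "nat \<Rightarrow> real \<Rightarrow> real" where
  "cutoff k t = (if 0 < t then (1/t)^k * exp (- (1/t)) else 0)"

text \<open>For \<open>k = 0\<close> this is the classical flat function exp(-1/t). The factor
  (1/t)^k is carried along because the family is then closed under differentiation, so that
  smoothness of all members follows by one induction with \<open>k\<close> arbitrary.\<close>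

lemma cutoff_DERIV:
  "(cutoff k has_real_derivative cutoff (k+2) t - real k * cutoff (k+1) t) (at t)"
proof (cases t "0::real" rule: linorder_cases)
  case less
  have "((\<lambda>t. 0) has_real_derivative 0) (at t)" by simp
  then have "(cutoff k has_real_derivative 0) (at t)"
    by (rule has_field_derivative_transform_within_open[of _ _ _ "{..<0}"]) (use less in \<open>auto simp: cutoff_def\<close>)
  then show ?thesis using less by (simp add: cutoff_def)
next
  case greater
  have "((\<lambda>t. (1/t)^k * exp (- (1/t))) has_real_derivative cutoff (k+2) t - real k * cutoff (k+1) t) (at t)"
  proof -
    have i: "((\<lambda>t. 1/t) has_real_derivative - ((1/t)\<^sup>2)) (at t)"
      using greater by (auto intro!: derivative_eq_intros simp: power2_eq_square)
    have e: "((\<lambda>t. exp (- (1/t))) has_real_derivative exp (- (1/t)) * (1/t)\<^sup>2) (at t)"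
      using DERIV_chain2[OF DERIV_exp DERIV_minus[OF i]] by simp
    show ?thesis
      using DERIV_mult[OF DERIV_power[OF i, of k] e] greater
      by (cases k) (simp_all add: cutoff_def algebra_simps power2_eq_square)
  qed
  then show ?thesis
    by (rule has_field_derivative_transform_within_open[of _ _ _ "{0<..}"]) (use greater in \<open>auto simp: cutoff_def\<close>)
next
  case equal
  \<comment> \<open>With s = 1/h the right difference quotient at 0 becomes s^(k+1) exp(-s), so the
    exponential beating powers at infinity settles the critical point.\<close>
  have "((\<lambda>x::real. x^(k+1) / exp x) \<longlongrightarrow> 0) at_top"
    by (rule tendsto_power_div_exp_0)
  from filterlim_compose[OF this filterlim_inverse_at_top_right]
  have "((\<lambda>h. (inverse h)^(k+1) / exp (inverse h)) \<longlongrightarrow> (0::real)) (at_right 0)" .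
  then have "((\<lambda>h. cutoff k h / h) \<longlongrightarrow> 0) (at_right 0)"
  proof (rule Lim_transform_eventually)
    show "\<forall>\<^sub>F h in at_right 0. (inverse h)^(k+1) / exp (inverse h) = cutoff k h / h"
      unfolding eventually_at_filter by (auto simp: cutoff_def exp_minus field_simps)
  qed
  moreover have "((\<lambda>h. cutoff k h / h) \<longlongrightarrow> 0) (at_left 0)"
  proof (rule Lim_transform_eventually)
    show "\<forall>\<^sub>F h in at_left 0. 0 = cutoff k h / h"
      unfolding eventually_at_filter by (auto simp: cutoff_def)
  qed simp
  ultimately have "((\<lambda>h. cutoff k h / h) \<longlongrightarrow> 0) (at 0)"
    by (simp add: filterlim_split_at)
  then show ?thesis
    using equal by (simp add: cutoff_def has_field_derivative_iff)
qed

lemma smooth_on_cutoff: "smooth_on UNIV (\<lambda>x. cutoff k (b \<bullet> x + d))"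
proof -
  have "Ck_on n UNIV (\<lambda>x. cutoff k (b \<bullet> x + d))" for n
  proof (induction n arbitrary: k)
    case 0
    have "continuous_on UNIV (cutoff k)"
      by (meson cutoff_DERIV DERIV_isCont continuous_at_imp_continuous_on)
    then show ?case
      by (auto intro!: continuous_on_compose2[of UNIV "cutoff k"] continuous_intros)
  next
    case (Suc n)
    have D: "((\<lambda>x. cutoff k (b \<bullet> x + d)) has_derivative
       (\<lambda>h. (b \<bullet> h) * (cutoff (k+2) (b \<bullet> x + d) + (- real k) * cutoff (k+1) (b \<bullet> x + d)))) (at x)" for x
    proof -
      have "((\<lambda>x. b \<bullet> x + d) has_derivative (\<lambda>h. b \<bullet> h)) (at x)"
        by (auto intro!: derivative_eq_intros)
      from has_derivative_compose[OF this cutoff_DERIV[of k "b \<bullet> x + d", unfolded has_field_derivative_def]]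
      show ?thesis by (simp add: mult.commute)
    qed
    show ?case
      by (rule Ck_on_SucI[OF D]) (intro Ck_on_mult Ck_on_add Ck_on_const Suc.IH)
  qed
  then show ?thesis by (simp add: smooth_on_def)
qed

text \<open>Being positive on the whole open box, it can be rescaled to approximate the indicator of
  that box; no plateau has to be built in.\<close>

definition box_bump :: "real^2 \<Rightarrow> real^2 \<Rightarrow> real^2 \<Rightarrow> real" where
  "box_bump a b x = cutoff 0 (x$1 - a$1) * cutoff 0 (b$1 - x$1) * (cutoff 0 (x$2 - a$2) * cutoff 0 (b$2 - x$2))"

lemma smooth_on_box_bump: "smooth_on UNIV (box_bump a b)"
proof -
  have "x$i - a$i = axis i 1 \<bullet> x + - a$i" "b$i - x$i = axis i (-1) \<bullet> x + b$i" for x :: "real^2" and i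
    by (simp_all add: inner_axis inner_commute)
  then show ?thesis
    unfolding box_bump_def[abs_def] by (simp only:) (intro smooth_on_mult smooth_on_cutoff)
qed

lemma box_bump_pos_iff: "box_bump a b x > 0 \<longleftrightarrow> x \<in> box a b"
  by (auto simp: box_bump_def cutoff_def mem_box_cart forall_2)

lemma box_bump_nonneg: "box_bump a b x \<ge> 0"
  by (simp add: box_bump_def cutoff_def)

lemma test_functionsI:
  assumes "smooth_on UNIV \<psi>" "compact K" "K \<subseteq> \<Omega>" "\<And>x. x \<notin> K \<Longrightarrow> \<psi> x = 0"
  shows "\<psi> \<in> test_functions \<Omega>"
proof -
  have "closure {x. \<psi> x \<noteq> 0} \<subseteq> K"
    using assms by (intro closure_minimal compact_imp_closed) auto
  moreover from this have "compact (closure {x. \<psi> x \<noteq> 0})"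
    using compact_Int_closed[OF assms(2) closed_closure, of "{x. \<psi> x \<noteq> 0}"] by (simp add: Int_absorb1)
  ultimately show ?thesis
    using assms by (auto simp: test_functions_def)
qed

lemma smooth_mult_test_functions:
  assumes "\<psi> \<in> test_functions \<Omega>" "smooth_on UNIV \<eta>"
  shows "(\<lambda>x. \<psi> x * \<eta> x) \<in> test_functions \<Omega>"
proof (rule test_functionsI)
  show "\<psi> x * \<eta> x = 0" if "x \<notin> closure {x. \<psi> x \<noteq> 0}" for x
    using that closure_subset[of "{x. \<psi> x \<noteq> 0}"] by auto
qed (use assms in \<open>auto simp: test_functions_def smooth_on_mult\<close>)

lemma box_bump_test_functions:
  assumes "cbox a b \<subseteq> \<Omega>"
  shows "box_bump a b \<in> test_functions \<Omega>"
proof (rule test_functionsI[OF smooth_on_box_bump compact_cbox assms])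
  show "box_bump a b x = 0" if "x \<notin> cbox a b" for x
    using that box_bump_nonneg[of a b x] box_bump_pos_iff[of a b x] box_subset_cbox[of a b]
    by (auto simp: less_le)
qed

section \<open>Uniqueness of weak gradients\<close>

lemma L2_measurable: "u \<in> L2 \<Omega> \<Longrightarrow> u \<in> borel_measurable (lebesgue_on \<Omega>)"
  by (simp add: L2_def)

lemma L2_inner_integrable:
  assumes "u \<in> L2 \<Omega>" "v \<in> L2 \<Omega>"
  shows "integrable (lebesgue_on \<Omega>) (\<lambda>x. u x \<bullet> v x)"
proof (rule Bochner_Integration.integrable_bound)
  show "integrable (lebesgue_on \<Omega>) (\<lambda>x. (norm (u x))\<^sup>2 + (norm (v x))\<^sup>2)"
    using assms by (auto simp: L2_def)
  show "AE x in lebesgue_on \<Omega>. norm (u x \<bullet> v x) \<le> norm ((norm (u x))\<^sup>2 + (norm (v x))\<^sup>2)"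
  proof (rule AE_I2)
    fix x
    have "\<bar>u x \<bullet> v x\<bar> \<le> norm (u x) * norm (v x)" by (rule Cauchy_Schwarz_ineq2)
    also have "\<dots> \<le> (norm (u x))\<^sup>2 + (norm (v x))\<^sup>2"
      using sum_squares_bound[of "norm (u x)" "norm (v x)"] mult_nonneg_nonneg[OF norm_ge_zero norm_ge_zero, of "u x" "v x"]
      by linarith
    finally show "norm (u x \<bullet> v x) \<le> norm ((norm (u x))\<^sup>2 + (norm (v x))\<^sup>2)" by simp
  qed
qed (use assms[THEN L2_measurable] in measurable)

lemma L2_mult_integrable:
  fixes u v :: "real^2 \<Rightarrow> real"
  shows "u \<in> L2 \<Omega> \<Longrightarrow> v \<in> L2 \<Omega> \<Longrightarrow> integrable (lebesgue_on \<Omega>) (\<lambda>x. u x * v x)"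
  using L2_inner_integrable[of u \<Omega> v] by simp

lemma L2_scaleR: "u \<in> L2 \<Omega> \<Longrightarrow> (\<lambda>x. a *\<^sub>R u x) \<in> L2 \<Omega>"
  by (auto simp: L2_def power_mult_distrib)

lemma L2_add: 
  assumes "u \<in> L2 \<Omega>" "v \<in> L2 \<Omega>"
  shows "(\<lambda>x. u x + v x) \<in> L2 \<Omega>"
proof -
  have "integrable (lebesgue_on \<Omega>) (\<lambda>x. u x \<bullet> u x + 2 * (u x \<bullet> v x) + v x \<bullet> v x)"
    using assms by (intro Bochner_Integration.integrable_add integrable_mult_right L2_inner_integrable)
  then show ?thesis using assms
    by (auto simp: L2_def power2_norm_eq_inner inner_simps inner_commute algebra_simps)
qed

lemma L2_component:
  assumes "G \<in> L2 \<Omega>"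
  shows "(\<lambda>x. G x $ i) \<in> L2 \<Omega>"
proof -
  have "(\<lambda>x. G x $ i) \<in> borel_measurable (lebesgue_on \<Omega>)"
    using L2_measurable[OF assms] by (rule borel_measurable_continuous_on[rotated]) (intro continuous_intros)
  moreover have "norm ((norm (G x $ i))\<^sup>2) \<le> norm ((norm (G x))\<^sup>2)" for x
    using Finite_Cartesian_Product.norm_nth_le[of "G x" i] by (simp add: power_mono)
  ultimately have "integrable (lebesgue_on \<Omega>) (\<lambda>x. (norm (G x $ i))\<^sup>2)"
    using assms Bochner_Integration.integrable_bound[of "lebesgue_on \<Omega>" "\<lambda>x. (norm (G x))\<^sup>2" "\<lambda>x. (norm (G x $ i))\<^sup>2"]
    by (simp add: L2_def)
  then show ?thesis using \<open>(\<lambda>x. G x $ i) \<in> _\<close> by (simp add: L2_def)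
qed

lemma L2_vec_lambda:
  fixes G :: "'n::finite \<Rightarrow> real^2 \<Rightarrow> 'b::euclidean_space"
  assumes "\<And>i. G i \<in> L2 \<Omega>"
  shows "(\<lambda>x. \<chi> i. G i x) \<in> L2 \<Omega>"
proof -
  have "(\<lambda>x. \<chi> i. G i x) \<in> borel_measurable (lebesgue_on \<Omega>)"
    using assms[THEN L2_measurable]
    by (subst borel_measurable_euclidean_space) (auto simp: Basis_vec_def inner_axis)
  moreover have "integrable (lebesgue_on \<Omega>) (\<lambda>x. \<Sum>i\<in>UNIV. (norm (G i x))\<^sup>2)"
    using assms by (auto simp: L2_def)
  ultimately show ?thesis
    by (simp add: L2_def norm_vec_def L2_set_def sum_nonneg)
qed

lemma L2_bounded_mult:
  fixes b :: "real^2 \<Rightarrow> real"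
  assumes "u \<in> L2 \<Omega>" "b \<in> borel_measurable (lebesgue_on \<Omega>)" "\<And>x. x \<in> \<Omega> \<Longrightarrow> \<bar>b x\<bar> \<le> B" "open \<Omega>"
  shows "(\<lambda>x. b x *\<^sub>R u x) \<in> L2 \<Omega>"
proof -
  have "norm ((norm (b x *\<^sub>R u x))\<^sup>2) \<le> norm (B\<^sup>2 * (norm (u x))\<^sup>2)" if "x \<in> \<Omega>" for x
    using power_mono[OF assms(3)[OF that], of 2] by (simp add: power_mult_distrib mult_right_mono)
  then have "AE x in lebesgue_on \<Omega>. norm ((norm (b x *\<^sub>R u x))\<^sup>2) \<le> norm (B\<^sup>2 * (norm (u x))\<^sup>2)"
    by (intro AE_I2) simp
  moreover have meas: "(\<lambda>x. b x *\<^sub>R u x) \<in> borel_measurable (lebesgue_on \<Omega>)"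
    using assms(2) L2_measurable[OF assms(1)] by (rule borel_measurable_scaleR)
  moreover have "integrable (lebesgue_on \<Omega>) (\<lambda>x. B\<^sup>2 * (norm (u x))\<^sup>2)"
    using assms(1) by (intro integrable_mult_right) (simp add: L2_def)
  ultimately have "integrable (lebesgue_on \<Omega>) (\<lambda>x. (norm (b x *\<^sub>R u x))\<^sup>2)"
    using Bochner_Integration.integrable_bound[of "lebesgue_on \<Omega>" "\<lambda>x. B\<^sup>2 * (norm (u x))\<^sup>2" "\<lambda>x. (norm (b x *\<^sub>R u x))\<^sup>2"]
      borel_measurable_power[OF measurable_compose[OF meas borel_measurable_norm]] by blast
  then show ?thesis using meas by (simp add: L2_def)
qed

lemma open_lebesgue: "open \<Omega> \<Longrightarrow> \<Omega> \<in> sets lebesgue"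
  by auto

lemma continuous_closure_measurable:
  "open \<Omega> \<Longrightarrow> continuous_on (closure \<Omega>) u \<Longrightarrow> u \<in> borel_measurable (lebesgue_on \<Omega>)"
  by (meson closure_subset continuous_imp_measurable_on_sets_lebesgue continuous_on_subset open_lebesgue)

lemma finite_measure_bounded_open: "open \<Omega> \<Longrightarrow> bounded \<Omega> \<Longrightarrow> finite_measure (lebesgue_on \<Omega>)"
  by (simp add: finite_measure_lebesgue_on lmeasurable_open)

lemma continuous_closure_bounded:
  fixes u :: "real^2 \<Rightarrow> real"
  assumes "bounded \<Omega>" "continuous_on (closure \<Omega>) u"
  obtains B where "B > 0" "\<And>x. x \<in> \<Omega> \<Longrightarrow> \<bar>u x\<bar> \<le> B"
proof -
  have "bounded (u ` closure \<Omega>)"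
    using assms by (intro compact_imp_bounded compact_continuous_image) auto
  then obtain B where "B > 0" "\<forall>y\<in>u ` closure \<Omega>. norm y \<le> B"
    unfolding bounded_pos by auto
  with that show ?thesis using closure_subset by fastforce
qed

lemma const_L2:
  assumes "open \<Omega>" "bounded \<Omega>"
  shows "(\<lambda>x. c) \<in> L2 \<Omega>"
proof -
  interpret finite_measure "lebesgue_on \<Omega>" using assms by (rule finite_measure_bounded_open)
  show ?thesis by (simp add: L2_def)
qed

lemma continuous_closure_L2:
  fixes u :: "real^2 \<Rightarrow> real"
  assumes "open \<Omega>" "bounded \<Omega>" "continuous_on (closure \<Omega>) u"
  shows "u \<in> L2 \<Omega>"
  using continuous_closure_bounded[OF assms(2,3)]
    L2_bounded_mult[OF const_L2[OF assms(1,2), of "1::real"] continuous_closure_measurable[OF assms(1,3)] _ assms(1)]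
  by (metis (no_types, lifting) ext mult.right_neutral real_scaleR_def)

lemma L2_integrable:
  fixes u :: "real^2 \<Rightarrow> real"
  shows "open \<Omega> \<Longrightarrow> bounded \<Omega> \<Longrightarrow> u \<in> L2 \<Omega> \<Longrightarrow> integrable (lebesgue_on \<Omega>) u"
  using L2_mult_integrable[of u \<Omega> "\<lambda>x. 1"] const_L2[of \<Omega> "1::real"] by simp

text \<open>Smooth approximants of \<eta> on the box and dominated convergence extend the
  orthogonality to the bump times a continuous function; the bump hides the uncontrolled behaviour
  of the approximants off the box. Admitting continuous \<eta> spares a proof that the quotients
  used next are smooth.\<close>

lemma box_bump_continuous_integral_zero:
  assumes D: "integrable (lebesgue_on \<Omega>) D" "\<And>\<psi>. \<psi> \<in> test_functions \<Omega> \<Longrightarrow> (LINT x|lebesgue_on \<Omega>. D x * \<psi> x) = 0"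
    and sub: "cbox a b \<subseteq> \<Omega>" and "open \<Omega>" and \<eta>: "continuous_on (cbox a b) \<eta>"
  shows "(LINT x|lebesgue_on \<Omega>. D x * (box_bump a b x * \<eta> x)) = 0"
    and "integrable (lebesgue_on \<Omega>) (\<lambda>x. D x * (box_bump a b x * \<eta> x))"
proof -
  obtain g where g: "\<And>n::nat. smooth_on UNIV (g n)" "\<And>n x. x \<in> cbox a b \<Longrightarrow> \<bar>\<eta> x - g n x\<bar> < 1 / Suc n"
    using smooth_approximation[OF compact_cbox \<eta>] by metis
  let ?\<phi> = "box_bump a b"
  have zero: "?\<phi> x = 0" if "x \<notin> cbox a b" for x
    using that box_bump_nonneg[of a b x] box_bump_pos_iff[of a b x] box_subset_cbox[of a b]
    by (auto simp: less_le)
  have c\<phi>: "continuous_on (cbox a b) ?\<phi>" by (intro smooth_on_continuous smooth_on_box_bump)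
  \<comment> \<open>Since 1 / (n + 1) is at most 1, the approximants are bounded by
    \<open>\<bar>\<eta> x\<bar> + 1\<close> on the box, so one \<open>B\<close> dominates all
    products.\<close>
  have "bounded ((\<lambda>x. ?\<phi> x * (\<bar>\<eta> x\<bar> + 1)) ` cbox a b)"
    by (intro compact_imp_bounded compact_continuous_image continuous_intros \<eta> c\<phi>) auto
  then obtain B where B: "B > 0" "\<And>x. x \<in> cbox a b \<Longrightarrow> \<bar>?\<phi> x * (\<bar>\<eta> x\<bar> + 1)\<bar> \<le> B"
    unfolding bounded_pos by auto
  have bnd: "\<bar>?\<phi> x * g n x\<bar> \<le> B" for n x
  proof (cases "x \<in> cbox a b")
    case True
    have "1 / real (Suc n) \<le> 1" by simp
    with g(2)[OF True, of n] have "\<bar>g n x\<bar> \<le> \<bar>\<eta> x\<bar> + 1" by linarith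
    then have "\<bar>?\<phi> x * g n x\<bar> \<le> \<bar>?\<phi> x * (\<bar>\<eta> x\<bar> + 1)\<bar>"
      by (simp add: abs_mult mult_left_mono)
    also have "\<dots> \<le> B" by (rule B(2)[OF True])
    finally show ?thesis .
  qed (use zero B in auto)
  have lim: "(\<lambda>n. ?\<phi> x * g n x) \<longlonglongrightarrow> ?\<phi> x * \<eta> x" for x
  proof (cases "x \<in> cbox a b")
    case True
    have "(\<lambda>n. g n x) \<longlonglongrightarrow> \<eta> x"
    proof (rule metric_tendsto_imp_tendsto)
      show "(\<lambda>n. 1 / real (Suc n)) \<longlonglongrightarrow> 0" by (rule LIMSEQ_Suc[OF lim_1_over_n])
      show "\<forall>\<^sub>F n in sequentially. dist (g n x) (\<eta> x) \<le> dist (1 / real (Suc n)) 0"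
        using g(2)[OF True] by (intro always_eventually allI) (simp add: dist_real_def abs_minus_commute less_imp_le)
    qed
    then show ?thesis by (intro tendsto_intros)
  qed (use zero in auto)
  have meas: "(\<lambda>x. D x * (?\<phi> x * g n x)) \<in> borel_measurable (lebesgue_on \<Omega>)" for n
    by (intro borel_measurable_times borel_measurable_integrable[OF D(1)]
        continuous_closure_measurable[OF \<open>open \<Omega>\<close>] smooth_on_continuous g(1) smooth_on_box_bump)
  have meas': "(\<lambda>x. D x * (?\<phi> x * \<eta> x)) \<in> borel_measurable (lebesgue_on \<Omega>)"
    by (rule borel_measurable_LIMSEQ_real[OF _ meas]) (rule tendsto_mult[OF tendsto_const lim])
  have dom: "integrable (lebesgue_on \<Omega>) (\<lambda>x. \<bar>D x\<bar> * B)" using D(1) by auto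
  have ev: "AE x in lebesgue_on \<Omega>. norm (D x * (?\<phi> x * g n x)) \<le> \<bar>D x\<bar> * B" for n
    using bnd by (auto simp: abs_mult[of "D _"] intro!: AE_I2 mult_left_mono)
  have evl: "AE x in lebesgue_on \<Omega>. (\<lambda>n. D x * (?\<phi> x * g n x)) \<longlonglongrightarrow> D x * (?\<phi> x * \<eta> x)"
    by (intro AE_I2 tendsto_mult[OF tendsto_const lim])
  have z: "(LINT x|lebesgue_on \<Omega>. D x * (?\<phi> x * g n x)) = 0" for n
    by (rule D(2)[OF smooth_mult_test_functions[OF box_bump_test_functions[OF sub] g(1)]])
  have "(\<lambda>n::nat. 0) \<longlonglongrightarrow> (LINT x|lebesgue_on \<Omega>. D x * (?\<phi> x * \<eta> x))"
    using integral_dominated_convergence[OF meas' meas dom evl ev] by (simp only: z)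
  then show "(LINT x|lebesgue_on \<Omega>. D x * (?\<phi> x * \<eta> x)) = 0"
    by (simp only: LIMSEQ_const_iff)
  show "integrable (lebesgue_on \<Omega>) (\<lambda>x. D x * (box_bump a b x * \<eta> x))"
    by (rule integrable_dominated_convergence[OF meas' meas dom evl ev])
qed

lemma box_integral_zero:
  assumes D: "integrable (lebesgue_on \<Omega>) D" "\<And>\<psi>. \<psi> \<in> test_functions \<Omega> \<Longrightarrow> (LINT x|lebesgue_on \<Omega>. D x * \<psi> x) = 0"
    and sub: "cbox a b \<subseteq> \<Omega>" and "open \<Omega>"
  shows "integral (cbox a b) D = 0"
proof -
  let ?\<phi> = "box_bump a b" and ?I = "\<lambda>x. indicat_real (box a b) x"
  have pos: "1 + real n * ?\<phi> x > 0" for n x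
    using box_bump_nonneg[of a b x] by (meson add_pos_nonneg mult_nonneg_nonneg of_nat_0_le_iff zero_less_one)
  \<comment> \<open>With \<open>\<phi>\<close> the bump, \<open>\<phi> * \<eta> n = n * \<phi> / (1 + n * \<phi>)\<close> increases to the indicator of the open box.\<close>
  define \<eta> where "\<eta> n x = real n / (1 + real n * ?\<phi> x)" for n x
  have c\<eta>: "continuous_on (cbox a b) (\<eta> n)" for n
    unfolding \<eta>_def[abs_def] using pos[of n]
    by (intro continuous_intros smooth_on_continuous smooth_on_box_bump) (metis less_irrefl)
  note Z = box_bump_continuous_integral_zero[OF D sub \<open>open \<Omega>\<close> c\<eta>]
  have bnd: "\<bar>?\<phi> x * \<eta> n x\<bar> \<le> 1" for n x
    using pos[of n x] box_bump_nonneg[of a b x] by (auto simp: \<eta>_def field_simps)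
  have lim: "(\<lambda>n. ?\<phi> x * \<eta> n x) \<longlonglongrightarrow> ?I x" for x
  proof (cases "x \<in> box a b")
    case True
    then have p: "?\<phi> x > 0" by (simp add: box_bump_pos_iff)
    have "(\<lambda>n. ?\<phi> x / (inverse (real n) + ?\<phi> x)) \<longlonglongrightarrow> ?\<phi> x / (0 + ?\<phi> x)"
      using p by (intro tendsto_intros lim_inverse_n) auto
    moreover have "\<forall>\<^sub>F n in sequentially. ?\<phi> x / (inverse (real n) + ?\<phi> x) = ?\<phi> x * \<eta> n x"
      using eventually_gt_at_top[of 0] by eventually_elim (use p in \<open>simp add: \<eta>_def field_simps\<close>)
    ultimately show ?thesis using p True by (auto intro: Lim_transform_eventually)
  next
    case False
    then show ?thesis using box_bump_nonneg[of a b x] box_bump_pos_iff[of a b x] by (simp add: less_le)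
  qed
  have meas: "(\<lambda>x. D x * (?\<phi> x * \<eta> n x)) \<in> borel_measurable (lebesgue_on \<Omega>)" for n
    using Z(2) by auto
  have meas': "(\<lambda>x. D x * ?I x) \<in> borel_measurable (lebesgue_on \<Omega>)"
    by (rule borel_measurable_LIMSEQ_real[OF _ meas]) (rule tendsto_mult[OF tendsto_const lim])
  have dom: "integrable (lebesgue_on \<Omega>) (\<lambda>x. \<bar>D x\<bar> * 1)" using D(1) by auto
  have ev: "AE x in lebesgue_on \<Omega>. norm (D x * (?\<phi> x * \<eta> n x)) \<le> \<bar>D x\<bar> * 1" for n
    using bnd by (auto simp: abs_mult[of "D _"] intro!: AE_I2 mult_left_mono simp del: mult_1_right)
  have evl: "AE x in lebesgue_on \<Omega>. (\<lambda>n. D x * (?\<phi> x * \<eta> n x)) \<longlonglongrightarrow> D x * ?I x"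
    by (intro AE_I2 tendsto_mult[OF tendsto_const lim])
  have "(\<lambda>n::nat. 0) \<longlonglongrightarrow> (LINT x|lebesgue_on \<Omega>. D x * ?I x)"
    using integral_dominated_convergence[OF meas' meas dom evl ev] by (simp only: Z(1))
  then have "0 = (LINT x|lebesgue_on \<Omega>. D x * ?I x)"
    by (simp only: LIMSEQ_const_iff)
  \<comment> \<open>The limit is rewritten as a gauge integral over a box, the form in which the
    differentiation theorem takes averages; the faces of the box have measure zero.\<close>
  also have "\<dots> = integral \<Omega> (\<lambda>x. D x * ?I x)"
    using \<open>open \<Omega>\<close> integrable_dominated_convergence[OF meas' meas dom evl ev]
    by (intro lebesgue_integral_eq_integral open_lebesgue)
  also have "\<dots> = integral UNIV (\<lambda>x. if x \<in> \<Omega> then D x * ?I x else 0)"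
    by (simp add: integral_restrict_UNIV)
  also have "\<dots> = integral UNIV (\<lambda>x. if x \<in> box a b then D x else 0)"
    using sub box_subset_cbox[of a b] by (intro arg_cong2[where f=integral]) (auto simp: indicator_def fun_eq_iff)
  also have "\<dots> = integral (cbox a b) D"
    by (simp add: integral_restrict_UNIV integral_open_interval)
  finally show ?thesis by simp
qed

text \<open>By Lebesgue's differentiation theorem the averages of \<open>D\<close>, extended by
  zero, over small squares with corner \<open>x\<close> tend to \<open>D x\<close> for almost every
  \<open>x\<close> in \<Omega>, while all averages over squares inside \<Omega> vanish.\<close>

lemma fundamental_lemma_calculus_of_variations:
  assumes D: "integrable (lebesgue_on \<Omega>) D" "\<And>\<psi>. \<psi> \<in> test_functions \<Omega> \<Longrightarrow> (LINT x|lebesgue_on \<Omega>. D x * \<psi> x) = 0"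
    and "open \<Omega>"
  shows "AE x in lebesgue_on \<Omega>. D x = 0"
proof -
  let ?D = "\<lambda>x. if x \<in> \<Omega> then D x else 0"
  have "?D integrable_on UNIV"
    using integrable_on_lebesgue_on[OF D(1) open_lebesgue[OF \<open>open \<Omega>\<close>]] by (simp add: integrable_restrict_UNIV)
  then have "?D integrable_on cbox a b" for a b
    by (rule integrable_on_subcbox) simp
  then obtain N where N: "negligible N" "\<And>x e. \<lbrakk>x \<notin> N; 0 < e\<rbrakk> \<Longrightarrow>
    \<exists>d>0. \<forall>h. 0 < h \<and> h < d \<longrightarrow> norm (integral (cbox x (x + h *\<^sub>R One)) ?D /\<^sub>R h ^ DIM(real^2) - ?D x) < e"
    by (rule integrable_ccontinuous_explicit[of ?D]) (rule that)
  have "D x = 0" if "x \<in> \<Omega>" "x \<notin> N" for x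
  proof (rule ccontr)
    assume "D x \<noteq> 0"
    then have "\<bar>D x\<bar> > 0" by simp
    from N(2)[OF that(2) this] obtain d where d: "d > 0"
      "\<And>h. 0 < h \<Longrightarrow> h < d \<Longrightarrow> norm (integral (cbox x (x + h *\<^sub>R One)) ?D /\<^sub>R h ^ DIM(real^2) - ?D x) < \<bar>D x\<bar>"
      by blast
    obtain r where r: "r > 0" "cball x r \<subseteq> \<Omega>"
      using \<open>open \<Omega>\<close> \<open>x \<in> \<Omega>\<close> open_contains_cball by blast
    \<comment> \<open>Half of \<open>d\<close> makes the inequality strict; half of \<open>r\<close>
      is taken because the l1 bound for a planar square of side h gives distances up to 2 h.\<close>
    define h where "h = min (d/2) (r / 2)"
    have h: "h > 0" "h < d" "2 * h \<le> r" using d r by (auto simp: h_def)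
    have "cbox x (x + h *\<^sub>R One) \<subseteq> cball x r"
    proof
      fix y assume y: "y \<in> cbox x (x + h *\<^sub>R One)"
      have "norm (y - x) \<le> (\<Sum>b\<in>Basis. \<bar>(y - x) \<bullet> b\<bar>)" by (rule norm_le_l1)
      also have "\<dots> \<le> (\<Sum>b\<in>(Basis::(real^2) set). h)"
        using y by (intro sum_mono) (auto simp: mem_box inner_simps)
      also have "\<dots> \<le> r" using h by simp
      finally show "y \<in> cball x r" by (simp add: dist_norm norm_minus_commute)
    qed
    with r have sub: "cbox x (x + h *\<^sub>R One) \<subseteq> \<Omega>" by blast
    have "integral (cbox x (x + h *\<^sub>R One)) ?D = integral (cbox x (x + h *\<^sub>R One)) D"
      using sub by (intro integral_cong) auto
    also have "\<dots> = 0" by (rule box_integral_zero[OF D sub \<open>open \<Omega>\<close>])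
    finally show False using d(2)[OF h(1,2)] that by simp
  qed
  then have "\<Omega> \<inter> {x. D x \<noteq> 0} \<subseteq> N" by auto
  then have "negligible (\<Omega> \<inter> {x. D x \<noteq> 0})" using N(1) negligible_subset by blast
  then have "AE x in lebesgue. x \<notin> \<Omega> \<inter> {x. D x \<noteq> 0}"
    by (intro AE_not_in) (simp add: negligible_iff_null_sets)
  then show ?thesis
    using \<open>open \<Omega>\<close> by (subst AE_restrict_space_iff) (auto elim!: eventually_mono)
qed

text \<open>The difference of two weak gradients is orthogonal to all test functions, component by
  component. As \<open>weak_grad\<close> is obtained by choice, this is how its values are
  identified.\<close>

lemma weak_grad_unique:
  assumes "open \<Omega>" "bounded \<Omega>" "is_weak_grad \<Omega> u G" "is_weak_grad \<Omega> u H"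
  shows "AE x in lebesgue_on \<Omega>. G x = H x"
proof -
  have "AE x in lebesgue_on \<Omega>. G x $ i - H x $ i = 0" for i
  proof (rule fundamental_lemma_calculus_of_variations[OF _ _ assms(1)])
    have int: "integrable (lebesgue_on \<Omega>) (\<lambda>x. G x $ i)" "integrable (lebesgue_on \<Omega>) (\<lambda>x. H x $ i)"
      using assms L2_component by (auto simp: is_weak_grad_def intro!: L2_integrable)
    then show "integrable (lebesgue_on \<Omega>) (\<lambda>x. G x $ i - H x $ i)" by simp
    fix \<psi> assume \<psi>: "\<psi> \<in> test_functions \<Omega>"
    have "\<psi> \<in> L2 \<Omega>"
      using \<psi> assms by (intro continuous_closure_L2 smooth_on_continuous) (auto simp: test_functions_def)
    then have "integrable (lebesgue_on \<Omega>) (\<lambda>x. G x $ i * \<psi> x)" "integrable (lebesgue_on \<Omega>) (\<lambda>x. H x $ i * \<psi> x)"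
      using assms by (auto simp: is_weak_grad_def intro!: L2_mult_integrable L2_component)
    moreover have "(LINT x|lebesgue_on \<Omega>. G x $ i * \<psi> x) = (LINT x|lebesgue_on \<Omega>. H x $ i * \<psi> x)"
    proof -
      have "(LINT x|lebesgue_on \<Omega>. u x * partial i \<psi> x) = - (LINT x|lebesgue_on \<Omega>. G x $ i * \<psi> x)"
        "(LINT x|lebesgue_on \<Omega>. u x * partial i \<psi> x) = - (LINT x|lebesgue_on \<Omega>. H x $ i * \<psi> x)"
        using assms(3,4) \<psi> unfolding is_weak_grad_def by blast+
      then show ?thesis by linarith
    qed
    ultimately show "(LINT x|lebesgue_on \<Omega>. (G x $ i - H x $ i) * \<psi> x) = 0"
      by (simp add: left_diff_distrib)
  qed
  then have "AE x in lebesgue_on \<Omega>. \<forall>i. G x $ i - H x $ i = 0"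
    by (simp add: AE_all_countable)
  then show ?thesis by eventually_elim (simp add: vec_eq_iff)
qed

lemma is_weak_grad_weak_grad: "u \<in> H1 \<Omega> \<Longrightarrow> is_weak_grad \<Omega> u (weak_grad \<Omega> u)"
  unfolding weak_grad_def H1_def by (auto intro: someI[of "is_weak_grad \<Omega> u"])

lemma weak_grad_AE:
  assumes "open \<Omega>" "bounded \<Omega>" "is_weak_grad \<Omega> u G"
  shows "AE x in lebesgue_on \<Omega>. weak_grad \<Omega> u x = G x"
  using weak_grad_unique[OF assms(1,2) _ assms(3)] assms(3) unfolding weak_grad_def by (metis (full_types) someI)

section \<open>The product rule for continuous functions with a weak gradient\<close>

lemma integral_lebesgue_on_eq_lborel:
  fixes f :: "real^2 \<Rightarrow> real"
  assumes "open \<Omega>" "continuous_on UNIV f" "\<And>x. x \<notin> \<Omega> \<Longrightarrow> f x = 0"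
  shows "(LINT x|lebesgue_on \<Omega>. f x) = (LINT x|lborel. f x)"
proof -
  have "(LINT x|lebesgue_on \<Omega>. f x) = (LINT x|lebesgue. indicator \<Omega> x *\<^sub>R f x)"
    using assms(1) by (intro integral_restrict_space) auto
  also have "(\<lambda>x. indicator \<Omega> x *\<^sub>R f x) = f"
    using assms(3) by (auto simp: indicator_def fun_eq_iff)
  also have "(LINT x|lebesgue. f x) = (LINT x|lborel. f x)"
    by (rule integral_completion) (simp add: borel_measurable_continuous_onI assms(2))
  finally show ?thesis .
qed

text \<open>Translation invariance belongs to the measure on the whole plane. The two vanishing
  conditions allow the function and its translate both to be integrated there.\<close>

lemma integral_lebesgue_on_shift:
  fixes f :: "real^2 \<Rightarrow> real"
  assumes "open \<Omega>" "continuous_on UNIV f" "\<And>x. x \<notin> \<Omega> \<Longrightarrow> f x = 0" "\<And>x. x \<notin> \<Omega> \<Longrightarrow> f (x + a) = 0"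
  shows "(LINT x|lebesgue_on \<Omega>. f (x + a)) = (LINT x|lebesgue_on \<Omega>. f x)"
proof -
  have "(LINT x|lebesgue_on \<Omega>. f (x + a)) = (LINT x|lborel. f (x + a))"
  proof (rule integral_lebesgue_on_eq_lborel)
    show "continuous_on UNIV (\<lambda>x. f (x + a))"
      by (rule continuous_on_compose2[OF assms(2)]) (auto intro!: continuous_intros)
  qed (fact assms)+
  also have "\<dots> = (LINT x|distr lborel borel ((+) a). f x)"
  proof -
    have "(LINT x|distr lborel borel ((+) a). f x) = (LINT x|lborel. f (a + x))"
      by (rule integral_distr) (measurable, rule borel_measurable_continuous_onI[OF assms(2)])
    then show ?thesis by (simp only: add.commute)
  qed
  also have "\<dots> = (LINT x|lebesgue_on \<Omega>. f x)"
    using assms by (simp add: lborel_distr_plus integral_lebesgue_on_eq_lborel)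
  finally show ?thesis .
qed

lemma integrable_mult_continuous:
  fixes w f :: "real^2 \<Rightarrow> real"
  assumes "open \<Omega>" "bounded \<Omega>" "integrable (lebesgue_on \<Omega>) w" "continuous_on (closure \<Omega>) f"
  shows "integrable (lebesgue_on \<Omega>) (\<lambda>x. w x * f x)"
proof -
  obtain B where B: "B > 0" "\<And>x. x \<in> \<Omega> \<Longrightarrow> \<bar>f x\<bar> \<le> B"
    using continuous_closure_bounded[OF assms(2,4)] by metis
  have "integrable (lebesgue_on \<Omega>) (\<lambda>x. w x * B)" using assms(3) by simp
  moreover have "(\<lambda>x. w x * f x) \<in> borel_measurable (lebesgue_on \<Omega>)"
    using borel_measurable_integrable[OF assms(3)] continuous_closure_measurable[OF assms(1,4)]
    by (rule borel_measurable_times)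
  moreover have "AE x in lebesgue_on \<Omega>. norm (w x * f x) \<le> norm (w x * B)"
    using B by (intro AE_I2) (auto simp: abs_mult intro!: mult_left_mono)
  ultimately show ?thesis
    by (rule Bochner_Integration.integrable_bound)
qed

text \<open>The Hoelder inequality between L1 and the sup norm. The weight is merely integrable, so
  a component of a weak gradient may take its place.\<close>

lemma integral_mult_diff_le:
  fixes w f h :: "real^2 \<Rightarrow> real"
  assumes "open \<Omega>" "bounded \<Omega>" "integrable (lebesgue_on \<Omega>) w"
    "continuous_on (closure \<Omega>) f" "continuous_on (closure \<Omega>) h"
    and le: "\<And>x. x \<in> \<Omega> \<Longrightarrow> \<bar>f x - h x\<bar> \<le> \<epsilon>"
  shows "\<bar>(LINT x|lebesgue_on \<Omega>. w x * f x) - (LINT x|lebesgue_on \<Omega>. w x * h x)\<bar>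
    \<le> \<epsilon> * (LINT x|lebesgue_on \<Omega>. \<bar>w x\<bar>)"
proof -
  note int = integrable_mult_continuous[OF assms(1-3)]
  have "(LINT x|lebesgue_on \<Omega>. w x * f x) - (LINT x|lebesgue_on \<Omega>. w x * h x)
      = (LINT x|lebesgue_on \<Omega>. w x * (f x - h x))"
    by (simp add: right_diff_distrib int assms(4,5))
  moreover have "\<bar>LINT x|lebesgue_on \<Omega>. w x * (f x - h x)\<bar> \<le> (LINT x|lebesgue_on \<Omega>. \<bar>w x * (f x - h x)\<bar>)"
    by (rule integral_abs_bound)
  moreover have "\<dots> \<le> (LINT x|lebesgue_on \<Omega>. \<epsilon> * \<bar>w x\<bar>)"
  proof (rule integral_mono)
    show "integrable (lebesgue_on \<Omega>) (\<lambda>x. \<bar>w x * (f x - h x)\<bar>)"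
      by (intro integrable_abs int continuous_intros assms)
    show "integrable (lebesgue_on \<Omega>) (\<lambda>x. \<epsilon> * \<bar>w x\<bar>)"
      using assms(3) by auto
    show "\<bar>w x * (f x - h x)\<bar> \<le> \<epsilon> * \<bar>w x\<bar>" if "x \<in> space (lebesgue_on \<Omega>)" for x
      using mult_left_mono[OF le[of x], of "\<bar>w x\<bar>"] that by (simp add: abs_mult mult.commute)
  qed
  moreover have "(LINT x|lebesgue_on \<Omega>. \<epsilon> * \<bar>w x\<bar>) = \<epsilon> * (LINT x|lebesgue_on \<Omega>. \<bar>w x\<bar>)"
    by simp
  ultimately show ?thesis by linarith
qed

lemma integral_lebesgue_on_eq_cbox:
  fixes f :: "real^2 \<Rightarrow> real"
  assumes "open \<Omega>" "bounded \<Omega>" "continuous_on UNIV f" "\<And>x. x \<notin> \<Omega> \<Longrightarrow> f x = 0" "\<Omega> \<subseteq> cbox a b"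
  shows "(LINT x|lebesgue_on \<Omega>. f x) = integral (cbox a b) f"
proof -
  have "integrable (lebesgue_on \<Omega>) f"
    using assms by (intro L2_integrable continuous_closure_L2) (auto intro: continuous_on_subset)
  then have "(LINT x|lebesgue_on \<Omega>. f x) = integral \<Omega> f"
    using assms(1) by (intro lebesgue_integral_eq_integral open_lebesgue)
  also have "\<dots> = integral UNIV (\<lambda>x. if x \<in> \<Omega> then f x else 0)"
    by (simp add: integral_restrict_UNIV)
  also have "\<dots> = integral UNIV (\<lambda>x. if x \<in> cbox a b then f x else 0)"
    using assms(4,5) by (intro arg_cong2[where f=integral]) (auto simp: fun_eq_iff)
  also have "\<dots> = integral (cbox a b) f"
    by (simp add: integral_restrict_UNIV)
  finally show ?thesis .
qed

text \<open>The derivative falls on \<phi> alone, so \<open>C\<close> may be merely continuous. As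
  the integrands vanish off \<Omega> for all shifts in \<open>U\<close>, the domain can be exchanged
  for a fixed box, where the Leibniz rule for continuous integrands applies.\<close>

lemma DERIV_integral_translate:
  fixes \<phi> C :: "real^2 \<Rightarrow> real"
  assumes "open \<Omega>" "bounded \<Omega>" and \<phi>: "smooth_on UNIV \<phi>" and C: "continuous_on UNIV C"
    and U: "convex U" "s0 \<in> U"
    and zero: "\<And>s x. s \<in> U \<Longrightarrow> x \<notin> \<Omega> \<Longrightarrow> \<phi> (x + s *\<^sub>R axis i r) * C x = 0"
      "\<And>s x. s \<in> U \<Longrightarrow> x \<notin> \<Omega> \<Longrightarrow> partial i \<phi> (x + s *\<^sub>R axis i r) * C x = 0"
  shows "((\<lambda>s. LINT x|lebesgue_on \<Omega>. \<phi> (x + s *\<^sub>R axis i r) * C x) has_real_derivative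
     r * (LINT x|lebesgue_on \<Omega>. partial i \<phi> (x + s0 *\<^sub>R axis i r) * C x)) (at s0 within U)"
proof -
  obtain a b where ab: "\<Omega> \<subseteq> cbox a b"
    using \<open>bounded \<Omega>\<close> bounded_subset_cbox_symmetric by metis
  have c\<phi>: "continuous_on UNIV \<phi>" "continuous_on UNIV (partial i \<phi>)"
    using \<phi> by (auto intro: smooth_on_continuous smooth_on_partial)
  note [continuous_intros] = continuous_on_compose2[OF c\<phi>(1)] continuous_on_compose2[OF c\<phi>(2)]
    continuous_on_compose2[OF C]
  have eq: "(LINT x|lebesgue_on \<Omega>. \<phi> (x + s *\<^sub>R axis i r) * C x) =
      integral (cbox a b) (\<lambda>x. \<phi> (x + s *\<^sub>R axis i r) * C x)" if "s \<in> U" for s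
    using zero that by (intro integral_lebesgue_on_eq_cbox assms(1,2) ab) (auto intro!: continuous_intros)
  have "((\<lambda>s. integral (cbox a b) (\<lambda>x. \<phi> (x + s *\<^sub>R axis i r) * C x)) has_real_derivative
     integral (cbox a b) (\<lambda>x. r * partial i \<phi> (x + s0 *\<^sub>R axis i r) * C x)) (at s0 within U)"
  proof (rule leibniz_rule_field_derivative[OF _ _ _ U(2,1)])
    show "((\<lambda>s. \<phi> (x + s *\<^sub>R axis i r) * C x) has_real_derivative
        r * partial i \<phi> (x + s *\<^sub>R axis i r) * C x) (at s within U)" for s x
      by (rule DERIV_cmult_right[OF smooth_on_DERIV_line[OF \<phi>]])
    show "(\<lambda>x. \<phi> (x + s *\<^sub>R axis i r) * C x) integrable_on cbox a b" for s
      by (intro integrable_continuous continuous_intros) auto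
    show "continuous_on (U \<times> cbox a b) (\<lambda>(s, x). r * partial i \<phi> (x + s *\<^sub>R axis i r) * C x)"
      unfolding case_prod_beta by (intro continuous_intros) auto
  qed
  moreover have "integral (cbox a b) (\<lambda>x. r * partial i \<phi> (x + s0 *\<^sub>R axis i r) * C x) =
     (LINT x|lebesgue_on \<Omega>. r * partial i \<phi> (x + s0 *\<^sub>R axis i r) * C x)"
    using zero U(2)
    by (intro integral_lebesgue_on_eq_cbox[symmetric] assms(1,2) ab) (auto intro!: continuous_intros simp: mult.assoc)
  ultimately have "((\<lambda>s. integral (cbox a b) (\<lambda>x. \<phi> (x + s *\<^sub>R axis i r) * C x)) has_real_derivative
     r * (LINT x|lebesgue_on \<Omega>. partial i \<phi> (x + s0 *\<^sub>R axis i r) * C x)) (at s0 within U)"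
    by (auto simp: mult.assoc)
  then show ?thesis
    by (rule has_field_derivative_transform_within[OF _ zero_less_one U(2)]) (simp add: eq)
qed

lemma test_functionsD:
  assumes "\<psi> \<in> test_functions \<Omega>"
  obtains K where "compact K" "K \<subseteq> \<Omega>" "\<And>x. x \<notin> K \<Longrightarrow> \<psi> x = 0" "\<And>x i. x \<notin> K \<Longrightarrow> partial i \<psi> x = 0"
    "smooth_on UNIV \<psi>"
proof
  let ?K = "closure {x. \<psi> x \<noteq> 0}"
  show *: "\<psi> x = 0" if "x \<notin> ?K" for x
    using that closure_subset[of "{x. \<psi> x \<noteq> 0}"] by auto
  show "partial i \<psi> x = 0" if "x \<notin> ?K" for x i
  proof -
    have "((\<lambda>x. 0::real) has_derivative (\<lambda>h. 0)) (at x)" by simp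
    then have "(\<psi> has_derivative (\<lambda>h. 0)) (at x)"
    proof (rule has_derivative_transform_within_open)
      show "open (- ?K)" by (rule open_Compl[OF closed_closure])
      show "x \<in> - ?K" using that by (simp only: Compl_iff simp_thms)
      show "0 = \<psi> y" if "y \<in> - ?K" for y
        by (rule sym, rule *) (use that in \<open>simp only: Compl_iff simp_thms\<close>)
    qed
    then show ?thesis by (simp add: partial_eqI)
  qed
qed (use assms in \<open>auto simp: test_functions_def\<close>)

text \<open>The integral of a translate does not depend on the translation, so its derivative at 0,
  which is the integral of the partial derivative, vanishes. Short translations keep the support
  inside \<Omega>.\<close>

lemma test_functions_integral_partial:
  assumes "open \<Omega>" "bounded \<Omega>" "\<psi> \<in> test_functions \<Omega>"
  shows "(LINT x|lebesgue_on \<Omega>. partial i \<psi> x) = 0"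
proof -
  obtain K where K: "compact K" "K \<subseteq> \<Omega>" "\<And>x. x \<notin> K \<Longrightarrow> \<psi> x = 0" "\<And>x i. x \<notin> K \<Longrightarrow> partial i \<psi> x = 0"
    "smooth_on UNIV \<psi>" using test_functionsD[OF assms(3)] by metis
  obtain \<delta> where \<delta>: "\<delta> > 0" "(\<Union>x\<in>K. cball x \<delta>) \<subseteq> \<Omega>"
    using compact_subset_open_imp_cball_epsilon_subset[OF K(1) assms(1) K(2)] by metis
  have out: "x + s *\<^sub>R axis i 1 \<notin> K" if "x \<notin> \<Omega>" "s \<in> {-\<delta>..\<delta>}" for s x
  proof
    assume "x + s *\<^sub>R axis i 1 \<in> K"
    moreover have "x \<in> cball (x + s *\<^sub>R axis i 1) \<delta>"
      using that(2) by (auto simp: dist_norm norm_axis_1)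
    ultimately show False using \<delta>(2) that(1) by blast
  qed
  have "(LINT x|lebesgue_on \<Omega>. \<psi> (x + s *\<^sub>R axis i 1) * 1) = (LINT x|lebesgue_on \<Omega>. \<psi> x)"
    if "s \<in> {-\<delta>..\<delta>}" for s
    using K(2,3) out[OF _ that] assms(1)
      integral_lebesgue_on_shift[OF assms(1) smooth_on_continuous[OF K(5)], of "s *\<^sub>R axis i 1"] by auto
  moreover have "((\<lambda>s. LINT x|lebesgue_on \<Omega>. \<psi> (x + s *\<^sub>R axis i 1) * 1) has_real_derivative
     1 * (LINT x|lebesgue_on \<Omega>. partial i \<psi> (x + 0 *\<^sub>R axis i 1) * 1)) (at 0 within {-\<delta>..\<delta>})"
    using \<delta>(1) K(3,4) out by (intro DERIV_integral_translate assms(1,2) K(5)) auto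
  ultimately have "((\<lambda>s. LINT x|lebesgue_on \<Omega>. \<psi> x) has_real_derivative
      (LINT x|lebesgue_on \<Omega>. partial i \<psi> x)) (at 0 within {-\<delta>..\<delta>})"
    by (subst (asm) has_field_derivative_cong_eventually[where g="\<lambda>s. LINT x|lebesgue_on \<Omega>. \<psi> x"])
      (use \<delta>(1) in \<open>auto simp: eventually_at_filter\<close>)
  then have "((\<lambda>s. LINT x|lebesgue_on \<Omega>. \<psi> x) has_real_derivative
      (LINT x|lebesgue_on \<Omega>. partial i \<psi> x)) (at 0)"
    using \<delta>(1) at_within_Icc_at[of "-\<delta>" 0 \<delta>] by simp
  then show ?thesis
    using DERIV_unique DERIV_const by blast
qed

text \<open>Let A be the integral of \<open>G x $ i * (\<psi> x * c x)\<close> and B the integral on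
  the left. Formally, the two ways of differentiating at 0 give the values -A and A + B, hence B =
  -2 A. Since neither factor \<open>c\<close> is smooth, differentiability is not known beforehand;
  one factor at a time is approximated, and the derivatives converge uniformly in the shift.\<close>

lemma weak_grad_square_test:
  assumes "open \<Omega>" "bounded \<Omega>" and G: "is_weak_grad \<Omega> c G" and c: "continuous_on (closure \<Omega>) c"
    and \<psi>: "\<psi> \<in> test_functions \<Omega>"
  shows "(LINT x|lebesgue_on \<Omega>. c x * (c x * partial i \<psi> x)) = - 2 * (LINT x|lebesgue_on \<Omega>. G x $ i * (\<psi> x * c x))"
proof -
  let ?M = "lebesgue_on \<Omega>"
  define e where "e r = (axis i r :: real^2)" for r :: real
  \<comment> \<open>Translates leave \<Omega>, and off its closure the values of \<open>c\<close>
    are arbitrary; a continuous extension makes all integrands continuous on the whole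
    plane.\<close>
  obtain C where C: "continuous_on UNIV C" "\<And>x. x \<in> closure \<Omega> \<Longrightarrow> C x = c x"
    using Tietze_unbounded[OF c, of UNIV] by (metis closed_closedin closed_closure subtopology_UNIV)
  have Cc: "C x = c x" if "x \<in> \<Omega>" for x using C(2) that closure_subset by blast
  obtain g where g: "\<And>n::nat. smooth_on UNIV (g n)" "\<And>n x. x \<in> closure \<Omega> \<Longrightarrow> \<bar>C x - g n x\<bar> < 1 / Suc n"
    using smooth_approximation[of "closure \<Omega>" C] assms(2) C(1) by (metis compact_closure continuous_on_subset subset_UNIV)
  obtain K where K: "compact K" "K \<subseteq> \<Omega>" "\<And>x. x \<notin> K \<Longrightarrow> \<psi> x = 0" "\<And>x i. x \<notin> K \<Longrightarrow> partial i \<psi> x = 0"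
    and s\<psi>: "smooth_on UNIV \<psi>" using test_functionsD[OF \<psi>] by metis
  obtain \<delta> where \<delta>: "\<delta> > 0" "(\<Union>x\<in>K. cball x \<delta>) \<subseteq> \<Omega>"
    using compact_subset_open_imp_cball_epsilon_subset[OF K(1) assms(1) K(2)] by metis
  define U where "U = {-\<delta>..\<delta>}"
  have dist_e: "dist x (x + s *\<^sub>R e r) \<le> \<delta>" "dist (x + s *\<^sub>R e r) x \<le> \<delta>" if "s \<in> U" "\<bar>r\<bar> = 1" for s x r
  proof -
    have "axis i r = r *\<^sub>R axis i 1" by (simp add: axis_def vec_eq_iff)
    then have "norm (e r) = 1" using that by (simp add: e_def norm_axis_1)
    with that show "dist x (x + s *\<^sub>R e r) \<le> \<delta>" "dist (x + s *\<^sub>R e r) x \<le> \<delta>"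
      by (auto simp: dist_norm U_def)
  qed
  have out: "x + s *\<^sub>R e r \<notin> K" if "x \<notin> \<Omega>" "s \<in> U" "\<bar>r\<bar> = 1" for s x r
    using dist_e[OF that(2,3)] \<delta>(2) that(1) by (meson UN_I mem_cball subsetD)
  have into: "x + s *\<^sub>R e r \<in> \<Omega>" if "x \<in> K" "s \<in> U" "\<bar>r\<bar> = 1" for s x r
    using dist_e[OF that(2,3)] \<delta>(2) that(1) by (meson UN_I mem_cball subsetD)
  have c\<psi>: "continuous_on A \<psi>" "continuous_on A (partial i \<psi>)" "continuous_on A (g n)" for A n
    by (intro smooth_on_continuous smooth_on_partial s\<psi> g(1))+
  note [continuous_intros] = continuous_on_compose2[OF c\<psi>(1)[of UNIV]] continuous_on_compose2[OF c\<psi>(2)[of UNIV]]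
    continuous_on_compose2[OF c\<psi>(3)[of UNIV]] continuous_on_compose2[OF C(1)]
  obtain B1 B2 where B12: "\<And>x. x \<in> \<Omega> \<Longrightarrow> \<bar>\<psi> x\<bar> \<le> B1" "\<And>x. x \<in> \<Omega> \<Longrightarrow> \<bar>partial i \<psi> x\<bar> \<le> B2"
    using continuous_closure_bounded[OF assms(2) c\<psi>(1)] continuous_closure_bounded[OF assms(2) c\<psi>(2)] by metis
  \<comment> \<open>The maximum with 0 keeps the bounds valid off \<Omega>, where \<psi> and its
    partial derivatives vanish.\<close>
  define B where "B = max 0 (max B1 B2)"
  have B: "\<bar>\<psi> x\<bar> \<le> B" "\<bar>partial i \<psi> x\<bar> \<le> B" "B \<ge> 0" for x
    using B12[of x] K(2) K(3,4)[of x] unfolding B_def by fastforce+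
  have near: "\<bar>C y - g n y\<bar> \<le> 1 / Suc n" if "y \<in> \<Omega>" for n y
    using g(2)[of y n] that closure_subset by fastforce
  \<comment> \<open>The approximants are close to \<open>C\<close> only on the closure of \<Omega>.
    In the applications \<open>p\<close> is a value of \<psi> or of its partial derivative, which is
    zero whenever \<open>y\<close> lies outside \<Omega>.\<close>
  have prod_near: "\<bar>p * g n y - p * C y\<bar> \<le> B / Suc n" if "\<bar>p\<bar> \<le> B" "p \<noteq> 0 \<Longrightarrow> y \<in> \<Omega>" for n y p
  proof (cases "p = 0")
    case False
    have "\<bar>p * g n y - p * C y\<bar> = \<bar>p\<bar> * \<bar>C y - g n y\<bar>"
      by (simp add: abs_mult abs_minus_commute flip: right_diff_distrib)
    also have "\<dots> \<le> B * (1 / Suc n)"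
      using near[OF that(2)[OF False]] that(1) B(3) by (intro mult_mono) auto
    finally show ?thesis by simp
  qed (use B(3) in auto)
  have Gi: "integrable ?M (\<lambda>x. G x $ i)"
    using G L2_component by (auto simp: is_weak_grad_def intro!: L2_integrable assms(1,2))
  have ibp: "(LINT x|?M. c x * partial i \<phi> x) = - (LINT x|?M. G x $ i * \<phi> x)" if "\<phi> \<in> test_functions \<Omega>" for \<phi>
    using G that by (simp add: is_weak_grad_def)
  have int_C: "integrable ?M (\<lambda>x. C (x + a))" for a
    by (intro L2_integrable continuous_closure_L2 assms(1,2) continuous_intros) auto
  have int_c: "integrable ?M c"
    by (intro L2_integrable continuous_closure_L2 assms(1,2) c)
  \<comment> \<open>Both \<open>J n s\<close> and \<open>I n s\<close> tend to \<open>\<integral> \<psi>(x) C(x) C(x - s e) dx\<close>: the smooth approximation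
      replaces the fixed factor in \<open>J\<close> (after a translation) and the translated one in \<open>I\<close>, so that the
      weak gradient of \<open>c\<close> yields the derivatives.  Their difference tends to \<open>0\<close> with derivative \<open>\<Phi> C\<close>.\<close>
  define J where "J n s = (LINT x|?M. (\<psi> (x + s *\<^sub>R e 1) * g n (x + s *\<^sub>R e 1)) * C x)" for n s
  define I where "I n s = (LINT x|?M. g n (x + s *\<^sub>R e (-1)) * (\<psi> x * C x))" for n s
  define \<Phi> where "\<Phi> f s = - (LINT x|?M. G x $ i * (\<psi> (x + s *\<^sub>R e 1) * f (x + s *\<^sub>R e 1)))
     - (LINT x|?M. G x $ i * (\<psi> x * f (x + s *\<^sub>R e (-1))))
     - (LINT x|?M. c x * (partial i \<psi> x * f (x + s *\<^sub>R e (-1))))" for f s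
  have J_deriv: "(J n has_real_derivative - (LINT x|?M. G x $ i * (\<psi> (x + s *\<^sub>R e 1) * g n (x + s *\<^sub>R e 1)))) (at s within U)"
    if "s \<in> U" for n s
  proof -
    let ?\<phi> = "\<lambda>x. \<psi> x * g n x"
    let ?\<phi>s = "\<lambda>x. \<psi> (x + s *\<^sub>R e 1) * g n (x + s *\<^sub>R e 1)"
    have s\<phi>: "smooth_on UNIV ?\<phi>" by (intro smooth_on_mult s\<psi> g(1))
    have p: "partial i ?\<phi> x = 0" if "x \<notin> K" for x
      using K(3,4)[OF that] by (simp add: partial_mult s\<psi> g(1))
    have "(J n has_real_derivative 1 * (LINT x|?M. partial i ?\<phi> (x + s *\<^sub>R e 1) * C x)) (at s within U)"
      unfolding J_def[abs_def] e_def
      by (rule DERIV_integral_translate[OF assms(1,2) s\<phi> C(1) _ that])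
        (use out K(3) p in \<open>auto simp: U_def e_def\<close>)
    also have "(LINT x|?M. partial i ?\<phi> (x + s *\<^sub>R e 1) * C x) = (LINT x|?M. c x * partial i ?\<phi>s x)"
      using partial_shift[OF s\<phi>] by (intro Bochner_Integration.integral_cong) (auto simp: Cc)
    \<comment> \<open>The translated product is again a test function: it vanishes off the set
      \<open>K\<close> shifted by \<open>- s\<close>, which the choice of \<delta> keeps inside
      \<Omega>.\<close>
    also have "\<dots> = - (LINT x|?M. G x $ i * ?\<phi>s x)"
    proof (rule ibp, rule test_functionsI)
      show "smooth_on UNIV ?\<phi>s" by (rule smooth_on_shift[OF s\<phi>])
      show "compact ((\<lambda>x. x + s *\<^sub>R e (-1)) ` K)"
        by (intro compact_continuous_image K(1) continuous_intros)
      show "(\<lambda>x. x + s *\<^sub>R e (-1)) ` K \<subseteq> \<Omega>"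
        using into[OF _ \<open>s \<in> U\<close>] by auto
      show "?\<phi>s x = 0" if "x \<notin> (\<lambda>x. x + s *\<^sub>R e (-1)) ` K" for x
      proof -
        have "axis i (-1) = - (axis i 1 :: real^2)" by (simp add: axis_def vec_eq_iff)
        then have "x = (x + s *\<^sub>R e 1) + s *\<^sub>R e (-1)" by (simp add: e_def)
        with that have "x + s *\<^sub>R e 1 \<notin> K" by blast
        then show ?thesis using K(3) by simp
      qed
    qed
    finally show ?thesis by simp
  qed
  have I_deriv: "(I n has_real_derivative (LINT x|?M. G x $ i * (\<psi> x * g n (x + s *\<^sub>R e (-1))))
     + (LINT x|?M. c x * (partial i \<psi> x * g n (x + s *\<^sub>R e (-1))))) (at s within U)"
    if "s \<in> U" for n s
  proof -
    let ?h = "\<lambda>x. g n (x + s *\<^sub>R e (-1))"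
    have sh: "smooth_on UNIV ?h" by (intro smooth_on_shift g(1))
    have [continuous_intros]: "continuous_on A ?h" "continuous_on A (partial i ?h)" for A
      by (intro smooth_on_continuous smooth_on_partial sh)+
    have "(I n has_real_derivative (-1) * (LINT x|?M. partial i (g n) (x + s *\<^sub>R e (-1)) * (\<psi> x * C x))) (at s within U)"
      unfolding I_def[abs_def] e_def
      by (rule DERIV_integral_translate[OF assms(1,2) g(1) _ _ that])
        (use K(2,3) in \<open>auto simp: U_def e_def intro!: continuous_intros\<close>)
    also have "(LINT x|?M. partial i (g n) (x + s *\<^sub>R e (-1)) * (\<psi> x * C x)) = (LINT x|?M. c x * (\<psi> x * partial i ?h x))"
      using partial_shift[OF g(1)] by (intro Bochner_Integration.integral_cong) (auto simp: Cc)
    \<comment> \<open>The approximant is freed of its derivative by the product rule for the test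
      function \<open>\<lambda>x. \<psi> x * ?h x\<close>, at the cost of a term with the partial
      derivative of \<psi>.\<close>
    also have "- 1 * \<dots> = (LINT x|?M. G x $ i * (\<psi> x * ?h x)) + (LINT x|?M. c x * (partial i \<psi> x * ?h x))"
    proof -
      have "- (LINT x|?M. G x $ i * (\<psi> x * ?h x)) = (LINT x|?M. c x * partial i (\<lambda>x. \<psi> x * ?h x) x)"
        by (rule ibp[symmetric, OF smooth_mult_test_functions[OF \<psi> sh]])
      also have "\<dots> = (LINT x|?M. c x * (\<psi> x * partial i ?h x) + c x * (partial i \<psi> x * ?h x))"
        by (simp add: partial_mult s\<psi> sh distrib_left)
      also have "\<dots> = (LINT x|?M. c x * (\<psi> x * partial i ?h x)) + (LINT x|?M. c x * (partial i \<psi> x * ?h x))"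
        by (intro Bochner_Integration.integral_add integrable_mult_continuous assms(1,2) int_c)
          (intro continuous_intros c\<psi>; simp)+
      finally show ?thesis by simp
    qed
    finally show ?thesis .
  qed
  \<comment> \<open>Uniform convergence of the derivatives leaves convergence to be checked at a
    single point. That point is 0, where \<open>J n\<close> and \<open>I n\<close> coincide
    exactly.\<close>
  have "\<exists>k. \<forall>s\<in>U. (\<lambda>n. J n s - I n s) \<longlonglongrightarrow> k s \<and> (k has_derivative (\<lambda>h. h * \<Phi> C s)) (at s within U)"
  proof (rule has_derivative_sequence[where ?x0.0=0])
    show "convex U" "0 \<in> U" using \<delta>(1) by (auto simp: U_def)
    show "((\<lambda>s. J n s - I n s) has_derivative (\<lambda>h. h * \<Phi> (g n) s)) (at s within U)" if "s \<in> U" for n s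
    proof -
      have "((\<lambda>s. J n s - I n s) has_real_derivative \<Phi> (g n) s) (at s within U)"
        using DERIV_diff[OF J_deriv[OF that] I_deriv[OF that], of n n] by (simp only: \<Phi>_def diff_diff_eq)
      then show ?thesis by (simp only: has_field_derivative_def mult_commute_abs)
    qed
    \<comment> \<open>Among the three integrals of \<Phi> the weight \<open>G\<close> occurs twice
      and \<open>c\<close> once. The resulting bound is free of \<open>s\<close>, which is the
      required uniformity.\<close>
    define L where "L = 2 * (LINT x|?M. \<bar>G x $ i\<bar>) + (LINT x|?M. \<bar>c x\<bar>)"
    have est: "\<bar>\<Phi> (g n) s - \<Phi> C s\<bar> \<le> B / Suc n * L" if "s \<in> U" for n s
    proof -
      have "\<bar>(LINT x|?M. G x $ i * (\<psi> (x + s *\<^sub>R e 1) * g n (x + s *\<^sub>R e 1)))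
           - (LINT x|?M. G x $ i * (\<psi> (x + s *\<^sub>R e 1) * C (x + s *\<^sub>R e 1)))\<bar> \<le> B / Suc n * (LINT x|?M. \<bar>G x $ i\<bar>)"
        using K(2,3) B(1)
        by (intro integral_mult_diff_le assms(1,2) Gi prod_near) (auto intro!: continuous_intros)
      moreover have "\<bar>(LINT x|?M. G x $ i * (\<psi> x * g n (x + s *\<^sub>R e (-1))))
           - (LINT x|?M. G x $ i * (\<psi> x * C (x + s *\<^sub>R e (-1))))\<bar> \<le> B / Suc n * (LINT x|?M. \<bar>G x $ i\<bar>)"
        using K(3) B(1) into[OF _ that, of _ "-1"]
        by (intro integral_mult_diff_le assms(1,2) Gi prod_near) (auto intro!: continuous_intros)
      moreover have "\<bar>(LINT x|?M. c x * (partial i \<psi> x * g n (x + s *\<^sub>R e (-1))))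
           - (LINT x|?M. c x * (partial i \<psi> x * C (x + s *\<^sub>R e (-1))))\<bar> \<le> B / Suc n * (LINT x|?M. \<bar>c x\<bar>)"
        using K(4) B(2) into[OF _ that, of _ "-1"]
        by (intro integral_mult_diff_le assms(1,2) int_c prod_near) (auto intro!: continuous_intros)
      moreover have "b * L = b * (LINT x|?M. \<bar>G x $ i\<bar>) + b * (LINT x|?M. \<bar>G x $ i\<bar>) + b * (LINT x|?M. \<bar>c x\<bar>)" for b
        unfolding L_def by (simp only: distrib_left mult_2)
      ultimately show ?thesis unfolding \<Phi>_def by (smt (verit))
    qed
    show "\<forall>\<^sub>F n in sequentially. \<forall>s\<in>U. \<forall>h. norm (h * \<Phi> (g n) s - h * \<Phi> C s) \<le> \<epsilon> * norm h" if "\<epsilon> > 0" for \<epsilon>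
    proof -
      have "(\<lambda>n. B * L * (1 / Suc n)) \<longlonglongrightarrow> B * L * 0"
        by (intro tendsto_intros LIMSEQ_Suc[OF lim_1_over_n])
      then have "\<forall>\<^sub>F n in sequentially. B * L * (1 / Suc n) < \<epsilon>"
        using that by (simp add: order_tendsto_iff)
      then show ?thesis
      proof eventually_elim
        case (elim n)
        show ?case
        proof (intro ballI allI)
          fix s h :: real assume "s \<in> U"
          have "norm (h * \<Phi> (g n) s - h * \<Phi> C s) = norm h * \<bar>\<Phi> (g n) s - \<Phi> C s\<bar>"
            by (simp add: abs_mult flip: right_diff_distrib)
          also have "\<dots> \<le> norm h * \<epsilon>"
            using est[OF \<open>s \<in> U\<close>, of n] elim by (intro mult_left_mono) (auto simp: mult_ac)
          finally show "norm (h * \<Phi> (g n) s - h * \<Phi> C s) \<le> \<epsilon> * norm h" by (simp add: mult.commute)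
        qed
      qed
    qed
    show "(\<lambda>n. J n 0 - I n 0) \<longlonglongrightarrow> 0"
      by (simp add: J_def I_def mult_ac)
  qed
  then obtain k where k: "\<And>s. s \<in> U \<Longrightarrow> (\<lambda>n. J n s - I n s) \<longlonglongrightarrow> k s"
    "\<And>s. s \<in> U \<Longrightarrow> (k has_derivative (\<lambda>h. h * \<Phi> C s)) (at s within U)" by blast
  \<comment> \<open>For s different from 0 the two approximations need not agree at finite
    \<open>n\<close>. Translating \<open>J\<close> puts the approximant on the fixed factor, so that
    both can be compared with the same integral \<open>?I\<close>.\<close>
  have k0: "k s = 0" if "s \<in> U" for s
  proof -
    let ?I = "LINT x|?M. C (x + s *\<^sub>R e (-1)) * (\<psi> x * C x)"
    have Jn: "J n s = (LINT x|?M. C (x + s *\<^sub>R e (-1)) * (\<psi> x * g n x))" for n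
    proof -
      have "axis i (-1) = - (axis i 1 :: real^2)" by (simp add: axis_def vec_eq_iff)
      then have e: "x + s *\<^sub>R e 1 + s *\<^sub>R e (-1) = x" for x by (simp add: e_def)
      let ?f = "\<lambda>x. C (x + s *\<^sub>R e (-1)) * (\<psi> x * g n x)"
      have "(LINT x|?M. ?f (x + s *\<^sub>R e 1)) = (LINT x|?M. ?f x)"
        using K(2,3) out[OF _ that, of _ 1]
        by (intro integral_lebesgue_on_shift assms(1)) (auto intro!: continuous_intros)
      then show ?thesis by (simp add: J_def e mult_ac)
    qed
    have J: "\<bar>J n s - ?I\<bar> \<le> B / Suc n * (LINT x|?M. \<bar>C (x + s *\<^sub>R e (-1))\<bar>)" for n
      unfolding Jn using K(2,3) B(1)
      by (intro integral_mult_diff_le assms(1,2) int_C prod_near) (auto intro!: continuous_intros)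
    have I': "I n s = (LINT x|?M. C x * (\<psi> x * g n (x + s *\<^sub>R e (-1))))"
        "?I = (LINT x|?M. C x * (\<psi> x * C (x + s *\<^sub>R e (-1))))" for n
      by (simp_all add: I_def mult_ac)
    have I: "\<bar>I n s - ?I\<bar> \<le> B / Suc n * (LINT x|?M. \<bar>C x\<bar>)" for n
      unfolding I' using K(3) B(1) into[OF _ that, of _ "-1"] int_C[of 0]
      by (intro integral_mult_diff_le assms(1,2) prod_near) (auto intro!: continuous_intros)
    define L where "L = B * ((LINT x|?M. \<bar>C (x + s *\<^sub>R e (-1))\<bar>) + (LINT x|?M. \<bar>C x\<bar>))"
    have le: "norm (J n s - I n s) \<le> L * (1 / Suc n)" for n
      using J[of n] I[of n] by (simp add: L_def distrib_left add_divide_distrib)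
    have "(\<lambda>n. L * (1 / Suc n)) \<longlonglongrightarrow> 0"
      using tendsto_mult[OF tendsto_const[of L] LIMSEQ_Suc[OF lim_1_over_n]] by simp
    then have "(\<lambda>n. J n s - I n s) \<longlonglongrightarrow> 0"
      by (rule Lim_null_comparison[OF always_eventually[OF allI[OF le]]])
    then show ?thesis using k(1)[OF that] LIMSEQ_unique by blast
  qed
  have "(k has_real_derivative \<Phi> C 0) (at 0 within U)"
    using k(2)[of 0] \<delta>(1) by (simp add: U_def has_field_derivative_def mult.commute[of _ "\<Phi> C 0"])
  then have "((\<lambda>s. 0) has_real_derivative \<Phi> C 0) (at 0 within U)"
    by (rule has_field_derivative_transform_within[OF _ zero_less_one]) (use \<delta>(1) k0 in \<open>auto simp: U_def\<close>)
  then have "((\<lambda>s. 0) has_real_derivative \<Phi> C 0) (at 0)"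
    using \<delta>(1) at_within_Icc_at[of "-\<delta>" 0 \<delta>] by (simp add: U_def)
  then have "\<Phi> C 0 = 0"
    using DERIV_unique DERIV_const by blast
  moreover have "(LINT x|?M. G x $ i * (\<psi> x * C x)) = (LINT x|?M. G x $ i * (\<psi> x * c x))"
    "(LINT x|?M. c x * (partial i \<psi> x * C x)) = (LINT x|?M. c x * (c x * partial i \<psi> x))"
    by (intro Bochner_Integration.integral_cong; simp add: Cc)+
  ultimately show ?thesis by (simp add: \<Phi>_def)
qed

section \<open>Sobolev spaces and skew symmetry of convection\<close>

lemma L2_diff: "u \<in> L2 \<Omega> \<Longrightarrow> v \<in> L2 \<Omega> \<Longrightarrow> (\<lambda>x. u x - v x) \<in> L2 \<Omega>"
  using L2_add[of u \<Omega> "\<lambda>x. (-1) *\<^sub>R v x"] L2_scaleR[of v \<Omega> "-1"] by simp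

lemma L2_inner_commute: "L2_inner \<Omega> u v = L2_inner \<Omega> v u"
  by (simp add: L2_inner_def inner_commute)

lemma L2_inner_add_left:
  "u \<in> L2 \<Omega> \<Longrightarrow> v \<in> L2 \<Omega> \<Longrightarrow> w \<in> L2 \<Omega> \<Longrightarrow> L2_inner \<Omega> (\<lambda>x. u x + v x) w = L2_inner \<Omega> u w + L2_inner \<Omega> v w"
  by (simp add: L2_inner_def inner_add_left L2_inner_integrable)

lemma L2_inner_diff_left:
  "u \<in> L2 \<Omega> \<Longrightarrow> v \<in> L2 \<Omega> \<Longrightarrow> w \<in> L2 \<Omega> \<Longrightarrow> L2_inner \<Omega> (\<lambda>x. u x - v x) w = L2_inner \<Omega> u w - L2_inner \<Omega> v w"
  by (simp add: L2_inner_def inner_diff_left L2_inner_integrable)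

lemma L2_inner_scaleR_left: "L2_inner \<Omega> (\<lambda>x. a *\<^sub>R u x) v = a * L2_inner \<Omega> u v"
  by (simp add: L2_inner_def)

lemma L2_inner_add_right:
  "u \<in> L2 \<Omega> \<Longrightarrow> v \<in> L2 \<Omega> \<Longrightarrow> w \<in> L2 \<Omega> \<Longrightarrow> L2_inner \<Omega> w (\<lambda>x. u x + v x) = L2_inner \<Omega> w u + L2_inner \<Omega> w v"
  by (simp add: L2_inner_commute[of \<Omega> w] L2_inner_add_left)

lemma L2_inner_diff_right:
  "u \<in> L2 \<Omega> \<Longrightarrow> v \<in> L2 \<Omega> \<Longrightarrow> w \<in> L2 \<Omega> \<Longrightarrow> L2_inner \<Omega> w (\<lambda>x. u x - v x) = L2_inner \<Omega> w u - L2_inner \<Omega> w v"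
  by (simp add: L2_inner_commute[of \<Omega> w] L2_inner_diff_left)

lemma L2_inner_scaleR_right: "L2_inner \<Omega> u (\<lambda>x. a *\<^sub>R v x) = a * L2_inner \<Omega> u v"
  by (simp add: L2_inner_def)

lemma L2_norm_square: "(L2_norm \<Omega> u)\<^sup>2 = L2_inner \<Omega> u u"
  by (simp add: L2_norm_def L2_inner_def)

lemma L2_norm_nonneg: "L2_norm \<Omega> u \<ge> 0"
  by (simp add: L2_norm_def L2_inner_def)

lemma L2_norm_scaleR: "L2_norm \<Omega> (\<lambda>x. a *\<^sub>R u x) = \<bar>a\<bar> * L2_norm \<Omega> u"
  by (simp add: L2_norm_def L2_inner_scaleR_left L2_inner_scaleR_right real_sqrt_mult flip: mult.assoc power2_eq_square)

lemma L2_norm_cong_AE: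
  assumes "AE x in lebesgue_on \<Omega>. u x = v x" "u \<in> L2 \<Omega>" "v \<in> L2 \<Omega>"
  shows "L2_norm \<Omega> u = L2_norm \<Omega> v"
proof -
  have "L2_inner \<Omega> u u = L2_inner \<Omega> v v"
    unfolding L2_inner_def
    by (rule integral_cong_AE)
      (use assms in \<open>auto intro: borel_measurable_integrable[OF L2_inner_integrable]\<close>)
  then show ?thesis by (simp add: L2_norm_def)
qed

text \<open>The squared norm of u - t v is a nonnegative quadratic in t, minimized at t = B / C. The
  degenerate case is separate because elements are representatives: \<open>C = 0\<close> does not
  make \<open>v\<close> the zero function.\<close>

lemma L2_Cauchy_Schwarz:
  assumes "u \<in> L2 \<Omega>" "v \<in> L2 \<Omega>"
  shows "\<bar>L2_inner \<Omega> u v\<bar> \<le> L2_norm \<Omega> u * L2_norm \<Omega> v"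
proof -
  define A B C where "A = L2_inner \<Omega> u u" and "B = L2_inner \<Omega> u v" and "C = L2_inner \<Omega> v v"
  have AC: "A \<ge> 0" "C \<ge> 0" by (simp_all add: A_def C_def flip: L2_norm_square)
  have q: "0 \<le> A - 2 * t * B + t\<^sup>2 * C" for t
  proof -
    have tv: "(\<lambda>x. t *\<^sub>R v x) \<in> L2 \<Omega>" using assms(2) by (rule L2_scaleR)
    then have d: "(\<lambda>x. u x - t *\<^sub>R v x) \<in> L2 \<Omega>" using assms(1) by (intro L2_diff)
    have "L2_inner \<Omega> (\<lambda>x. u x - t *\<^sub>R v x) (\<lambda>x. u x - t *\<^sub>R v x) = A - 2 * t * B + t\<^sup>2 * C"
      using assms tv d
      by (simp add: L2_inner_diff_left L2_inner_diff_right L2_inner_scaleR_left L2_inner_scaleR_right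
          A_def B_def C_def L2_inner_commute[of \<Omega> v u] power2_eq_square algebra_simps)
    moreover have "L2_inner \<Omega> (\<lambda>x. u x - t *\<^sub>R v x) (\<lambda>x. u x - t *\<^sub>R v x) \<ge> 0"
      by (simp flip: L2_norm_square)
    ultimately show ?thesis by simp
  qed
  have "B\<^sup>2 \<le> A * C"
  proof (cases "C = 0")
    case True
    have "B = 0"
    proof (rule ccontr)
      assume "B \<noteq> 0"
      \<comment> \<open>For \<open>C = 0\<close> the quadratic is linear in t, and this choice gives
        it the value -1.\<close>
      with q[of "(A + 1) / (2 * B)"] True show False by simp
    qed
    then show ?thesis using AC by simp
  next
    case False
    then show ?thesis using q[of "B / C"] AC by (simp add: field_simps power2_eq_square)
  qed
  then have "sqrt (B\<^sup>2) \<le> sqrt (A * C)" by (rule real_sqrt_le_mono)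
  then show ?thesis by (simp add: L2_norm_def A_def B_def C_def real_sqrt_mult)
qed

text \<open>The parallelogram identity for the two scaled functions, with the squared norm of their
  difference dropped.\<close>

lemma L2_norm_lincomb_le:
  assumes "u \<in> L2 \<Omega>" "v \<in> L2 \<Omega>"
  shows "(L2_norm \<Omega> (\<lambda>x. a *\<^sub>R u x + b *\<^sub>R v x))\<^sup>2 \<le> 2 * a\<^sup>2 * (L2_norm \<Omega> u)\<^sup>2 + 2 * b\<^sup>2 * (L2_norm \<Omega> v)\<^sup>2"
proof -
  have uv: "(\<lambda>x. a *\<^sub>R u x) \<in> L2 \<Omega>" "(\<lambda>x. b *\<^sub>R v x) \<in> L2 \<Omega>" using assms by (auto intro: L2_scaleR)
  define p q where "p = (\<lambda>x. a *\<^sub>R u x + b *\<^sub>R v x)" and "q = (\<lambda>x. a *\<^sub>R u x - b *\<^sub>R v x)"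
  have "p \<in> L2 \<Omega>" "q \<in> L2 \<Omega>" unfolding p_def q_def using uv by (auto intro: L2_add L2_diff)
  then have "L2_inner \<Omega> p p + L2_inner \<Omega> q q = 2 * a\<^sup>2 * L2_inner \<Omega> u u + 2 * b\<^sup>2 * L2_inner \<Omega> v v"
    using uv assms unfolding p_def q_def
    by (simp add: L2_inner_add_left L2_inner_add_right L2_inner_diff_left L2_inner_diff_right
      L2_inner_scaleR_left L2_inner_scaleR_right power2_eq_square algebra_simps)
  moreover have "L2_inner \<Omega> q q \<ge> 0" by (simp flip: L2_norm_square)
  ultimately show ?thesis by (simp add: L2_norm_square p_def)
qed

lemma L2_inner_tendsto:
  assumes "w \<in> L2 \<Omega>" "f \<in> L2 \<Omega>" "\<And>k. g k \<in> L2 \<Omega>"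
    and lim: "(\<lambda>k. L2_norm \<Omega> (\<lambda>x. f x - g k x)) \<longlonglongrightarrow> 0"
  shows "(\<lambda>k::nat. L2_inner \<Omega> w (g k)) \<longlonglongrightarrow> L2_inner \<Omega> w f"
proof -
  have d: "(\<lambda>x. f x - g k x) \<in> L2 \<Omega>" for k using assms by (intro L2_diff)
  have "(\<lambda>k. L2_inner \<Omega> w (\<lambda>x. f x - g k x)) \<longlonglongrightarrow> 0"
  proof (rule Lim_null_comparison[OF always_eventually])
    show "\<forall>k. norm (L2_inner \<Omega> w (\<lambda>x. f x - g k x)) \<le> L2_norm \<Omega> w * L2_norm \<Omega> (\<lambda>x. f x - g k x)"
      using L2_Cauchy_Schwarz[OF assms(1) d] by simp
    show "(\<lambda>k. L2_norm \<Omega> w * L2_norm \<Omega> (\<lambda>x. f x - g k x)) \<longlonglongrightarrow> 0"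
      using tendsto_mult_right_zero[OF lim] .
  qed
  then have "(\<lambda>k. L2_inner \<Omega> w f - L2_inner \<Omega> w (g k)) \<longlonglongrightarrow> 0"
    using assms by (simp add: L2_inner_diff_right)
  from tendsto_diff[OF tendsto_const[of "L2_inner \<Omega> w f"] this] show ?thesis by simp
qed

lemma H1_L2: "u \<in> H1 \<Omega> \<Longrightarrow> u \<in> L2 \<Omega>"
  by (simp add: H1_def)

lemma weak_grad_L2: "u \<in> H1 \<Omega> \<Longrightarrow> weak_grad \<Omega> u \<in> L2 \<Omega>"
  using is_weak_grad_weak_grad by (auto simp: is_weak_grad_def)

section \<open>Linear structure of H1 and approximation in H10\<close>

context
  fixes \<Omega> :: "(real^2) set"
  assumes \<Omega>: "open \<Omega>" "bounded \<Omega>"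
begin

lemma smooth_L2: "smooth_on UNIV \<psi> \<Longrightarrow> \<psi> \<in> L2 \<Omega>"
  by (intro continuous_closure_L2 \<Omega> smooth_on_continuous)

lemma is_weak_grad_lincomb:
  assumes "u \<in> L2 \<Omega>" "v \<in> L2 \<Omega>" "is_weak_grad \<Omega> u G" "is_weak_grad \<Omega> v H"
  shows "is_weak_grad \<Omega> (\<lambda>x. a * u x + b * v x) (\<lambda>x. a *\<^sub>R G x + b *\<^sub>R H x)"
  unfolding is_weak_grad_def
proof (intro conjI ballI allI)
  show "(\<lambda>x. a *\<^sub>R G x + b *\<^sub>R H x) \<in> L2 \<Omega>"
    using assms by (intro L2_add L2_scaleR) (auto simp: is_weak_grad_def)
  fix \<psi> i assume \<psi>: "\<psi> \<in> test_functions \<Omega>"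
  then have s: "smooth_on UNIV \<psi>" by (simp add: test_functions_def)
  have int: "integrable (lebesgue_on \<Omega>) (\<lambda>x. u x * partial i \<psi> x)" "integrable (lebesgue_on \<Omega>) (\<lambda>x. v x * partial i \<psi> x)"
    "integrable (lebesgue_on \<Omega>) (\<lambda>x. G x $ i * \<psi> x)" "integrable (lebesgue_on \<Omega>) (\<lambda>x. H x $ i * \<psi> x)"
    using assms smooth_L2[OF s] smooth_L2[OF smooth_on_partial[OF s]]
    by (auto intro!: L2_mult_integrable L2_component simp: is_weak_grad_def)
  have "(LINT x|lebesgue_on \<Omega>. (a * u x + b * v x) * partial i \<psi> x)
      = a * (LINT x|lebesgue_on \<Omega>. u x * partial i \<psi> x) + b * (LINT x|lebesgue_on \<Omega>. v x * partial i \<psi> x)"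
    using int by (simp add: distrib_right mult.assoc)
  also have "\<dots> = - (a * (LINT x|lebesgue_on \<Omega>. G x $ i * \<psi> x) + b * (LINT x|lebesgue_on \<Omega>. H x $ i * \<psi> x))"
    using assms(3,4) \<psi> by (simp add: is_weak_grad_def)
  also have "\<dots> = - (LINT x|lebesgue_on \<Omega>. (a *\<^sub>R G x + b *\<^sub>R H x) $ i * \<psi> x)"
    using int by (simp add: distrib_right mult.assoc)
  finally show "(LINT x|lebesgue_on \<Omega>. (a * u x + b * v x) * partial i \<psi> x)
      = - (LINT x|lebesgue_on \<Omega>. (a *\<^sub>R G x + b *\<^sub>R H x) $ i * \<psi> x)" .
qed

lemma H1_lincomb:
  assumes "u \<in> H1 \<Omega>" "v \<in> H1 \<Omega>"
  shows "(\<lambda>x. a * u x + b * v x) \<in> H1 \<Omega>"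
    and "AE x in lebesgue_on \<Omega>. weak_grad \<Omega> (\<lambda>x. a * u x + b * v x) x = a *\<^sub>R weak_grad \<Omega> u x + b *\<^sub>R weak_grad \<Omega> v x"
proof -
  note W = is_weak_grad_lincomb[OF assms[THEN H1_L2] assms[THEN is_weak_grad_weak_grad], of a b]
  have "(\<lambda>x. a * u x + b * v x) \<in> L2 \<Omega>"
    using L2_add[OF L2_scaleR[OF H1_L2[OF assms(1)]] L2_scaleR[OF H1_L2[OF assms(2)]], of a b] by simp
  with W show "(\<lambda>x. a * u x + b * v x) \<in> H1 \<Omega>" by (auto simp: H1_def)
  show "AE x in lebesgue_on \<Omega>. weak_grad \<Omega> (\<lambda>x. a * u x + b * v x) x = a *\<^sub>R weak_grad \<Omega> u x + b *\<^sub>R weak_grad \<Omega> v x"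
    by (rule weak_grad_AE[OF \<Omega> W])
qed

lemma H1_norm_lincomb_le:
  assumes "u \<in> H1 \<Omega>" "v \<in> H1 \<Omega>"
  shows "(H1_norm \<Omega> (\<lambda>x. a * u x + b * v x))\<^sup>2 \<le> 2 * a\<^sup>2 * (H1_norm \<Omega> u)\<^sup>2 + 2 * b\<^sup>2 * (H1_norm \<Omega> v)\<^sup>2"
proof -
  have "L2_norm \<Omega> (weak_grad \<Omega> (\<lambda>x. a * u x + b * v x)) = L2_norm \<Omega> (\<lambda>x. a *\<^sub>R weak_grad \<Omega> u x + b *\<^sub>R weak_grad \<Omega> v x)"
    using H1_lincomb[OF assms] assms by (intro L2_norm_cong_AE L2_add L2_scaleR weak_grad_L2)
  moreover note L2_norm_lincomb_le[OF assms[THEN H1_L2], of a b] L2_norm_lincomb_le[OF assms[THEN weak_grad_L2], of a b]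
  ultimately show ?thesis
    by (simp add: H1_norm_def distrib_left)
qed

text \<open>The product of two test functions is a test function, so its partial derivatives have
  integral zero; the product rule turns this into integration by parts.\<close>

lemma is_weak_grad_test_function:
  assumes "\<phi> \<in> test_functions \<Omega>"
  shows "is_weak_grad \<Omega> \<phi> (\<lambda>x. \<chi> i. partial i \<phi> x)"
  unfolding is_weak_grad_def
proof (intro conjI ballI allI)
  have s: "smooth_on UNIV \<phi>" using assms by (simp add: test_functions_def)
  show "(\<lambda>x. \<chi> i. partial i \<phi> x) \<in> L2 \<Omega>"
    by (intro L2_vec_lambda smooth_L2 smooth_on_partial s)
  fix \<psi> i assume "\<psi> \<in> test_functions \<Omega>"
  then have t: "smooth_on UNIV \<psi>" by (simp add: test_functions_def)
  have "0 = (LINT x|lebesgue_on \<Omega>. partial i (\<lambda>x. \<phi> x * \<psi> x) x)"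
    by (rule test_functions_integral_partial[symmetric, OF \<Omega> smooth_mult_test_functions[OF assms t]])
  also have "\<dots> = (LINT x|lebesgue_on \<Omega>. \<phi> x * partial i \<psi> x + partial i \<phi> x * \<psi> x)"
    by (simp add: partial_mult s t)
  also have "\<dots> = (LINT x|lebesgue_on \<Omega>. \<phi> x * partial i \<psi> x) + (LINT x|lebesgue_on \<Omega>. partial i \<phi> x * \<psi> x)"
    by (intro Bochner_Integration.integral_add L2_mult_integrable smooth_L2 smooth_on_partial s t)
  finally show "(LINT x|lebesgue_on \<Omega>. \<phi> x * partial i \<psi> x) = - (LINT x|lebesgue_on \<Omega>. (\<chi> i. partial i \<phi> x) $ i * \<psi> x)"
    by simp
qed

lemma test_functions_H1: "\<phi> \<in> test_functions \<Omega> \<Longrightarrow> \<phi> \<in> H1 \<Omega>"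
  using is_weak_grad_test_function smooth_L2 by (auto simp: H1_def test_functions_def)

lemma test_functions_lincomb:
  assumes "\<phi> \<in> test_functions \<Omega>" "\<psi> \<in> test_functions \<Omega>"
  shows "(\<lambda>x. a * \<phi> x + b * \<psi> x) \<in> test_functions \<Omega>"
proof -
  obtain K L where "compact K" "K \<subseteq> \<Omega>" "\<And>x. x \<notin> K \<Longrightarrow> \<phi> x = 0" "smooth_on UNIV \<phi>"
    "compact L" "L \<subseteq> \<Omega>" "\<And>x. x \<notin> L \<Longrightarrow> \<psi> x = 0" "smooth_on UNIV \<psi>"
    using test_functionsD[OF assms(1)] test_functionsD[OF assms(2)] by metis
  then show ?thesis
    by (intro test_functionsI[of _ "K \<union> L"] smooth_on_add smooth_on_mult smooth_on_const) auto
qed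

lemma H10_lincomb:
  assumes "u \<in> H10 \<Omega>" "v \<in> H10 \<Omega>"
  shows "(\<lambda>x. a * u x + b * v x) \<in> H10 \<Omega>"
proof -
  obtain \<phi> \<psi> where u: "u \<in> H1 \<Omega>" "\<And>k::nat. \<phi> k \<in> test_functions \<Omega>" "(\<lambda>k. H1_norm \<Omega> (\<lambda>x. u x - \<phi> k x)) \<longlonglongrightarrow> 0"
    and v: "v \<in> H1 \<Omega>" "\<And>k::nat. \<psi> k \<in> test_functions \<Omega>" "(\<lambda>k. H1_norm \<Omega> (\<lambda>x. v x - \<psi> k x)) \<longlonglongrightarrow> 0"
    using assms unfolding H10_def by blast
  let ?f = "\<lambda>k x. (a * u x + b * v x) - (a * \<phi> k x + b * \<psi> k x)"
  have H: "(\<lambda>x. u x - \<phi> k x) \<in> H1 \<Omega>" "(\<lambda>x. v x - \<psi> k x) \<in> H1 \<Omega>" for k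
    using H1_lincomb(1)[OF u(1) test_functions_H1[OF u(2)], of 1 "-1"]
      H1_lincomb(1)[OF v(1) test_functions_H1[OF v(2)], of 1 "-1"] by simp_all
  have "(\<lambda>k. 2 * a\<^sup>2 * (H1_norm \<Omega> (\<lambda>x. u x - \<phi> k x))\<^sup>2 + 2 * b\<^sup>2 * (H1_norm \<Omega> (\<lambda>x. v x - \<psi> k x))\<^sup>2)
      \<longlonglongrightarrow> 2 * a\<^sup>2 * 0\<^sup>2 + 2 * b\<^sup>2 * 0\<^sup>2"
    by (intro tendsto_intros u(3) v(3))
  then have lim: "(\<lambda>k. 2 * a\<^sup>2 * (H1_norm \<Omega> (\<lambda>x. u x - \<phi> k x))\<^sup>2 + 2 * b\<^sup>2 * (H1_norm \<Omega> (\<lambda>x. v x - \<psi> k x))\<^sup>2)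
      \<longlonglongrightarrow> 0" by simp
  have "norm ((H1_norm \<Omega> (?f k))\<^sup>2) \<le> 2 * a\<^sup>2 * (H1_norm \<Omega> (\<lambda>x. u x - \<phi> k x))\<^sup>2 + 2 * b\<^sup>2 * (H1_norm \<Omega> (\<lambda>x. v x - \<psi> k x))\<^sup>2" for k
    using H1_norm_lincomb_le[OF H[of k], of a b] by (simp add: algebra_simps)
  then have "(\<lambda>k. (H1_norm \<Omega> (?f k))\<^sup>2) \<longlonglongrightarrow> 0"
    by (intro Lim_null_comparison[OF _ lim] always_eventually allI)
  then have "(\<lambda>k. sqrt ((H1_norm \<Omega> (?f k))\<^sup>2)) \<longlonglongrightarrow> sqrt 0"
    by (rule tendsto_real_sqrt)
  then have "(\<lambda>k. H1_norm \<Omega> (?f k)) \<longlonglongrightarrow> 0"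
    by (simp add: H1_norm_def)
  then show ?thesis
    using H1_lincomb(1)[OF u(1) v(1)] test_functions_lincomb[OF u(2) v(2)]
    unfolding H10_def by (intro CollectI conjI exI[of _ "\<lambda>k x. a * \<phi> k x + b * \<psi> k x"]) auto
qed

text \<open>\<open>H1_norm\<close> contains the chosen gradient of a difference. It is exchanged
  almost everywhere for the difference of the chosen gradient and the classical one, so that
  identities for test functions can be carried to the limit componentwise.\<close>

lemma H10_approximation:
  assumes "u \<in> H10 \<Omega>"
  obtains \<phi> where "\<And>k::nat. \<phi> k \<in> test_functions \<Omega>"
    "(\<lambda>k. L2_norm \<Omega> (\<lambda>x. u x - \<phi> k x)) \<longlonglongrightarrow> 0"
    "\<And>i. (\<lambda>k. L2_norm \<Omega> (\<lambda>x. weak_grad \<Omega> u x $ i - partial i (\<phi> k) x)) \<longlonglongrightarrow> 0"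
proof -
  obtain \<phi> where u: "u \<in> H1 \<Omega>" and \<phi>: "\<And>k::nat. \<phi> k \<in> test_functions \<Omega>" 
    and lim: "(\<lambda>k. H1_norm \<Omega> (\<lambda>x. u x - \<phi> k x)) \<longlonglongrightarrow> 0"
    using assms unfolding H10_def by blast
  have "norm (L2_norm \<Omega> (\<lambda>x. u x - \<phi> k x)) \<le> H1_norm \<Omega> (\<lambda>x. u x - \<phi> k x)" for k
    by (simp add: H1_norm_def L2_norm_nonneg real_le_rsqrt)
  then have 1: "(\<lambda>k. L2_norm \<Omega> (\<lambda>x. u x - \<phi> k x)) \<longlonglongrightarrow> 0"
    by (intro Lim_null_comparison[OF _ lim] always_eventually allI)
  have "norm (L2_norm \<Omega> (\<lambda>x. weak_grad \<Omega> u x $ i - partial i (\<phi> k) x)) \<le> H1_norm \<Omega> (\<lambda>x. u x - \<phi> k x)" for k i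
  proof -
    let ?P = "\<lambda>x. \<chi> i. partial i (\<phi> k) x" and ?W = "weak_grad \<Omega> (\<lambda>x. u x - \<phi> k x)"
    have W: "is_weak_grad \<Omega> (\<lambda>x. u x - \<phi> k x) (\<lambda>x. weak_grad \<Omega> u x - ?P x)"
      using is_weak_grad_lincomb[OF H1_L2[OF u] H1_L2[OF test_functions_H1[OF \<phi>]] is_weak_grad_weak_grad[OF u]
        is_weak_grad_test_function[OF \<phi>], where a=1 and b="-1"] by simp
    have "(\<lambda>x. u x - \<phi> k x) \<in> H1 \<Omega>"
      using H1_lincomb(1)[OF u test_functions_H1[OF \<phi>], of 1 "-1"] by simp
    then have WL: "?W \<in> L2 \<Omega>" by (rule weak_grad_L2)
    have DL: "(\<lambda>x. weak_grad \<Omega> u x - ?P x) \<in> L2 \<Omega>" using W by (simp add: is_weak_grad_def)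
    have "L2_inner \<Omega> (\<lambda>x. weak_grad \<Omega> u x $ i - partial i (\<phi> k) x) (\<lambda>x. weak_grad \<Omega> u x $ i - partial i (\<phi> k) x)
       \<le> L2_inner \<Omega> (\<lambda>x. weak_grad \<Omega> u x - ?P x) (\<lambda>x. weak_grad \<Omega> u x - ?P x)"
      unfolding L2_inner_def
    proof (rule integral_mono)
      show "integrable (lebesgue_on \<Omega>) (\<lambda>x. (weak_grad \<Omega> u x - ?P x) \<bullet> (weak_grad \<Omega> u x - ?P x))"
        by (rule L2_inner_integrable[OF DL DL])
      show "integrable (lebesgue_on \<Omega>) (\<lambda>x. (weak_grad \<Omega> u x $ i - partial i (\<phi> k) x) \<bullet> (weak_grad \<Omega> u x $ i - partial i (\<phi> k) x))"
        using L2_component[OF DL, of i] by (intro L2_inner_integrable) simp_all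
      show "(weak_grad \<Omega> u x $ i - partial i (\<phi> k) x) \<bullet> (weak_grad \<Omega> u x $ i - partial i (\<phi> k) x)
          \<le> (weak_grad \<Omega> u x - ?P x) \<bullet> (weak_grad \<Omega> u x - ?P x)" for x
        using power_mono[OF component_le_norm_cart[of "weak_grad \<Omega> u x - ?P x" i], of 2]
        by (simp add: power2_eq_square dot_square_norm)
    qed
    then have "L2_norm \<Omega> (\<lambda>x. weak_grad \<Omega> u x $ i - partial i (\<phi> k) x) \<le> L2_norm \<Omega> (\<lambda>x. weak_grad \<Omega> u x - ?P x)"
      by (simp add: L2_norm_def)
    also have "\<dots> = L2_norm \<Omega> ?W"
      using weak_grad_AE[OF \<Omega> W] by (intro L2_norm_cong_AE WL DL) auto
    also have "\<dots> \<le> H1_norm \<Omega> (\<lambda>x. u x - \<phi> k x)"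
      by (simp add: H1_norm_def L2_norm_nonneg real_le_rsqrt)
    finally show ?thesis by (simp add: L2_norm_nonneg)
  qed
  then have "(\<lambda>k. L2_norm \<Omega> (\<lambda>x. weak_grad \<Omega> u x $ i - partial i (\<phi> k) x)) \<longlonglongrightarrow> 0" for i
    by (intro Lim_null_comparison[OF _ lim] always_eventually allI)
  with that[OF \<phi> 1] show ?thesis .
qed

text \<open>Formally the sum of the integrands is the \<open>j\<close>-th partial derivative of
  \<open>a x * (c x * c x)\<close>. For test functions in place of \<open>a\<close> this is
  \<open>weak_grad_square_test\<close>; both terms are continuous under the approximation of
  \<open>a\<close>, because \<open>c * c\<close> and \<open>c\<close> times its gradient lie in L2.
  The boundary term is removed by \<open>a\<close> alone, so the identity serves concentrations as
  well as velocity components.\<close>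

lemma convection_skew:
  assumes a: "a \<in> H10 \<Omega>" and c: "c \<in> H1 \<Omega>" "continuous_on (closure \<Omega>) c"
  shows "2 * (LINT x|lebesgue_on \<Omega>. a x * (weak_grad \<Omega> c x $ j * c x)) + (LINT x|lebesgue_on \<Omega>. weak_grad \<Omega> a x $ j * (c x * c x)) = 0"
proof -
  obtain \<phi> where \<phi>: "\<And>k::nat. \<phi> k \<in> test_functions \<Omega>"
    and lim: "(\<lambda>k. L2_norm \<Omega> (\<lambda>x. a x - \<phi> k x)) \<longlonglongrightarrow> 0"
      "\<And>i. (\<lambda>k. L2_norm \<Omega> (\<lambda>x. weak_grad \<Omega> a x $ i - partial i (\<phi> k) x)) \<longlonglongrightarrow> 0"
    by (rule H10_approximation[OF a]) (rule that)
  have s: "smooth_on UNIV (\<phi> k)" for k using \<phi>[of k] by (simp add: test_functions_def)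
  obtain B where B: "\<And>x. x \<in> \<Omega> \<Longrightarrow> \<bar>c x\<bar> \<le> B"
    using continuous_closure_bounded[OF \<Omega>(2) c(2)] by metis
  have a1: "a \<in> H1 \<Omega>" using a by (simp add: H10_def)
  have cc: "(\<lambda>x. c x * c x) \<in> L2 \<Omega>"
    by (intro continuous_closure_L2 \<Omega> continuous_intros c)
  have gc: "(\<lambda>x. weak_grad \<Omega> c x $ j * c x) \<in> L2 \<Omega>"
    using L2_bounded_mult[OF L2_component[OF weak_grad_L2[OF c(1)]] continuous_closure_measurable[OF \<Omega>(1) c(2)] B \<Omega>(1), of j]
    by (simp add: mult.commute)
  have "(\<lambda>k. L2_inner \<Omega> (\<lambda>x. c x * c x) (partial j (\<phi> k))) \<longlonglongrightarrow> L2_inner \<Omega> (\<lambda>x. c x * c x) (\<lambda>x. weak_grad \<Omega> a x $ j)"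
    by (intro L2_inner_tendsto cc L2_component weak_grad_L2 a1 smooth_L2 smooth_on_partial s lim)
  moreover have "L2_inner \<Omega> (\<lambda>x. c x * c x) (partial j (\<phi> k)) = - 2 * L2_inner \<Omega> (\<lambda>x. weak_grad \<Omega> c x $ j * c x) (\<phi> k)" for k
    using weak_grad_square_test[OF \<Omega> is_weak_grad_weak_grad[OF c(1)] c(2) \<phi>[of k], of j]
    by (simp add: L2_inner_def mult_ac)
  moreover have "(\<lambda>k. - 2 * L2_inner \<Omega> (\<lambda>x. weak_grad \<Omega> c x $ j * c x) (\<phi> k)) \<longlonglongrightarrow> - 2 * L2_inner \<Omega> (\<lambda>x. weak_grad \<Omega> c x $ j * c x) a"
    by (intro tendsto_mult[OF tendsto_const] L2_inner_tendsto gc H1_L2 a1 smooth_L2 s lim)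
  ultimately have "L2_inner \<Omega> (\<lambda>x. c x * c x) (\<lambda>x. weak_grad \<Omega> a x $ j) = - 2 * L2_inner \<Omega> (\<lambda>x. weak_grad \<Omega> c x $ j * c x) a"
    using LIMSEQ_unique by simp
  then show ?thesis by (simp add: L2_inner_def mult_ac)
qed

end

section \<open>Finite element spaces and forms\<close>

lemma L2_norm_triangle:
  assumes "u \<in> L2 \<Omega>" "v \<in> L2 \<Omega>"
  shows "L2_norm \<Omega> (\<lambda>x. u x + v x) \<le> L2_norm \<Omega> u + L2_norm \<Omega> v"
proof (rule power2_le_imp_le)
  have "(L2_norm \<Omega> (\<lambda>x. u x + v x))\<^sup>2 = L2_inner \<Omega> u u + 2 * L2_inner \<Omega> u v + L2_inner \<Omega> v v"
    using assms L2_add[OF assms]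
    by (simp add: L2_norm_square L2_inner_add_left L2_inner_add_right L2_inner_commute[of \<Omega> v u])
  also have "\<dots> \<le> (L2_norm \<Omega> u + L2_norm \<Omega> v)\<^sup>2"
    using L2_Cauchy_Schwarz[OF assms] by (simp add: power2_sum L2_norm_square)
  finally show "(L2_norm \<Omega> (\<lambda>x. u x + v x))\<^sup>2 \<le> (L2_norm \<Omega> u + L2_norm \<Omega> v)\<^sup>2" .
qed (simp add: L2_norm_nonneg)

lemma P1_lincomb: "w \<in> P1 \<Longrightarrow> w' \<in> P1 \<Longrightarrow> (\<lambda>x. a * w x + b * w' x) \<in> P1"
proof -
  assume "w \<in> P1" "w' \<in> P1"
  then obtain p d p' d' where "\<And>x. w x = p \<bullet> x + d" "\<And>x. w' x = p' \<bullet> x + d'"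
    unfolding P1_def by blast
  then show ?thesis
    unfolding P1_def
    by (intro CollectI exI[of _ "a *\<^sub>R p + b *\<^sub>R p'"] exI[of _ "a * d + b * d'"]) (simp add: inner_simps algebra_simps)
qed

lemma mean_altdef: "mean u v = (\<lambda>x. (1/2) *\<^sub>R u x + (1/2) *\<^sub>R v x)"
  by (simp add: mean_def[abs_def] scaleR_add_right)

text \<open>Pairing a difference with a sum leaves a difference of squares; the factor
  \<open>4 * \<tau>\<close> clears the 1 / (2 \<tau>) of the difference quotient and the 1/2 of the
  mean.\<close>

lemma L2_inner_central_diff_mean:
  assumes "v \<in> L2 \<Omega>" "w \<in> L2 \<Omega>" "\<tau> \<noteq> 0"
  shows "4 * \<tau> * L2_inner \<Omega> (central_diff \<tau> v w) (mean v w) = (L2_norm \<Omega> v)\<^sup>2 - (L2_norm \<Omega> w)\<^sup>2"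
proof -
  have "L2_inner \<Omega> (central_diff \<tau> v w) (mean v w) = 1 / (2 * \<tau>) * (1/2 * L2_inner \<Omega> (\<lambda>x. v x - w x) (\<lambda>x. v x + w x))"
    unfolding central_diff_def[abs_def] mean_def[abs_def]
    by (simp only: L2_inner_scaleR_left L2_inner_scaleR_right)
  also have "L2_inner \<Omega> (\<lambda>x. v x - w x) (\<lambda>x. v x + w x) = (L2_norm \<Omega> v)\<^sup>2 - (L2_norm \<Omega> w)\<^sup>2"
    using assms L2_add[OF assms(1,2)]
    by (simp add: L2_inner_diff_left L2_inner_add_right L2_norm_square L2_inner_commute[of \<Omega> w v])
  finally show ?thesis using assms(3) by simp
qed

context
  fixes \<Omega> :: "(real^2) set"
  assumes \<Omega>: "open \<Omega>" "bounded \<Omega>"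
begin

lemma V_h_componentD:
  assumes "v \<in> V_h \<Omega> \<T>"
  shows "(\<lambda>x. v x $ i) \<in> H10 \<Omega>" "(\<lambda>x. v x $ i) \<in> H1 \<Omega>" "continuous_on (closure \<Omega>) (\<lambda>x. v x $ i)"
  using assms by (auto simp: V_h_def V_space_def H10_def intro: continuous_intros)

lemma V_h_L2:
  assumes "v \<in> V_h \<Omega> \<T>"
  shows "v \<in> L2 \<Omega>"
  using L2_vec_lambda[of "\<lambda>i x. v x $ i", OF H1_L2[OF V_h_componentD(2)[OF assms]]] by simp

lemma V_h_weak_jac_L2: "v \<in> V_h \<Omega> \<T> \<Longrightarrow> weak_jac \<Omega> v \<in> L2 \<Omega>"
  unfolding weak_jac_def[abs_def] by (intro L2_vec_lambda weak_grad_L2 V_h_componentD)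

text \<open>Linearity makes the mean of two time levels an admissible test function.\<close>

lemma V_h_lincomb:
  assumes "v \<in> V_h \<Omega> \<T>" "w \<in> V_h \<Omega> \<T>"
  shows "(\<lambda>x. a *\<^sub>R v x + b *\<^sub>R w x) \<in> V_h \<Omega> \<T>"
proof -
  have "(\<lambda>x. a *\<^sub>R v x + b *\<^sub>R w x) \<in> V_space \<Omega>"
    using H10_lincomb[OF \<Omega> V_h_componentD(1)[OF assms(1)] V_h_componentD(1)[OF assms(2)], of a _ b]
    by (simp add: V_space_def)
  moreover have "continuous_on (closure \<Omega>) (\<lambda>x. a *\<^sub>R v x + b *\<^sub>R w x)"
    using assms by (auto simp: V_h_def intro!: continuous_intros)
  moreover have "\<exists>p\<in>P1. \<exists>d. \<forall>x\<in>F ` ref_triangle. (a *\<^sub>R v x + b *\<^sub>R w x) $ i = p x + d * bubble F x"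
    if "F \<in> \<T>" for F i
  proof -
    have "\<exists>p\<in>P1. \<exists>d. \<forall>x\<in>F ` ref_triangle. v x $ i = p x + d * bubble F x" if "v \<in> V_h \<Omega> \<T>" for v
      using that \<open>F \<in> \<T>\<close> by (simp add: V_h_def)
    from this[OF assms(1)] this[OF assms(2)]
    obtain p d q d' where "p \<in> P1" "\<forall>x\<in>F ` ref_triangle. v x $ i = p x + d * bubble F x"
      "q \<in> P1" "\<forall>x\<in>F ` ref_triangle. w x $ i = q x + d' * bubble F x"
      by auto
    then show ?thesis
      by (intro bexI[OF _ P1_lincomb[of p q a b]] exI[of _ "a * d + b * d'"]) (auto simp: algebra_simps)
  qed
  ultimately show ?thesis by (simp add: V_h_def)
qed

lemma V_h_mean: "v \<in> V_h \<Omega> \<T> \<Longrightarrow> w \<in> V_h \<Omega> \<T> \<Longrightarrow> mean v w \<in> V_h \<Omega> \<T>"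
  unfolding mean_altdef by (rule V_h_lincomb)

lemma H_tilde_hD:
  assumes "c \<in> H_tilde_h \<Omega> \<T>"
  shows "c \<in> H1 \<Omega>" "c \<in> L2 \<Omega>" "continuous_on (closure \<Omega>) c"
  using assms by (auto simp: H_tilde_h_def H_tilde_def H1_L2)

lemma H_tilde_h_lincomb:
  assumes "c \<in> H_tilde_h \<Omega> \<T>" "d \<in> H_tilde_h \<Omega> \<T>"
  shows "(\<lambda>x. a * c x + b * d x) \<in> H_tilde_h \<Omega> \<T>"
proof -
  have H1: "(\<lambda>x. a * c x + b * d x) \<in> H1 \<Omega>"
    by (intro H1_lincomb(1) \<Omega> H_tilde_hD(1)[OF assms(1)] H_tilde_hD(1)[OF assms(2)])
  moreover have "(LINT x|lebesgue_on \<Omega>. a * c x + b * d x) = 0"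
    using assms L2_integrable[OF \<Omega> H_tilde_hD(2)[OF assms(1)]] L2_integrable[OF \<Omega> H_tilde_hD(2)[OF assms(2)]]
    by (simp add: H_tilde_h_def H_tilde_def L20_def)
  moreover have "continuous_on (closure \<Omega>) (\<lambda>x. a * c x + b * d x)"
    using assms by (auto simp: H_tilde_h_def intro!: continuous_intros)
  moreover have "\<exists>p\<in>P1. \<forall>x\<in>F ` ref_triangle. a * c x + b * d x = p x" if "F \<in> \<T>" for F
  proof -
    have "\<exists>p\<in>P1. \<forall>x\<in>F ` ref_triangle. r x = p x" if "r \<in> H_tilde_h \<Omega> \<T>" for r
      using that \<open>F \<in> \<T>\<close> by (simp add: H_tilde_h_def)
    from this[OF assms(1)] this[OF assms(2)]
    obtain p q where "p \<in> P1" "\<forall>x\<in>F ` ref_triangle. c x = p x" "q \<in> P1" "\<forall>x\<in>F ` ref_triangle. d x = q x"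
      by auto
    then show ?thesis
      by (intro bexI[OF _ P1_lincomb[of p q a b]]) auto
  qed
  ultimately show ?thesis by (simp add: H_tilde_h_def H_tilde_def L20_def H1_L2)
qed

lemma H_tilde_h_mean: "c \<in> H_tilde_h \<Omega> \<T> \<Longrightarrow> d \<in> H_tilde_h \<Omega> \<T> \<Longrightarrow> mean c d \<in> H_tilde_h \<Omega> \<T>"
  unfolding mean_altdef real_scaleR_def by (rule H_tilde_h_lincomb)

lemma L2_norm_weak_grad_sum:
  assumes "c \<in> H1 \<Omega>" "d \<in> H1 \<Omega>"
  shows "L2_norm \<Omega> (weak_grad \<Omega> (\<lambda>x. c x + d x)) = 2 * L2_norm \<Omega> (weak_grad \<Omega> (mean c d))"
proof -
  have m: "mean c d \<in> H1 \<Omega>"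
    using H1_lincomb(1)[OF \<Omega> assms, of "1/2" "1/2"] by (simp add: mean_altdef)
  \<comment> \<open>The energy argument produces the gradient of the mean, the theorem speaks of
    that of the sum. The vanishing second term merely fits the two-term form of
    \<open>H1_lincomb\<close>.\<close>
  have s: "(\<lambda>x. c x + d x) = (\<lambda>x. 2 * mean c d x + 0 * mean c d x)"
    by (simp add: mean_def fun_eq_iff field_simps)
  have "AE x in lebesgue_on \<Omega>. weak_grad \<Omega> (\<lambda>x. c x + d x) x = 2 *\<^sub>R weak_grad \<Omega> (mean c d) x"
    unfolding s using H1_lincomb(2)[OF \<Omega> m m, of 2 0] by simp
  moreover have "(\<lambda>x. c x + d x) \<in> H1 \<Omega>"
    unfolding s by (rule H1_lincomb(1)[OF \<Omega> m m])
  ultimately have "L2_norm \<Omega> (weak_grad \<Omega> (\<lambda>x. c x + d x)) = L2_norm \<Omega> (\<lambda>x. 2 *\<^sub>R weak_grad \<Omega> (mean c d) x)"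
    by (intro L2_norm_cong_AE weak_grad_L2 L2_scaleR m)
  then show ?thesis by (simp add: L2_norm_scaleR)
qed

lemma L2_norm_weak_jac_sum:
  assumes "v \<in> V_h \<Omega> \<T>" "w \<in> V_h \<Omega> \<T>"
  shows "L2_norm \<Omega> (weak_jac \<Omega> (\<lambda>x. v x + w x)) = 2 * L2_norm \<Omega> (weak_jac \<Omega> (mean v w))"
proof -
  let ?m = "mean v w"
  have m: "?m \<in> V_h \<Omega> \<T>" by (rule V_h_mean[OF assms])
  have s: "(\<lambda>y. (v y + w y) $ i) = (\<lambda>y. 2 * ?m y $ i + 0 * ?m y $ i)" for i
    by (simp add: mean_def fun_eq_iff field_simps)
  have "AE x in lebesgue_on \<Omega>. weak_grad \<Omega> (\<lambda>y. (v y + w y) $ i) x = 2 *\<^sub>R weak_grad \<Omega> (\<lambda>y. ?m y $ i) x" for i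
    unfolding s using H1_lincomb(2)[OF \<Omega> V_h_componentD(2)[OF m] V_h_componentD(2)[OF m], of 2 i 0 i] by simp
  then have "AE x in lebesgue_on \<Omega>. \<forall>i. weak_grad \<Omega> (\<lambda>y. (v y + w y) $ i) x = 2 *\<^sub>R weak_grad \<Omega> (\<lambda>y. ?m y $ i) x"
    by (subst AE_all_countable) (rule allI)
  then have "AE x in lebesgue_on \<Omega>. weak_jac \<Omega> (\<lambda>x. v x + w x) x = 2 *\<^sub>R weak_jac \<Omega> ?m x"
    by eventually_elim (simp add: weak_jac_def vec_eq_iff)
  moreover have "(\<lambda>x. v x + w x) \<in> V_h \<Omega> \<T>"
    using V_h_lincomb[OF assms, of 1 1] by simp
  ultimately have "L2_norm \<Omega> (weak_jac \<Omega> (\<lambda>x. v x + w x)) = L2_norm \<Omega> (\<lambda>x. 2 *\<^sub>R weak_jac \<Omega> ?m x)"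
    by (intro L2_norm_cong_AE V_h_weak_jac_L2[where \<T>=\<T>] L2_scaleR m)
  then show ?thesis by (simp add: L2_norm_scaleR)
qed

section \<open>Skew symmetry and coercivity of the forms\<close>

lemma weak_grad_mult_integrable:
  assumes "c \<in> H1 \<Omega>" "continuous_on (closure \<Omega>) f"
  shows "integrable (lebesgue_on \<Omega>) (\<lambda>x. weak_grad \<Omega> c x $ j * f x)"
  using assms by (intro integrable_mult_continuous \<Omega> L2_integrable L2_component weak_grad_L2)

text \<open>This is \<open>convection_skew\<close> for the \<open>j\<close>-th component of
  \<open>u\<close> and the \<open>i\<close>-th of \<open>v\<close>, summed over both indices; the
  diagonal derivatives \<open>?D j\<close> add up to the divergence.\<close>

lemma form_B_skew:
  assumes u: "u \<in> V_h \<Omega> \<T>" and v: "v \<in> V_h \<Omega> \<T>"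
  shows "form_B \<Omega> u v v = 0"
proof -
  let ?M = "lebesgue_on \<Omega>"
  let ?J = "\<lambda>i j x. weak_grad \<Omega> (\<lambda>y. v y $ i) x $ j" and ?D = "\<lambda>j x. weak_grad \<Omega> (\<lambda>y. u y $ j) x $ j"
  have iJ: "integrable ?M (\<lambda>x. u x $ j * (?J i j x * v x $ i))" for i j
    using weak_grad_mult_integrable[OF V_h_componentD(2)[OF v] continuous_on_mult[OF V_h_componentD(3)[OF u] V_h_componentD(3)[OF v]], of i j j i]
    by (simp add: mult_ac)
  have iD: "integrable ?M (\<lambda>x. ?D j x * (v x $ i * v x $ i))" for i j
    by (intro weak_grad_mult_integrable V_h_componentD(2)[OF u] continuous_on_mult V_h_componentD(3)[OF v])
  have "(LINT x|?M. (weak_jac \<Omega> v x *v u x) \<bullet> v x) = (LINT x|?M. (\<Sum>i\<in>UNIV. \<Sum>j\<in>UNIV. u x $ j * (?J i j x * v x $ i)))"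
    by (simp add: inner_vec_def matrix_vector_mult_def weak_jac_def sum_distrib_left sum_distrib_right mult_ac)
  also have "\<dots> = (\<Sum>i\<in>UNIV. \<Sum>j\<in>UNIV. (LINT x|?M. u x $ j * (?J i j x * v x $ i)))"
    by (simp add: iJ)
  finally have 1: "(LINT x|?M. (weak_jac \<Omega> v x *v u x) \<bullet> v x) = \<dots>" .
  have "(LINT x|?M. weak_div \<Omega> u x * (v x \<bullet> v x)) = (LINT x|?M. (\<Sum>i\<in>UNIV. \<Sum>j\<in>UNIV. ?D j x * (v x $ i * v x $ i)))"
    by (simp add: weak_div_def inner_vec_def trace_def weak_jac_def sum_distrib_left sum_distrib_right)
  also have "\<dots> = (\<Sum>i\<in>UNIV. \<Sum>j\<in>UNIV. (LINT x|?M. ?D j x * (v x $ i * v x $ i)))"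
    by (simp add: iD)
  finally have 2: "(LINT x|?M. weak_div \<Omega> u x * (v x \<bullet> v x)) = \<dots>" .
  have "2 * form_B \<Omega> u v v = (\<Sum>i\<in>UNIV. \<Sum>j\<in>UNIV. 2 * (LINT x|?M. u x $ j * (?J i j x * v x $ i)) + (LINT x|?M. ?D j x * (v x $ i * v x $ i)))"
    by (simp add: form_B_def 1 2 sum.distrib sum_distrib_left)
  also have "\<dots> = 0"
    using convection_skew[OF \<Omega> V_h_componentD(1)[OF u] V_h_componentD(2,3)[OF v]] by simp
  finally show ?thesis by simp
qed

lemma form_b_skew:
  assumes u: "u \<in> V_h \<Omega> \<T>" and c: "c \<in> H1 \<Omega>" "continuous_on (closure \<Omega>) c"
  shows "form_b \<Omega> u c c = 0"
proof -
  let ?M = "lebesgue_on \<Omega>"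
  let ?G = "\<lambda>j x. weak_grad \<Omega> c x $ j" and ?D = "\<lambda>j x. weak_grad \<Omega> (\<lambda>y. u y $ j) x $ j"
  have iG: "integrable ?M (\<lambda>x. u x $ j * (?G j x * c x))" for j
    using weak_grad_mult_integrable[OF c(1) continuous_on_mult[OF V_h_componentD(3)[OF u] c(2)], of j j]
    by (simp add: mult_ac)
  have iD: "integrable ?M (\<lambda>x. ?D j x * (c x * c x))" for j
    by (intro weak_grad_mult_integrable V_h_componentD(2)[OF u] continuous_on_mult c)
  have "(LINT x|?M. (u x \<bullet> weak_grad \<Omega> c x) * c x) = (LINT x|?M. (\<Sum>j\<in>UNIV. u x $ j * (?G j x * c x)))"
    by (simp add: inner_vec_def sum_distrib_left sum_distrib_right mult_ac)
  also have "\<dots> = (\<Sum>j\<in>UNIV. (LINT x|?M. u x $ j * (?G j x * c x)))"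
    by (simp add: iG)
  finally have 1: "(LINT x|?M. (u x \<bullet> weak_grad \<Omega> c x) * c x) = \<dots>" .
  have "(LINT x|?M. weak_div \<Omega> u x * c x * c x) = (LINT x|?M. (\<Sum>j\<in>UNIV. ?D j x * (c x * c x)))"
    by (simp add: weak_div_def trace_def weak_jac_def sum_distrib_right mult.assoc)
  also have "\<dots> = (\<Sum>j\<in>UNIV. (LINT x|?M. ?D j x * (c x * c x)))"
    by (simp add: iD)
  finally have 2: "(LINT x|?M. weak_div \<Omega> u x * c x * c x) = \<dots>" .
  have "2 * form_b \<Omega> u c c = (\<Sum>j\<in>UNIV. 2 * (LINT x|?M. u x $ j * (?G j x * c x)) + (LINT x|?M. ?D j x * (c x * c x)))"
    by (simp add: form_b_def 1 2 sum.distrib sum_distrib_left)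
  also have "\<dots> = 0"
    using convection_skew[OF \<Omega> V_h_componentD(1)[OF u] c] by simp
  finally show ?thesis by simp
qed

text \<open>The upper bound \<open>K\<close> and the continuity of \<nu> give boundedness and
  measurability of the coefficient, hence integrability; the lower bound is then applied
  pointwise.\<close>

lemma form_A_coercive:
  assumes "\<And>x. \<kappa> \<le> \<nu> x \<and> \<nu> x \<le> K" "\<kappa> > 0" "continuous_on UNIV \<nu>"
    "c \<in> L2 \<Omega>" "v \<in> V_h \<Omega> \<T>"
  shows "form_A \<Omega> \<nu> \<alpha> c v v \<ge> \<kappa> * (L2_norm \<Omega> (weak_jac \<Omega> v))\<^sup>2"
proof -
  let ?J = "weak_jac \<Omega> v"
  have J: "?J \<in> L2 \<Omega>" by (rule V_h_weak_jac_L2[OF assms(5)])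
  have "(\<lambda>x. c x + \<alpha>) \<in> borel_measurable (lebesgue_on \<Omega>)"
    using L2_measurable[OF assms(4)] by simp
  then have "(\<lambda>x. \<nu> (c x + \<alpha>)) \<in> borel_measurable (lebesgue_on \<Omega>)"
    by (rule borel_measurable_continuous_on[OF assms(3)])
  moreover have "\<bar>\<nu> y\<bar> \<le> K" for y using assms(1)[of y] assms(2) by linarith
  ultimately have nJ: "(\<lambda>x. \<nu> (c x + \<alpha>) *\<^sub>R ?J x) \<in> L2 \<Omega>"
    using J \<Omega>(1) by (intro L2_bounded_mult[where B=K])
  have "L2_inner \<Omega> (\<lambda>x. \<kappa> *\<^sub>R ?J x) ?J \<le> L2_inner \<Omega> (\<lambda>x. \<nu> (c x + \<alpha>) *\<^sub>R ?J x) ?J"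
    unfolding L2_inner_def
  proof (rule integral_mono)
    show "(\<kappa> *\<^sub>R ?J x) \<bullet> ?J x \<le> (\<nu> (c x + \<alpha>) *\<^sub>R ?J x) \<bullet> ?J x" for x
      using assms(1)[of "c x + \<alpha>"] by (simp add: mult_right_mono)
  qed (intro L2_inner_integrable L2_scaleR J nJ)+
  then show ?thesis
    by (simp add: form_A_def L2_inner_scaleR_left L2_norm_square)
qed

lemma L2_norm_one_square: "(L2_norm \<Omega> (\<lambda>x. 1::real))\<^sup>2 = measure lebesgue \<Omega>"
  using \<Omega> by (simp add: L2_norm_square L2_inner_def measure_restrict_space)

end

section \<open>A leap-frog Gronwall inequality\<close>

text \<open>The value is far from optimal; what matters is that neither the time step nor the number of steps enters.\<close>

definition leapfrog_const :: "real \<Rightarrow> real \<Rightarrow> real \<Rightarrow> real \<Rightarrow> real \<Rightarrow> real" where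
  "leapfrog_const T a b p q =
     15 + 26 * T * (p + 2 + q * T * exp (a * T) * (1 + b)) + (1 + 2 * a * T) * exp (a * T) * (1 + b) + 2 * b"

text \<open>Levels of even and of odd index form two separate chains, each of which telescopes, so
  two values survive at either end.\<close>

lemma sum_leapfrog_telescope:
  fixes z :: "nat \<Rightarrow> real"
  shows "(\<Sum>n=1..M. z (n+1) - z (n-1)) = z (M+1) + z M - z 1 - z 0"
  by (induction M) simp_all

text \<open>Only the old value stands on the right, so 1 + a <= exp a suffices. In the application
  \<open>a\<close> is proportional to the time step, and it may be arbitrarily large.\<close>

lemma discrete_gronwall:
  fixes s :: "nat \<Rightarrow> real"
  assumes step: "\<And>n. n < M \<Longrightarrow> s (Suc n) \<le> (1 + a) * s n + r" and "a \<ge> 0" "r \<ge> 0" "s 0 \<ge> 0" "n \<le> M"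
  shows "s n \<le> exp (a * real n) * (s 0 + real n * r)"
  using \<open>n \<le> M\<close>
proof (induction n)
  case (Suc n)
  have "s (Suc n) \<le> (1 + a) * s n + r" using step[of n] Suc.prems by simp
  also have "(1 + a) * s n \<le> exp a * (exp (a * real n) * (s 0 + real n * r))"
    using Suc assms(2-4) exp_ge_add_one_self[of a]
    by (intro order_trans[OF mult_left_mono mult_right_mono]) auto
  also have "\<dots> = exp (a * real (Suc n)) * (s 0 + real n * r)"
    by (simp add: distrib_left exp_add)
  finally have "s (Suc n) \<le> exp (a * real (Suc n)) * (s 0 + real n * r) + r" by simp
  moreover have "r \<le> exp (a * real (Suc n)) * r"
    using assms(2,3) mult_right_mono[of 1 "exp (a * real (Suc n))" r] by simp
  ultimately show ?case by (simp add: distrib_left distrib_right)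
qed simp

text \<open>In the application \<open>x\<close> and \<open>y\<close> are the L2 norms of velocity
  and concentration, \<open>D\<close> and \<open>E\<close> the squared norms of the gradients of the
  sums of the levels \<open>n+1\<close> and \<open>n-1\<close>, \<open>F\<close> bounds the total
  force, \<phi> is the squared norm of the body force and \<open>w\<close> the measure of \<Omega>.
  The coupling is one-sided: \<open>F\<close> is controlled by \<open>y\<close> and the data, and
  \<open>y\<close> by itself.\<close>

lemma leapfrog_gronwall:
  fixes x y F D E \<phi> :: "nat \<Rightarrow> real"
  assumes \<tau>: "\<tau> > 0" "\<tau> * real N = T"
    and nonneg: "a \<ge> 0" "b \<ge> 0" "p \<ge> 0" "q \<ge> 0" "w \<ge> 0" "\<kappa> \<ge> 0" "\<theta> \<ge> 0"
      "\<And>n. x n \<ge> 0" "\<And>n. y n \<ge> 0" "\<And>n. D n \<ge> 0" "\<And>n. E n \<ge> 0" "\<And>n. F n \<ge> 0" "\<And>n. \<phi> n \<ge> 0"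
    and y_step: "\<And>n. n \<in> {1..N-1} \<Longrightarrow> (y (n+1))\<^sup>2 - (y (n-1))\<^sup>2 + \<theta> * \<tau> / 2 * E n \<le> \<tau> * (a * (y n)\<^sup>2 + b * w)"
    and x_step: "\<And>n. n \<in> {1..N-1} \<Longrightarrow> (x (n+1))\<^sup>2 - (x (n-1))\<^sup>2 + \<kappa> * \<tau> * D n \<le> 2 * \<tau> * F n * (x (n+1) + x (n-1))"
    and F_le: "\<And>n. n \<in> {1..N-1} \<Longrightarrow> (F n)\<^sup>2 \<le> p * w + q * (y n)\<^sup>2 + 2 * \<phi> n"
    and m: "m \<in> {1..N-1}"
  shows "(x (m+1))\<^sup>2 + (y (m+1))\<^sup>2 + \<kappa> * \<tau> * (\<Sum>n=1..N-1. D n) + \<theta> * \<tau> * (\<Sum>n=1..N-1. E n)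
    \<le> leapfrog_const T a b p q * ((x 0)\<^sup>2 + (x 1)\<^sup>2 + (y 0)\<^sup>2 + (y 1)\<^sup>2)
      + leapfrog_const T a b p q * \<tau> * (\<Sum>n=1..N. \<phi> n + w)"
proof -
  define M where "M = N - 1"
  have N: "N = Suc M" using m by (cases N) (simp_all add: M_def)
  have T: "T > 0" "\<tau> * real M \<le> T" using \<tau> by (auto simp: N distrib_left add_pos_nonneg)
  define Sx Sy where "Sx = (x 0)\<^sup>2 + (x 1)\<^sup>2" and "Sy = (y 0)\<^sup>2 + (y 1)\<^sup>2"
  define W where "W = \<tau> * (\<Sum>n=1..N. \<phi> n + w)"
  define e where "e = exp (a * T)"
  define Y where "Y = e * (Sy + b * (T * w))"
  have e: "e \<ge> 1" using nonneg(1) T(1) by (simp add: e_def)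
  have S0: "Sx \<ge> 0" "Sy \<ge> 0" by (simp_all add: Sx_def Sy_def)
  have Y0: "Y \<ge> 0" using e S0 nonneg T by (simp add: Y_def)
  have WW: "W = \<tau> * (\<Sum>n=1..N. \<phi> n) + T * w"
    by (simp add: W_def sum.distrib distrib_left flip: \<tau>(2) mult.assoc)
  have phi: "0 \<le> \<tau> * (\<Sum>n=1..M. \<phi> n)" "\<tau> * (\<Sum>n=1..M. \<phi> n) \<le> \<tau> * (\<Sum>n=1..N. \<phi> n)"
    using \<tau>(1) nonneg(13) by (auto intro!: mult_left_mono mult_nonneg_nonneg sum_nonneg simp: N)
  have W: "W \<ge> 0" "T * w \<le> W" "\<tau> * (\<Sum>n=1..M. \<phi> n) \<le> W"
    using phi nonneg T mult_nonneg_nonneg[of T w] unfolding WW by linarith+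

  have y_sq: "(y (n+1))\<^sup>2 + (y n)\<^sup>2 \<le> Y" if "n \<le> M" for n
  proof -
    have "(y (n+1))\<^sup>2 + (y n)\<^sup>2 \<le> exp (\<tau> * a * real n) * ((y (0+1))\<^sup>2 + (y 0)\<^sup>2 + real n * (\<tau> * (b * w)))"
    proof (rule discrete_gronwall[where s="\<lambda>n. (y (n+1))\<^sup>2 + (y n)\<^sup>2"])
      show "(y (Suc k + 1))\<^sup>2 + (y (Suc k))\<^sup>2 \<le> (1 + \<tau> * a) * ((y (k+1))\<^sup>2 + (y k)\<^sup>2) + \<tau> * (b * w)" if "k < M" for k
      proof -
        have "(y (Suc k + 1))\<^sup>2 - (y k)\<^sup>2 \<le> \<tau> * (a * (y (Suc k))\<^sup>2 + b * w)"
        proof -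
          have "0 \<le> \<theta> * \<tau> / 2 * E (Suc k)" using \<tau>(1) nonneg(7) nonneg(11) by simp
          then show ?thesis using y_step[of "Suc k"] that by (simp add: N)
        qed
        \<comment> \<open>The energy step supplies only the square at the middle level; the older
          one is added to complete the pair on the right.\<close>
        moreover have "0 \<le> \<tau> * a * (y k)\<^sup>2" using \<tau>(1) nonneg(1) by simp
        ultimately show ?thesis by (simp add: algebra_simps)
      qed
    qed (use \<tau>(1) nonneg that in auto)
    also have "\<dots> \<le> e * (Sy + b * (T * w))"
    proof (intro mult_mono)
      have nT: "\<tau> * real n \<le> T" using that \<tau>(1) T(2) by (meson less_imp_le mult_left_mono of_nat_le_iff order_trans)
      from mult_left_mono[OF nT nonneg(1)] show "exp (\<tau> * a * real n) \<le> e" by (simp add: e_def mult_ac)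
      from mult_right_mono[OF nT, of "b * w"] nonneg
      show "(y (0+1))\<^sup>2 + (y 0)\<^sup>2 + real n * (\<tau> * (b * w)) \<le> Sy + b * (T * w)"
        by (simp add: Sy_def mult_ac)
    qed (use e \<tau>(1) nonneg in auto)
    finally show ?thesis by (simp add: Y_def)
  qed
  have y_le: "(y n)\<^sup>2 \<le> Y" if "n \<le> N" for n
    using y_sq[of n] y_sq[of "n-1"] that by (cases n) (auto simp: N intro: order_trans[rotated])

  \<comment> \<open>The sum telescopes and the two squares at the far end are dropped. The
    dissipation carries only \<open>\<theta> * \<tau> / 2\<close>, whence the factors 2.\<close>
  have E_sum: "\<theta> * \<tau> * (\<Sum>n=1..M. E n) \<le> 2 * Sy + 2 * (a * T * Y + b * (T * w))"
  proof -
    have "(\<Sum>n=1..M. (y (n+1))\<^sup>2 - (y (n-1))\<^sup>2 + \<theta> * \<tau> / 2 * E n) \<le> (\<Sum>n=1..M. \<tau> * (a * Y + b * w))"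
    proof (rule sum_mono)
      fix n assume n: "n \<in> {1..M}"
      have "a * (y n)\<^sup>2 \<le> a * Y" using y_le[of n] n nonneg(1) by (intro mult_left_mono) (auto simp: N)
      then have "\<tau> * (a * (y n)\<^sup>2 + b * w) \<le> \<tau> * (a * Y + b * w)" using \<tau>(1) by (intro mult_left_mono) auto
      then show "(y (n+1))\<^sup>2 - (y (n-1))\<^sup>2 + \<theta> * \<tau> / 2 * E n \<le> \<tau> * (a * Y + b * w)"
        using y_step[of n] n by (simp add: N)
    qed
    also have "\<dots> = (\<tau> * real M) * (a * Y + b * w)" by simp
    also have "\<dots> \<le> T * (a * Y + b * w)"
      using T(2) nonneg Y0 by (intro mult_right_mono) auto
    finally have "(\<Sum>n=1..M. (y (n+1))\<^sup>2 - (y (n-1))\<^sup>2) + \<theta> * \<tau> / 2 * (\<Sum>n=1..M. E n) \<le> T * (a * Y + b * w)"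
      by (simp add: sum.distrib sum_distrib_left)
    moreover note sum_leapfrog_telescope[of "\<lambda>n. (y n)\<^sup>2" M]
    moreover have "(y (M+1))\<^sup>2 \<ge> 0" "(y M)\<^sup>2 \<ge> 0" by simp_all
    ultimately have "\<theta> * \<tau> / 2 * (\<Sum>n=1..M. E n) \<le> Sy + T * (a * Y + b * w)"
      unfolding Sy_def by linarith
    then show ?thesis by (simp add: algebra_simps)
  qed

  \<comment> \<open>\<open>R\<close> is the discrete L1 norm of the force in time, \<open>Q\<close>
    the square of its discrete L2 norm, and \<open>X\<close> will bound \<open>x\<close> at all
    levels.\<close>
  define R where "R = \<tau> * (\<Sum>n=1..M. F n)"
  define Q where "Q = \<tau> * (\<Sum>n=1..M. (F n)\<^sup>2)"
  define X where "X = x 0 + x 1 + 2 * R"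
  have R0: "R \<ge> 0" using \<tau>(1) nonneg(12) by (auto simp: R_def intro!: mult_nonneg_nonneg sum_nonneg)
  have Q: "Q \<le> p * W + q * T * Y + 2 * W"
  proof -
    have "(\<Sum>n=1..M. (F n)\<^sup>2) \<le> (\<Sum>n=1..M. (p * w + q * Y) + 2 * \<phi> n)"
    proof (rule sum_mono)
      fix n assume n: "n \<in> {1..M}"
      have "q * (y n)\<^sup>2 \<le> q * Y" using y_le[of n] n nonneg(4) by (intro mult_left_mono) (auto simp: N)
      then show "(F n)\<^sup>2 \<le> (p * w + q * Y) + 2 * \<phi> n" using F_le[of n] n by (simp add: N)
    qed
    also have "\<dots> = real M * (p * w + q * Y) + 2 * (\<Sum>n=1..M. \<phi> n)"
      by (simp add: sum.distrib sum_distrib_left)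
    finally have "Q \<le> \<tau> * (real M * (p * w + q * Y) + 2 * (\<Sum>n=1..M. \<phi> n))"
      unfolding Q_def using \<tau>(1) by (intro mult_left_mono) auto
    also have "\<dots> = (\<tau> * real M) * (p * w + q * Y) + 2 * (\<tau> * (\<Sum>n=1..M. \<phi> n))"
      by (simp add: algebra_simps)
    also have "\<dots> \<le> T * (p * w + q * Y) + 2 * W"
      using T(2) nonneg Y0 W(3) by (intro add_mono mult_right_mono) auto
    also have "T * (p * w + q * Y) \<le> p * W + q * T * Y"
      using mult_left_mono[OF W(2) nonneg(3)] by (simp add: algebra_simps)
    finally show ?thesis by simp
  qed
  \<comment> \<open>Cauchy-Schwarz in time, at the price of a factor \<open>T\<close>.\<close>
  have RQ: "R\<^sup>2 \<le> T * Q"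
  proof -
    have "(\<Sum>n=1..M. F n)\<^sup>2 \<le> real M * (\<Sum>n=1..M. (F n)\<^sup>2)"
      using Cauchy_Schwarz_ineq_sum[of "\<lambda>n. 1" F "{1..M}"] by simp
    then have "R\<^sup>2 \<le> \<tau>\<^sup>2 * (real M * (\<Sum>n=1..M. (F n)\<^sup>2))"
      by (simp add: R_def power_mult_distrib mult_left_mono)
    also have "\<dots> = (\<tau> * real M) * Q" by (simp add: Q_def power2_eq_square)
    also have "\<dots> \<le> T * Q"
      using T(2) \<tau>(1) by (intro mult_right_mono) (auto simp: Q_def intro!: mult_nonneg_nonneg sum_nonneg)
    finally show ?thesis .
  qed
  \<comment> \<open>The scheme links a level with the one two steps back, so the induction is strong
    and starts at both 0 and 1. Admitting all earlier forces instead of those of matching parity,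
    and both initial norms, gives one bound for both chains.\<close>
  have x_partial: "x n \<le> x 0 + x 1 + 2 * \<tau> * (\<Sum>k=1..n-1. F k)" if "n \<le> N" for n
    using that
  proof (induction n rule: less_induct)
    case (less n)
    show ?case
    proof (cases "n \<le> 1")
      case True
      then have "n = 0 \<or> n = 1" by auto
      then show ?thesis using nonneg(8)[of 0] nonneg(8)[of 1] by auto
    next
      case False
      then obtain k where k: "n = Suc (Suc k)" by (metis One_nat_def le_SucI not0_implies_Suc not_less_eq_eq zero_le)
      let ?k = "Suc k"
      have mem: "?k \<in> {1..N-1}" using less.prems k by auto
      have step: "x (Suc ?k) \<le> x k + 2 * \<tau> * F ?k"
      proof (rule ccontr)
        \<comment> \<open>The negation puts the new norm strictly above a nonnegative number; the
          sum of the two norms is then positive and can be cancelled.\<close>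
        assume c: "\<not> ?thesis"
        have "2 * \<tau> * F ?k \<ge> 0" using \<tau>(1) nonneg(12) by simp
        with c have pos: "x (Suc ?k) + x k > 0" using nonneg(8)[of k] by linarith
        have "(x (Suc ?k) - x k) * (x (Suc ?k) + x k) \<le> 2 * \<tau> * F ?k * (x (Suc ?k) + x k)"
        proof -
          have "0 \<le> \<kappa> * \<tau> * D ?k" using \<tau>(1) nonneg(6) nonneg(10)[of ?k] by simp
          with x_step[OF mem] have "(x (Suc ?k))\<^sup>2 - (x k)\<^sup>2 \<le> 2 * \<tau> * F ?k * (x (Suc ?k) + x k)" by simp
          then show ?thesis by (simp add: power2_eq_square algebra_simps)
        qed
        with pos have "x (Suc ?k) - x k \<le> 2 * \<tau> * F ?k" by (simp only: mult_le_cancel_right_pos)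
        with c show False by simp
      qed
      have "(\<Sum>j=1..k-1. F j) \<le> (\<Sum>j=1..k. F j)"
        using nonneg(12) by (intro sum_mono2) auto
      then have "2 * \<tau> * (\<Sum>j=1..k-1. F j) \<le> 2 * \<tau> * (\<Sum>j=1..k. F j)"
        using \<tau>(1) by (intro mult_left_mono) auto
      with step less.IH[of k] less.prems k show ?thesis by (simp add: distrib_left)
    qed
  qed
  have x_le: "x n \<le> X" if "n \<le> N" for n
  proof -
    have "(\<Sum>k=1..n-1. F k) \<le> (\<Sum>k=1..M. F k)"
      using that nonneg(12) by (intro sum_mono2) (auto simp: N)
    then have "2 * \<tau> * (\<Sum>k=1..n-1. F k) \<le> 2 * \<tau> * (\<Sum>k=1..M. F k)"
      using \<tau>(1) by (intro mult_left_mono) auto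
    then show ?thesis using x_partial[OF that] by (simp add: X_def R_def)
  qed
  have X0: "X \<ge> 0" using x_le[of 0] nonneg(8)[of 0] by simp
  have X2: "X\<^sup>2 \<le> 4 * Sx + 8 * R\<^sup>2"
  proof -
    have "X\<^sup>2 \<le> 2 * (x 0 + x 1)\<^sup>2 + 2 * (2 * R)\<^sup>2"
      using sum_squares_bound[of "x 0 + x 1" "2 * R"] by (simp add: X_def power2_sum)
    moreover have "(x 0 + x 1)\<^sup>2 \<le> 2 * Sx"
      using sum_squares_bound[of "x 0" "x 1"] by (simp add: Sx_def power2_sum)
    ultimately show ?thesis by (simp add: power_mult_distrib)
  qed
  \<comment> \<open>With \<open>X\<close> bounding both norms, the right sides add up to at most 4 X
    R, which is split by 2 X R <= X^2 + R^2.\<close>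
  have D_sum: "\<kappa> * \<tau> * (\<Sum>n=1..M. D n) \<le> Sx + 2 * X\<^sup>2 + 2 * R\<^sup>2"
  proof -
    have "(\<Sum>n=1..M. (x (n+1))\<^sup>2 - (x (n-1))\<^sup>2 + \<kappa> * \<tau> * D n) \<le> (\<Sum>n=1..M. 4 * X * (\<tau> * F n))"
    proof (rule sum_mono)
      fix n assume n: "n \<in> {1..M}"
      have "n + 1 \<le> N" "n - 1 \<le> N" using n N by auto
      then have "x (n+1) + x (n-1) \<le> 2 * X" using x_le[of "n+1"] x_le[of "n-1"] by linarith
      then have "2 * \<tau> * F n * (x (n+1) + x (n-1)) \<le> 2 * \<tau> * F n * (2 * X)"
        using \<tau>(1) nonneg(12)[of n] by (intro mult_left_mono) auto
      then show "(x (n+1))\<^sup>2 - (x (n-1))\<^sup>2 + \<kappa> * \<tau> * D n \<le> 4 * X * (\<tau> * F n)"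
        using x_step[of n] n by (simp add: N mult_ac)
    qed
    also have "\<dots> = 4 * X * R" by (simp add: R_def sum_distrib_left)
    also have "\<dots> \<le> 2 * X\<^sup>2 + 2 * R\<^sup>2" using sum_squares_bound[of X R] by simp
    finally have "(\<Sum>n=1..M. (x (n+1))\<^sup>2 - (x (n-1))\<^sup>2) + \<kappa> * \<tau> * (\<Sum>n=1..M. D n) \<le> 2 * X\<^sup>2 + 2 * R\<^sup>2"
      by (simp add: sum.distrib sum_distrib_left)
    moreover note sum_leapfrog_telescope[of "\<lambda>n. (x n)\<^sup>2" M]
    moreover have "(x (M+1))\<^sup>2 \<ge> 0" "(x M)\<^sup>2 \<ge> 0" by simp_all
    ultimately show ?thesis unfolding Sx_def by linarith
  qed
  have xm: "(x (m+1))\<^sup>2 \<le> X\<^sup>2" using x_le[of "m+1"] m nonneg(8) by (intro power_mono) auto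
  have ym: "(y (m+1))\<^sup>2 \<le> Y" using y_le[of "m+1"] m by auto

  define c1 where "c1 = e * (1 + b)"
  have c1: "c1 \<ge> 0" using e nonneg by (simp add: c1_def)
  have bS: "0 \<le> b * Sy" and bW: "b * (T * w) \<le> b * W"
    using nonneg(2) S0 W(2) by (auto intro: mult_left_mono)
  have Y1: "Y \<le> c1 * (Sy + W)"
  proof -
    have "Sy + b * (T * w) \<le> (1 + b) * (Sy + W)"
      using bS bW W(1) unfolding distrib_left distrib_right mult_1_left by linarith
    then show ?thesis unfolding Y_def c1_def using e by (simp add: mult.assoc mult_left_mono)
  qed
  have "T * Q \<le> T * (p * W + q * T * Y + 2 * W)"
    using Q T(1) by (intro mult_left_mono) auto
  also have "\<dots> \<le> T * (p * (Sy + W) + q * T * (c1 * (Sy + W)) + 2 * (Sy + W))"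
    using T(1) nonneg S0 Y1 by (intro mult_left_mono add_mono) auto
  finally have TQ: "R\<^sup>2 \<le> T * (p + 2 + q * T * c1) * (Sy + W)"
    using RQ by (simp add: algebra_simps)
  have aTY: "(1 + 2 * a * T) * Y \<le> (1 + 2 * a * T) * c1 * (Sy + W)"
    using mult_left_mono[OF Y1, of "1 + 2 * a * T"] nonneg(1) T(1) by (simp add: mult.assoc)
  \<comment> \<open>Origin of the numbers: the bound X^2 for the final velocity and the velocity
    dissipation give Sx + 3 X^2 + 2 R^2, which X^2 <= 4 Sx + 8 R^2 turns into 13 Sx + 26 R^2. The
    term 2 Sy from the concentration dissipation raises 13 to 15.\<close>
  define K where "K = leapfrog_const T a b p q"
  have K: "K = 15 + 26 * (T * (p + 2 + q * T * c1)) + (1 + 2 * a * T) * c1 + 2 * b"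
    by (simp add: K_def leapfrog_const_def c1_def e_def)
  have K13: "K \<ge> 13"
    unfolding K using T(1) nonneg c1 by simp
  have "(x (m+1))\<^sup>2 + (y (m+1))\<^sup>2 + \<kappa> * \<tau> * (\<Sum>n=1..M. D n) + \<theta> * \<tau> * (\<Sum>n=1..M. E n)
     \<le> 13 * Sx + 26 * R\<^sup>2 + (1 + 2 * a * T) * Y + 2 * Sy + 2 * (b * (T * w))"
  proof -
    have "A + B + C + D' \<le> 13 * s + 26 * r + (y' + 2 * z) + 2 * t + 2 * z'"
      if "A \<le> X'" "B \<le> y'" "C \<le> s + 2 * X' + 2 * r" "D' \<le> 2 * t + 2 * (z + z')" "X' \<le> 4 * s + 8 * r"
      for A B C D' X' y' s r t z z' :: real
      using that by argo
    moreover have "(1 + 2 * a * T) * Y = Y + 2 * (a * T * Y)" by (simp add: distrib_right)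
    ultimately show ?thesis using xm ym D_sum E_sum X2 by presburger
  qed
  also have "\<dots> \<le> 13 * Sx + 26 * (T * (p + 2 + q * T * c1) * (Sy + W)) + (1 + 2 * a * T) * c1 * (Sy + W) + 2 * (Sy + W) + 2 * b * (Sy + W)"
  proof -
    have "A + 26 * r + B + 2 * Sy + 2 * C \<le> A + 26 * r' + B' + 2 * (Sy + W) + (2 * C' + 2 * C'')"
      if "r \<le> r'" "B \<le> B'" "C \<le> C''" "0 \<le> C'" for A B B' C C' C'' r r' :: real
      using that W(1) by argo
    moreover have "2 * b * (Sy + W) = 2 * (b * Sy) + 2 * (b * W)" by (simp add: distrib_left)
    ultimately show ?thesis using TQ aTY bS bW by presburger
  qed
  also have "\<dots> = 13 * Sx + (K - 13) * (Sy + W)"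
    unfolding K by (simp add: algebra_simps)
  also have "\<dots> \<le> K * Sx + K * (Sy + W)"
    using K13 S0 W(1) by (intro add_mono mult_right_mono) auto
  finally show ?thesis
    by (simp add: K_def Sx_def Sy_def W_def M_def algebra_simps)
qed

section \<open>Energy estimates\<close>

context
  fixes \<Omega> :: "(real^2) set"
  assumes \<Omega>: "open \<Omega>" "bounded \<Omega>"
begin

text \<open>The unit vector does not change the norm, so the field is measured as the scalar g + g
  \<gamma> c; the factor 2 is the price of splitting that sum.\<close>

lemma buoyancy_L2:
  assumes "c \<in> L2 \<Omega>"
  shows "(\<lambda>x. (g * (1 + \<gamma> * c x)) *\<^sub>R axis 2 1 :: real^2) \<in> L2 \<Omega>"
    and "(L2_norm \<Omega> (\<lambda>x. (g * (1 + \<gamma> * c x)) *\<^sub>R axis 2 1 :: real^2))\<^sup>2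
      \<le> 2 * g\<^sup>2 * measure lebesgue \<Omega> + 2 * g\<^sup>2 * \<gamma>\<^sup>2 * (L2_norm \<Omega> c)\<^sup>2"
proof -
  let ?e = "axis 2 1 :: real^2"
  let ?s = "\<lambda>x. g *\<^sub>R 1 + (g * \<gamma>) *\<^sub>R c x"
  have s: "?s \<in> L2 \<Omega>"
    by (intro L2_add L2_scaleR assms const_L2 \<Omega>)
  have inner: "(r *\<^sub>R ?e) \<bullet> (r *\<^sub>R ?e) = r \<bullet> r" "norm (r *\<^sub>R ?e) = \<bar>r\<bar>" for r :: real
    by (simp_all add: inner_axis norm_axis_1)
  have eq: "(\<lambda>x. (g * (1 + \<gamma> * c x)) *\<^sub>R ?e) = (\<lambda>x. ?s x *\<^sub>R ?e)"
    by (simp add: algebra_simps)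
  show "(\<lambda>x. (g * (1 + \<gamma> * c x)) *\<^sub>R ?e) \<in> L2 \<Omega>"
    unfolding eq using s borel_measurable_scaleR[OF L2_measurable[OF s] borel_measurable_const[of ?e]]
    by (simp add: L2_def inner del: norm_scaleR)
  have "L2_norm \<Omega> (\<lambda>x. (g * (1 + \<gamma> * c x)) *\<^sub>R ?e) = L2_norm \<Omega> ?s"
    unfolding eq by (simp only: L2_norm_def L2_inner_def inner)
  then show "(L2_norm \<Omega> (\<lambda>x. (g * (1 + \<gamma> * c x)) *\<^sub>R ?e))\<^sup>2
      \<le> 2 * g\<^sup>2 * measure lebesgue \<Omega> + 2 * g\<^sup>2 * \<gamma>\<^sup>2 * (L2_norm \<Omega> c)\<^sup>2"
    using L2_norm_lincomb_le[OF const_L2[OF \<Omega>, of 1] assms, of g "g * \<gamma>"]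
    by (simp add: L2_norm_one_square[OF \<Omega>] power_mult_distrib mult.assoc)
qed

text \<open>The right side deliberately stays a product of norms: Young's inequality would put the
  square of the new level on the right or call for a Poincare inequality. The norm of the mean is at
  most half the sum of the norms, and the factor 4 \<tau> turns the gradient of the mean into that
  of the sum.\<close>

lemma velocity_energy_step:
  fixes \<kappa> \<tau> g \<gamma> \<alpha> :: real and c p :: "real^2 \<Rightarrow> real" and f :: "real^2 \<Rightarrow> real^2"
  assumes \<nu>: "\<And>x. \<kappa> \<le> \<nu> x \<and> \<nu> x \<le> K" "\<kappa> > 0" "continuous_on UNIV \<nu>" and "\<tau> > 0"
    and u: "u \<in> V_h \<Omega> \<T>" "v \<in> V_h \<Omega> \<T>" "w \<in> V_h \<Omega> \<T>" and c: "c \<in> L2 \<Omega>" and f: "f \<in> L2 \<Omega>"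
    and momentum: "L2_inner \<Omega> (central_diff \<tau> u v) (mean u v) + form_A \<Omega> \<nu> \<alpha> c (mean u v) (mean u v)
       + form_B \<Omega> w (mean u v) (mean u v) - L2_inner \<Omega> p (weak_div \<Omega> (mean u v))
       = - L2_inner \<Omega> (\<lambda>x. (g * (1 + \<gamma> * c x)) *\<^sub>R axis 2 1) (mean u v) + L2_inner \<Omega> f (mean u v)"
    and div_free: "L2_inner \<Omega> (weak_div \<Omega> (mean u v)) p = 0"
  shows "(L2_norm \<Omega> u)\<^sup>2 - (L2_norm \<Omega> v)\<^sup>2 + \<kappa> * \<tau> * (L2_norm \<Omega> (weak_jac \<Omega> (\<lambda>x. u x + v x)))\<^sup>2
    \<le> 2 * \<tau> * (L2_norm \<Omega> (\<lambda>x. (g * (1 + \<gamma> * c x)) *\<^sub>R axis 2 1 :: real^2) + L2_norm \<Omega> f) * (L2_norm \<Omega> u + L2_norm \<Omega> v)"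
proof -
  let ?m = "mean u v" and ?G = "\<lambda>x. (g * (1 + \<gamma> * c x)) *\<^sub>R axis 2 1 :: real^2"
  note uL = V_h_L2[OF \<Omega> u(1)] V_h_L2[OF \<Omega> u(2)]
  have m: "?m \<in> V_h \<Omega> \<T>" by (rule V_h_mean[OF \<Omega> u(1,2)])
  note mL = V_h_L2[OF \<Omega> m]
  have "form_A \<Omega> \<nu> \<alpha> c ?m ?m \<ge> \<kappa> * (L2_norm \<Omega> (weak_jac \<Omega> ?m))\<^sup>2"
    by (rule form_A_coercive[OF \<Omega> \<nu> c m])
  moreover have "form_B \<Omega> w ?m ?m = 0" by (rule form_B_skew[OF \<Omega> u(3) m])
  moreover have "\<bar>L2_inner \<Omega> ?G ?m\<bar> \<le> L2_norm \<Omega> ?G * L2_norm \<Omega> ?m"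
    by (rule L2_Cauchy_Schwarz[OF buoyancy_L2(1)[OF c] mL])
  moreover have "\<bar>L2_inner \<Omega> f ?m\<bar> \<le> L2_norm \<Omega> f * L2_norm \<Omega> ?m"
    by (rule L2_Cauchy_Schwarz[OF f mL])
  moreover note momentum div_free L2_inner_commute[of \<Omega> p]
  ultimately have "L2_inner \<Omega> (central_diff \<tau> u v) ?m + \<kappa> * (L2_norm \<Omega> (weak_jac \<Omega> ?m))\<^sup>2
      \<le> (L2_norm \<Omega> ?G + L2_norm \<Omega> f) * L2_norm \<Omega> ?m"
    by (simp add: distrib_right)
  also have "\<dots> \<le> (L2_norm \<Omega> ?G + L2_norm \<Omega> f) * ((L2_norm \<Omega> u + L2_norm \<Omega> v) / 2)"
  proof (intro mult_left_mono)
    have "?m = (\<lambda>x. (1/2) *\<^sub>R (u x + v x))" by (simp add: mean_def[abs_def])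
    then have "L2_norm \<Omega> ?m = 1/2 * L2_norm \<Omega> (\<lambda>x. u x + v x)"
      by (simp only: L2_norm_scaleR)
    then show "L2_norm \<Omega> ?m \<le> (L2_norm \<Omega> u + L2_norm \<Omega> v) / 2"
      using L2_norm_triangle[OF uL] by simp
  qed (simp add: L2_norm_nonneg)
  finally have le: "4 * \<tau> * (L2_inner \<Omega> (central_diff \<tau> u v) ?m + \<kappa> * (L2_norm \<Omega> (weak_jac \<Omega> ?m))\<^sup>2)
      \<le> 4 * \<tau> * ((L2_norm \<Omega> ?G + L2_norm \<Omega> f) * ((L2_norm \<Omega> u + L2_norm \<Omega> v) / 2))"
    using \<open>\<tau> > 0\<close> by (intro mult_left_mono) auto
  have lhs: "4 * \<tau> * (A + \<kappa> * B\<^sup>2) = 4 * \<tau> * A + \<kappa> * \<tau> * (2 * B)\<^sup>2" for A B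
    by (simp add: power2_eq_square algebra_simps)
  have rhs: "4 * \<tau> * (A * (B / 2)) = 2 * \<tau> * A * B" for A B
    by simp
  have diff: "4 * \<tau> * L2_inner \<Omega> (central_diff \<tau> u v) ?m = (L2_norm \<Omega> u)\<^sup>2 - (L2_norm \<Omega> v)\<^sup>2"
    using L2_inner_central_diff_mean[OF uL, of \<tau>] \<open>\<tau> > 0\<close> by simp
  show ?thesis
    using le unfolding lhs rhs diff L2_norm_weak_jac_sum[OF \<Omega> u(1,2)] .
qed

text \<open>Here \<open>c\<close> and \<open>d\<close> are the new and the old level and
  \<open>e\<close> is the middle one. Both sources are paired with the second partial derivative of
  the mean, so they merge into U e + U \<alpha>, and Young's inequality weighted by \<theta> absorbs
  the gradient into half of the diffusion. The new level does not reappear on the right.\<close>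

lemma concentration_energy_step:
  fixes \<theta> \<tau> U \<alpha> :: real and e :: "real^2 \<Rightarrow> real"
  assumes "\<theta> > 0" "\<tau> > 0"
    and w: "w \<in> V_h \<Omega> \<T>" and c: "c \<in> H_tilde_h \<Omega> \<T>" "d \<in> H_tilde_h \<Omega> \<T>" and e: "e \<in> L2 \<Omega>"
    and transport: "L2_inner \<Omega> (central_diff \<tau> c d) (mean c d)
       + \<theta> * L2_inner \<Omega> (weak_grad \<Omega> (mean c d)) (weak_grad \<Omega> (mean c d))
       + form_b \<Omega> w (mean c d) (mean c d) - U * L2_inner \<Omega> e (\<lambda>x. weak_grad \<Omega> (mean c d) x $ 2)
       = U * \<alpha> * L2_inner \<Omega> (\<lambda>x. 1) (\<lambda>x. weak_grad \<Omega> (mean c d) x $ 2)"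
  shows "(L2_norm \<Omega> c)\<^sup>2 - (L2_norm \<Omega> d)\<^sup>2 + \<theta> * \<tau> / 2 * (L2_norm \<Omega> (weak_grad \<Omega> (\<lambda>x. c x + d x)))\<^sup>2
    \<le> \<tau> * (4 * U\<^sup>2 / \<theta> * (L2_norm \<Omega> e)\<^sup>2 + 4 * U\<^sup>2 * \<alpha>\<^sup>2 / \<theta> * measure lebesgue \<Omega>)"
proof -
  let ?m = "mean c d"
  define G where "G = weak_grad \<Omega> ?m"
  have m: "?m \<in> H_tilde_h \<Omega> \<T>" by (rule H_tilde_h_mean[OF \<Omega> c])
  have GL: "G \<in> L2 \<Omega>" unfolding G_def by (rule weak_grad_L2[OF H_tilde_hD(1)[OF \<Omega> m]])
  have G2: "(\<lambda>x. G x $ 2) \<in> L2 \<Omega>" by (rule L2_component[OF GL])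
  have one: "(\<lambda>x. 1::real) \<in> L2 \<Omega>" by (rule const_L2[OF \<Omega>])
  let ?r = "\<lambda>x. U *\<^sub>R e x + (U * \<alpha>) *\<^sub>R 1"
  have r: "?r \<in> L2 \<Omega>" by (intro L2_add L2_scaleR e one)
  have r_le: "(L2_norm \<Omega> ?r)\<^sup>2 \<le> 2 * U\<^sup>2 * (L2_norm \<Omega> e)\<^sup>2 + 2 * (U * \<alpha>)\<^sup>2 * measure lebesgue \<Omega>"
    using L2_norm_lincomb_le[OF e one, of U "U * \<alpha>"] unfolding L2_norm_one_square[OF \<Omega>] .
  have "L2_inner \<Omega> ?r (\<lambda>x. G x $ 2) = U * L2_inner \<Omega> e (\<lambda>x. G x $ 2) + U * \<alpha> * L2_inner \<Omega> (\<lambda>x. 1) (\<lambda>x. G x $ 2)"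
    by (simp only: L2_inner_add_left[OF L2_scaleR[OF e] L2_scaleR[OF one] G2] L2_inner_scaleR_left)
  moreover have "form_b \<Omega> w ?m ?m = 0"
    by (rule form_b_skew[OF \<Omega> w H_tilde_hD(1,3)[OF \<Omega> m]])
  ultimately have eq: "L2_inner \<Omega> (central_diff \<tau> c d) ?m + \<theta> * (L2_norm \<Omega> G)\<^sup>2 = L2_inner \<Omega> ?r (\<lambda>x. G x $ 2)"
    using transport by (simp add: G_def L2_norm_square)
  have "(L2_norm \<Omega> (\<lambda>x. G x $ 2))\<^sup>2 \<le> (L2_norm \<Omega> G)\<^sup>2"
    unfolding L2_norm_square L2_inner_def
  proof (rule integral_mono)
    show "G x $ 2 \<bullet> G x $ 2 \<le> G x \<bullet> G x" for x
      using power_mono[OF component_le_norm_cart[of "G x" 2], of 2]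
      by (simp add: power2_eq_square dot_square_norm)
  qed (intro L2_inner_integrable GL G2)+
  then have "L2_norm \<Omega> (\<lambda>x. G x $ 2) \<le> L2_norm \<Omega> G"
    by (rule power2_le_imp_le) (rule L2_norm_nonneg)
  then have "L2_inner \<Omega> ?r (\<lambda>x. G x $ 2) \<le> L2_norm \<Omega> ?r * L2_norm \<Omega> G"
    using L2_Cauchy_Schwarz[OF r G2] mult_left_mono[OF _ L2_norm_nonneg[of \<Omega> ?r]]
    by (meson abs_le_D1 order_trans)
  also have "\<dots> \<le> \<theta> / 2 * (L2_norm \<Omega> G)\<^sup>2 + (L2_norm \<Omega> ?r)\<^sup>2 / (2 * \<theta>)"
  proof -
    have "0 \<le> (\<theta> * L2_norm \<Omega> G - L2_norm \<Omega> ?r)\<^sup>2 / (2 * \<theta>)" using \<open>\<theta> > 0\<close> by simp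
    also have "\<dots> = \<theta> / 2 * (L2_norm \<Omega> G)\<^sup>2 + (L2_norm \<Omega> ?r)\<^sup>2 / (2 * \<theta>) - L2_norm \<Omega> ?r * L2_norm \<Omega> G"
      using \<open>\<theta> > 0\<close> by (simp add: power2_diff field_simps power2_eq_square)
    finally show ?thesis by simp
  qed
  also have "(L2_norm \<Omega> ?r)\<^sup>2 / (2 * \<theta>) \<le> (2 * U\<^sup>2 * (L2_norm \<Omega> e)\<^sup>2 + 2 * (U * \<alpha>)\<^sup>2 * measure lebesgue \<Omega>) / (2 * \<theta>)"
    using r_le \<open>\<theta> > 0\<close> by (intro divide_right_mono) auto
  finally have "L2_inner \<Omega> (central_diff \<tau> c d) ?m + \<theta> / 2 * (L2_norm \<Omega> G)\<^sup>2
     \<le> (2 * U\<^sup>2 * (L2_norm \<Omega> e)\<^sup>2 + 2 * (U * \<alpha>)\<^sup>2 * measure lebesgue \<Omega>) / (2 * \<theta>)"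
    using eq by simp
  then have le: "4 * \<tau> * (L2_inner \<Omega> (central_diff \<tau> c d) ?m + \<theta> / 2 * (L2_norm \<Omega> G)\<^sup>2)
     \<le> 4 * \<tau> * ((2 * U\<^sup>2 * (L2_norm \<Omega> e)\<^sup>2 + 2 * (U * \<alpha>)\<^sup>2 * measure lebesgue \<Omega>) / (2 * \<theta>))"
    using \<open>\<tau> > 0\<close> by (intro mult_left_mono) auto
  have lhs: "4 * \<tau> * (A + \<theta> / 2 * B\<^sup>2) = 4 * \<tau> * A + \<theta> * \<tau> / 2 * (2 * B)\<^sup>2" for A B
    by (simp add: power2_eq_square algebra_simps)
  have rhs: "4 * \<tau> * ((2 * U\<^sup>2 * X + 2 * (U * \<alpha>)\<^sup>2 * Z) / (2 * \<theta>))
      = \<tau> * (4 * U\<^sup>2 / \<theta> * X + 4 * U\<^sup>2 * \<alpha>\<^sup>2 / \<theta> * Z)" for X Z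
    using \<open>\<theta> > 0\<close> by (simp add: power_mult_distrib field_simps)
  have diff: "4 * \<tau> * L2_inner \<Omega> (central_diff \<tau> c d) ?m = (L2_norm \<Omega> c)\<^sup>2 - (L2_norm \<Omega> d)\<^sup>2"
    using L2_inner_central_diff_mean[OF H_tilde_hD(2)[OF \<Omega> c(1)] H_tilde_hD(2)[OF \<Omega> c(2)], of \<tau>] \<open>\<tau> > 0\<close> by simp
  have grad: "L2_norm \<Omega> (weak_grad \<Omega> (\<lambda>x. c x + d x)) = 2 * L2_norm \<Omega> G"
    unfolding G_def by (rule L2_norm_weak_grad_sum[OF \<Omega> H_tilde_hD(1)[OF \<Omega> c(1)] H_tilde_hD(1)[OF \<Omega> c(2)]])
  show ?thesis
    using le unfolding lhs rhs diff grad .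
qed

end

theorem theorem3p1:
  fixes \<Omega> :: "(real^2) set"
    and \<theta> g \<gamma> U \<alpha> \<kappa> \<beta> T :: real
    and \<nu> :: "real \<Rightarrow> real"
    and I :: "real set"
    and \<T> :: "real \<Rightarrow> (real^2 \<Rightarrow> real^2) set"
  assumes domain: "bounded_domain \<Omega>" "smooth_boundary \<Omega>"
    and constants: "\<theta> > 0" "g > 0" "\<gamma> > 0" "U > 0" "\<alpha> > 0" "T > 0"
    and viscosity_constants: "\<kappa> > 0" "\<beta> > 0"
    and viscosity_bounds: "\<And>x. \<kappa> \<le> \<nu> x \<and> \<nu> x \<le> 1 / \<kappa>"
    and viscosity_lipschitz: "\<And>x1 x2. \<bar>\<nu> x1 - \<nu> x2\<bar> \<le> \<beta> * \<bar>x1 - x2\<bar>"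
    and meshes: "quasi_uniform_family \<Omega> I \<T>"
  shows "\<exists>C>0. \<forall>h\<in>I. \<forall>N\<ge>1.
    \<forall>(f :: real \<Rightarrow> real^2 \<Rightarrow> real^2) (u :: nat \<Rightarrow> real^2 \<Rightarrow> real^2)
     (c :: nat \<Rightarrow> real^2 \<Rightarrow> real) (p :: nat \<Rightarrow> real^2 \<Rightarrow> real).
      let \<tau> = T / real N; fn = (\<lambda>n. f (real n * \<tau>)) in
      (\<forall>n\<in>{0..N}. fn n \<in> L2 \<Omega>) \<longrightarrow>
      u 0 \<in> V_h \<Omega> (\<T> h) \<longrightarrow> u 1 \<in> V_h \<Omega> (\<T> h) \<longrightarrow>
      c 0 \<in> H_tilde_h \<Omega> (\<T> h) \<longrightarrow> c 1 \<in> H_tilde_h \<Omega> (\<T> h) \<longrightarrow>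
      cnlf_solution \<Omega> (\<T> h) \<nu> \<theta> g \<gamma> U \<alpha> \<tau> N fn u c p \<longrightarrow>
      (\<forall>m\<in>{1..N-1}.
        (L2_norm \<Omega> (u (m+1)))\<^sup>2 + (L2_norm \<Omega> (c (m+1)))\<^sup>2
        + \<kappa> * \<tau> * (\<Sum>n=1..N-1. (L2_norm \<Omega> (weak_jac \<Omega> (\<lambda>x. u (n+1) x + u (n-1) x)))\<^sup>2)
        + \<theta> * \<tau> * (\<Sum>n=1..N-1. (L2_norm \<Omega> (weak_grad \<Omega> (\<lambda>x. c (n+1) x + c (n-1) x)))\<^sup>2)
        \<le> C * ((L2_norm \<Omega> (u 0))\<^sup>2 + (L2_norm \<Omega> (u 1))\<^sup>2
               + (L2_norm \<Omega> (c 0))\<^sup>2 + (L2_norm \<Omega> (c 1))\<^sup>2)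
          + C * \<tau> * (\<Sum>n=1..N. ((L2_norm \<Omega> (fn n))\<^sup>2 + measure lebesgue \<Omega>)))"
proof -
  have \<Omega>: "open \<Omega>" "bounded \<Omega>" using domain by (auto simp: bounded_domain_def)
  have \<nu>_cont: "continuous_on UNIV \<nu>"
  proof (rule lipschitz_on_continuous_on)
    show "\<beta>-lipschitz_on UNIV \<nu>"
      using viscosity_lipschitz viscosity_constants by (intro lipschitz_onI) (auto simp: dist_real_def)
  qed
  \<comment> \<open>\<open>a\<close> and \<open>b\<close> are the coefficients in
    \<open>concentration_energy_step\<close>; \<open>p0\<close> and \<open>q0\<close> are twice
    those in \<open>buoyancy_L2\<close>, because the square of \<open>F n\<close> is split into two
    squares. All four are fixed before \<open>h\<close>, \<open>N\<close> and the data.\<close>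
  define a b p0 q0 where "a = 4 * U\<^sup>2 / \<theta>" and "b = 4 * U\<^sup>2 * \<alpha>\<^sup>2 / \<theta>" and "p0 = 4 * g\<^sup>2" and "q0 = 4 * g\<^sup>2 * \<gamma>\<^sup>2"
  have nonneg: "a \<ge> 0" "b \<ge> 0" "p0 \<ge> 0" "q0 \<ge> 0" using constants by (auto simp: a_def b_def p0_def q0_def)
  define C where "C = leapfrog_const T a b p0 q0"
  have "C > 0"
    using nonneg constants unfolding C_def leapfrog_const_def by (intro add_pos_nonneg) auto
  have bound: "(L2_norm \<Omega> (u (m+1)))\<^sup>2 + (L2_norm \<Omega> (c (m+1)))\<^sup>2
        + \<kappa> * \<tau> * (\<Sum>n=1..N-1. (L2_norm \<Omega> (weak_jac \<Omega> (\<lambda>x. u (n+1) x + u (n-1) x)))\<^sup>2)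
        + \<theta> * \<tau> * (\<Sum>n=1..N-1. (L2_norm \<Omega> (weak_grad \<Omega> (\<lambda>x. c (n+1) x + c (n-1) x)))\<^sup>2)
        \<le> C * ((L2_norm \<Omega> (u 0))\<^sup>2 + (L2_norm \<Omega> (u 1))\<^sup>2
               + (L2_norm \<Omega> (c 0))\<^sup>2 + (L2_norm \<Omega> (c 1))\<^sup>2)
          + C * \<tau> * (\<Sum>n=1..N. ((L2_norm \<Omega> (fn n))\<^sup>2 + measure lebesgue \<Omega>))"
    if N: "N \<ge> 1" and \<tau>_def: "\<tau> = T / real N" and fn: "\<forall>n\<in>{0..N}. fn n \<in> L2 \<Omega>"
      and init: "u 0 \<in> V_h \<Omega> (\<T> h)" "u 1 \<in> V_h \<Omega> (\<T> h)" "c 0 \<in> H_tilde_h \<Omega> (\<T> h)" "c 1 \<in> H_tilde_h \<Omega> (\<T> h)"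
      and sol: "cnlf_solution \<Omega> (\<T> h) \<nu> \<theta> g \<gamma> U \<alpha> \<tau> N fn u c p" and m: "m \<in> {1..N-1}"
    for N h \<tau> m and fn u :: "nat \<Rightarrow> real^2 \<Rightarrow> real^2" and c p :: "nat \<Rightarrow> real^2 \<Rightarrow> real"
  proof -
    have \<tau>: "\<tau> > 0" "\<tau> * real N = T" using N constants by (auto simp: \<tau>_def)
    have uV: "u n \<in> V_h \<Omega> (\<T> h)" and cH: "c n \<in> H_tilde_h \<Omega> (\<T> h)" if "n \<le> N" for n
    proof -
      \<comment> \<open>The solution predicate places the levels from 2 on in the discrete spaces,
        indexed by the step that computes them; the levels 0 and 1 are initial data.\<close>
      consider "n = 0" | "n = 1" | "n - 1 \<in> {1..N-1}" "n = (n - 1) + 1" using \<open>n \<le> N\<close> by force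
      then have "u n \<in> V_h \<Omega> (\<T> h) \<and> c n \<in> H_tilde_h \<Omega> (\<T> h)"
      proof cases
        case 3
        then show ?thesis using sol unfolding cnlf_solution_def by metis
      qed (use init in auto)
      then show "u n \<in> V_h \<Omega> (\<T> h)" "c n \<in> H_tilde_h \<Omega> (\<T> h)" by auto
    qed
    define F where "F n = L2_norm \<Omega> (\<lambda>x. (g * (1 + \<gamma> * c n x)) *\<^sub>R axis 2 1 :: real^2) + L2_norm \<Omega> (fn n)" for n
    show ?thesis
      unfolding C_def
    proof (rule leapfrog_gronwall[OF \<tau>, where F=F])
      fix n assume n: "n \<in> {1..N-1}"
      then have le: "n + 1 \<le> N" "n - 1 \<le> N" "n \<le> N" by auto
      have cn: "c n \<in> L2 \<Omega>" by (rule H_tilde_hD(2)[OF \<Omega> cH[OF le(3)]])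
      have fL: "fn n \<in> L2 \<Omega>" using fn le by auto
      have mV: "mean (u (n+1)) (u (n-1)) \<in> V_h \<Omega> (\<T> h)"
        by (rule V_h_mean[OF \<Omega> uV[OF le(1)] uV[OF le(2)]])
      have mH: "mean (c (n+1)) (c (n-1)) \<in> H_tilde_h \<Omega> (\<T> h)"
        by (rule H_tilde_h_mean[OF \<Omega> cH[OF le(1)] cH[OF le(2)]])
      \<comment> \<open>The discrete pressure is itself an admissible test function of the
        divergence constraint, which is how the pressure term disappears.\<close>
      have pM: "p n \<in> M_h \<Omega> (\<T> h)" using sol n unfolding cnlf_solution_def by blast
      note eqs = sol[unfolded cnlf_solution_def, THEN conjunct2, rule_format, OF n]
      show "(L2_norm \<Omega> (c (n+1)))\<^sup>2 - (L2_norm \<Omega> (c (n-1)))\<^sup>2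
          + \<theta> * \<tau> / 2 * (L2_norm \<Omega> (weak_grad \<Omega> (\<lambda>x. c (n+1) x + c (n-1) x)))\<^sup>2
        \<le> \<tau> * (a * (L2_norm \<Omega> (c n))\<^sup>2 + b * measure lebesgue \<Omega>)"
        unfolding a_def b_def
        by (rule concentration_energy_step[OF \<Omega> constants(1) \<tau>(1) uV[OF le(3)] cH[OF le(1)] cH[OF le(2)] cn])
          (use eqs mH in blast)
      show "(L2_norm \<Omega> (u (n+1)))\<^sup>2 - (L2_norm \<Omega> (u (n-1)))\<^sup>2
          + \<kappa> * \<tau> * (L2_norm \<Omega> (weak_jac \<Omega> (\<lambda>x. u (n+1) x + u (n-1) x)))\<^sup>2
        \<le> 2 * \<tau> * F n * (L2_norm \<Omega> (u (n+1)) + L2_norm \<Omega> (u (n-1)))"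
        unfolding F_def
        by (rule velocity_energy_step[OF \<Omega> viscosity_bounds viscosity_constants(1) \<nu>_cont \<tau>(1)
              uV[OF le(1)] uV[OF le(2)] uV[OF le(3)] cn fL])
          (use eqs mV pM in blast)+
      have "(F n)\<^sup>2 \<le> 2 * (L2_norm \<Omega> (\<lambda>x. (g * (1 + \<gamma> * c n x)) *\<^sub>R axis 2 1 :: real^2))\<^sup>2 + 2 * (L2_norm \<Omega> (fn n))\<^sup>2"
        unfolding F_def
        using sum_squares_bound[of "L2_norm \<Omega> (\<lambda>x. (g * (1 + \<gamma> * c n x)) *\<^sub>R axis 2 1 :: real^2)" "L2_norm \<Omega> (fn n)"]
        by (simp add: power2_sum)
      then show "(F n)\<^sup>2 \<le> p0 * measure lebesgue \<Omega> + q0 * (L2_norm \<Omega> (c n))\<^sup>2 + 2 * (L2_norm \<Omega> (fn n))\<^sup>2"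
        using buoyancy_L2(2)[OF \<Omega> cn, of g \<gamma>] by (simp add: p0_def q0_def)
    qed (use nonneg constants viscosity_constants m in \<open>simp_all add: L2_norm_nonneg F_def\<close>)
  qed
  show ?thesis
    unfolding Let_def
    by (rule exI[of _ C], rule conjI, fact, intro ballI allI impI, rule bound[OF _ refl])
qed

end
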